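(* Let $f$ be a $\mathrm{TVMSOL}^2$-Specker function. Then for every $m\in\mathbb{N}$, $m\ge 1$, the function $f$ satisfies a linear recurrence relation with constant coefficients modulo $m$; that is, there are $d\ge 1$ and integers $a_1,\ldots,a_d$ (depending on $m$) such that $f(n)\equiv\sum_{j=1}^{d}a_j f(n-j)\pmod m$ for all $n>d$.
   Context: $[n]=\{1,\ldots,n\}$; structures have nonempty universes, so counting functions are considered for arguments $n\ge 1$. $\mathrm{MSOL}$ is Monadic Second Order Logic (first order logic with equality extended by quantification over subsets of the universe). Let $\bar R=(R_1,\ldots,R_s)$ be a finite tuple of relation symbols and $<_1$ an additional binary symbol to be interpreted as a linear order of the universe. An $\mathrm{MSOL}$-sentence $\phi$ over $\bar R\cup\{<_1\}$ is truth-value order invariant if for every $n$, every interpretation of $\bar R$ on $[n]$ and any two linear orders $<$, $<'$ of $[n]$, we have $\langle[n],<,\bar R\rangle\models\phi$ iff $\langle[n],<',\bar R\rangle\models\phi$. $\mathrm{TVMSOL}$ denotes the set of truth-value order invariant $\mathrm{MSOL}$-sentences; such a sentence is regarded as a sentence about $\bar R$-structures: a finite $\bar R$-structure satisfies $\phi$ iff its expansion by some (equivalently, every) linear order of the universe satisfies $\phi$. A function $f:\{1,2,\ldots\}\to\mathbb{N}$ is a $\mathrm{TVMSOL}^k$-Specker function if there are a finite set $\bar R$ of relation symbols of arity at most $k$ and a class $\mathcal{K}$ of finite $\bar R$-structures defined by a $\mathrm{TVMSOL}$-sentence such that for all $n$, $f(n)$ is the number of $\bar R$-structures with universe $[n]$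 (i.e. of interpretations of $\bar R$ on $[n]$) belonging to $\mathcal{K}$. *)

theory Defs
  imports "HOL-Library.FuncSet" "HOL-Number_Theory.Cong"
begin

text \<open>
  A finite relational vocabulary \<open>R\<^sub>0, \<dots>, R\<^sub>s\<^sub>-\<^sub>1\<close> is given by its list \<open>ar\<close> of arities.
  First-order and set variables are two separate sorts, each named by natural numbers.
  The remaining connectives and the universal quantifiers are definable from those below.
\<close>

datatype msol =
    Eq nat nat
  | Less nat nat
  | Rel nat "nat list"
  | Mem nat nat
  | Neg msol
  | Conj msol msol
  | ExElem nat msol
  | ExSet nat msol

fun fo_free :: "msol \<Rightarrow> nat set" where
  "fo_free (Eq x y) = {x, y}"
| "fo_free (Less x y) = {x, y}"
| "fo_free (Rel i xs) = set xs"
| "fo_free (Mem x X) = {x}"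
| "fo_free (Neg \<phi>) = fo_free \<phi>"
| "fo_free (Conj \<phi> \<psi>) = fo_free \<phi> \<union> fo_free \<psi>"
| "fo_free (ExElem x \<phi>) = fo_free \<phi> - {x}"
| "fo_free (ExSet X \<phi>) = fo_free \<phi>"

fun so_free :: "msol \<Rightarrow> nat set" where
  "so_free (Eq x y) = {}"
| "so_free (Less x y) = {}"
| "so_free (Rel i xs) = {}"
| "so_free (Mem x X) = {X}"
| "so_free (Neg \<phi>) = so_free \<phi>"
| "so_free (Conj \<phi> \<psi>) = so_free \<phi> \<union> so_free \<psi>"
| "so_free (ExElem x \<phi>) = so_free \<phi>"
| "so_free (ExSet X \<phi>) = so_free \<phi> - {X}"

fun wf_msol :: "nat list \<Rightarrow> msol \<Rightarrow> bool" where
  "wf_msol ar (Eq x y) \<longleftrightarrow> True"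
| "wf_msol ar (Less x y) \<longleftrightarrow> True"
| "wf_msol ar (Rel i xs) \<longleftrightarrow> i < length ar \<and> length xs = ar ! i"
| "wf_msol ar (Mem x X) \<longleftrightarrow> True"
| "wf_msol ar (Neg \<phi>) \<longleftrightarrow> wf_msol ar \<phi>"
| "wf_msol ar (Conj \<phi> \<psi>) \<longleftrightarrow> wf_msol ar \<phi> \<and> wf_msol ar \<psi>"
| "wf_msol ar (ExElem x \<phi>) \<longleftrightarrow> wf_msol ar \<phi>"
| "wf_msol ar (ExSet X \<phi>) \<longleftrightarrow> wf_msol ar \<phi>"

definition msol_sentence :: "nat list \<Rightarrow> msol \<Rightarrow> bool" where
  "msol_sentence ar \<phi> \<longleftrightarrow> wf_msol ar \<phi> \<and> fo_free \<phi> = {} \<and> so_free \<phi> = {}"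

text \<open>
  Satisfaction in the structure with universe \<open>U\<close>, order \<open>L\<close> and relations \<open>R\<close>, under the
  assignments \<open>e\<close> of elements and \<open>E\<close> of sets to the variables.
\<close>

fun sat :: "'a set \<Rightarrow> 'a rel \<Rightarrow> (nat \<Rightarrow> 'a list set) \<Rightarrow>
    (nat \<Rightarrow> 'a) \<Rightarrow> (nat \<Rightarrow> 'a set) \<Rightarrow> msol \<Rightarrow> bool" where
  "sat U L R e E (Eq x y) \<longleftrightarrow> e x = e y"
| "sat U L R e E (Less x y) \<longleftrightarrow> (e x, e y) \<in> L"
| "sat U L R e E (Rel i xs) \<longleftrightarrow> map e xs \<in> R i"
| "sat U L R e E (Mem x X) \<longleftrightarrow> e x \<in> E X"
| "sat U L R e E (Neg \<phi>) \<longleftrightarrow> \<not> sat U L R e E \<phi>"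
| "sat U L R e E (Conj \<phi> \<psi>) \<longleftrightarrow> sat U L R e E \<phi> \<and> sat U L R e E \<psi>"
| "sat U L R e E (ExElem x \<phi>) \<longleftrightarrow> (\<exists>a\<in>U. sat U L R (e(x := a)) E \<phi>)"
| "sat U L R e E (ExSet X \<phi>) \<longleftrightarrow> (\<exists>A\<subseteq>U. sat U L R e (E(X := A)) \<phi>)"

lemma sat_cong:
  assumes "\<And>x. x \<in> fo_free \<phi> \<Longrightarrow> e x = e' x"
    and "\<And>X. X \<in> so_free \<phi> \<Longrightarrow> E X = E' X"
  shows "sat U L R e E \<phi> \<longleftrightarrow> sat U L R e' E' \<phi>"
  using assms
proof (induction \<phi> arbitrary: e e' E E')
  case (Rel i xs)
  then have "map e xs = map e' xs" by simp
  then show ?case by (simp only: sat.simps)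
next
  case (Conj \<phi> \<psi>)
  have "sat U L R e E \<phi> = sat U L R e' E' \<phi>" using Conj.prems by (intro Conj.IH(1)) auto
  moreover have "sat U L R e E \<psi> = sat U L R e' E' \<psi>"
    using Conj.prems by (intro Conj.IH(2)) auto
  ultimately show ?case by simp
next
  case (Neg \<phi>)
  have "sat U L R e E \<phi> = sat U L R e' E' \<phi>" using Neg.prems by (intro Neg.IH) auto
  then show ?case by simp
next
  case (ExElem x \<phi>)
  have "sat U L R (e(x := a)) E \<phi> = sat U L R (e'(x := a)) E' \<phi>" for a
    using ExElem.prems by (intro ExElem.IH) auto
  then show ?case by simp
next
  case (ExSet X \<phi>)
  have "sat U L R e (E(X := A)) \<phi> = sat U L R e' (E'(X := A)) \<phi>" for A
    using ExSet.prems by (intro ExSet.IH) auto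
  then show ?case by simp
qed auto

text \<open>
  Intended for sentences only; the assignments chosen here are then irrelevant.
\<close>

definition models :: "'a set \<Rightarrow> 'a rel \<Rightarrow> (nat \<Rightarrow> 'a list set) \<Rightarrow> msol \<Rightarrow> bool" where
  "models U L R \<phi> \<longleftrightarrow> sat U L R (\<lambda>_. undefined) (\<lambda>_. {}) \<phi>"

lemma models_iff_sat:
  assumes "msol_sentence ar \<phi>"
  shows "models U L R \<phi> \<longleftrightarrow> sat U L R e E \<phi>"
  unfolding models_def using assms by (intro sat_cong) (auto simp: msol_sentence_def)

definition interps :: "nat list \<Rightarrow> 'a set \<Rightarrow> (nat \<Rightarrow> 'a list set) set" where
  "interps ar U = (\<Pi>\<^sub>E i\<in>{..<length ar}. Pow {xs. set xs \<subseteq> U \<and> length xs = ar ! i})"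

lemma finite_interps: "finite U \<Longrightarrow> finite (interps ar U)"
  unfolding interps_def by (intro finite_PiE) (auto intro: finite_lists_length_eq)

text \<open>
  The conjunct \<open>L \<subseteq> U \<times> U\<close> is not implied by \<^const>\<open>strict_linear_order_on\<close>.
\<close>

definition linear_orders :: "'a set \<Rightarrow> 'a rel set" where
  "linear_orders U = {L. L \<subseteq> U \<times> U \<and> strict_linear_order_on U L}"

definition tv_order_invariant :: "nat list \<Rightarrow> msol \<Rightarrow> bool" where
  "tv_order_invariant ar \<phi> \<longleftrightarrow>
    (\<forall>n\<ge>1. \<forall>R\<in>interps ar {1..n::nat}. \<forall>L\<in>linear_orders {1..n}. \<forall>L'\<in>linear_orders {1..n}.
      models {1..n} L R \<phi> \<longleftrightarrow> models {1..n} L' R \<phi>)"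

definition TVMSOL :: "nat list \<Rightarrow> msol set" where
  "TVMSOL ar = {\<phi>. msol_sentence ar \<phi> \<and> tv_order_invariant ar \<phi>}"

definition tv_models :: "'a set \<Rightarrow> (nat \<Rightarrow> 'a list set) \<Rightarrow> msol \<Rightarrow> bool" where
  "tv_models U R \<phi> \<longleftrightarrow> (\<exists>L\<in>linear_orders U. models U L R \<phi>)"

lemma tv_models_iff:
  assumes "\<phi> \<in> TVMSOL ar" "n \<ge> 1" "R \<in> interps ar {1..n::nat}" "L \<in> linear_orders {1..n}"
  shows "tv_models {1..n} R \<phi> \<longleftrightarrow> models {1..n} L R \<phi>"
  using assms unfolding TVMSOL_def tv_order_invariant_def tv_models_def by blast

text \<open>
  Counting functions have domain \<open>{1, 2, \<dots>}\<close>; the value \<open>f 0\<close> is unconstrained.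
\<close>

definition tvmsol_specker :: "nat \<Rightarrow> (nat \<Rightarrow> nat) \<Rightarrow> bool" where
  "tvmsol_specker k f \<longleftrightarrow>
    (\<exists>ar \<phi>. (\<forall>r\<in>set ar. r \<le> k) \<and> \<phi> \<in> TVMSOL ar \<and>
      (\<forall>n\<ge>1. f n = card {R \<in> interps ar {1..n}. tv_models {1..n} R \<phi>}))"

end

theory Submission
  imports Defs "HOL-Library.Nat_Bijection" "HOL-Combinatorics.List_Permutation"
begin

text \<open>
  Let every point of an index structure without loops carry a type, one of the finitely many
  Ehrenfeucht--Fraisse classes of ordered structures. By a composition theorem and order invariance,
  whether the structure obtained by inflating the points satisfies the sentence depends on the index
  structure and the types only. Let \<open>\<Phi>(w)\<close> count the accepted index structures on a
  multiset \<open>w\<close> of types. The counting function is \<open>f(n) = \<Sum> \<Phi>(w)\<close>, summed over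
  the words \<open>w\<close> of length \<open>n\<close> in the types of one-point structures.

  Take a prime \<open>p\<close> and \<open>2k\<close> blocks of \<open>p\<close> points of one type \<open>t\<close>. An index structure invariant under
  the rotation of one block is the inflation of a smaller one in which the block is a single point.
  On the structures invariant under the rotation of no block, \<open>(\<int>/p)\<^sup>2\<^sup>k\<close> acts with orbits of
  size divisible by \<open>p\<^sup>k\<close>: relations being binary, each block has a partner (if any) such
  that every element of the stabilizer that fixes the partner fixes the block, and so the stabilizer meets
  the rotations of some \<open>k\<close> blocks trivially. Hence modulo \<open>p\<^sup>k\<close> the function \<open>w \<mapsto> \<Phi>(t\<^sup>2\<^sup>p\<^sup>k w)\<close> is a
  combination of functions \<open>w \<mapsto> \<Phi>(v w)\<close> with shorter words \<open>v\<close>. So all shifts of \<open>\<Phi>\<close> lie in a finite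
  module, on which extension by one further point acts, and \<open>f\<close> is eventually periodic modulo \<open>p\<^sup>k\<close>.
\<close>

section \<open>Ehrenfeucht--Fraisse games\<close>

text \<open>Why \<open>2 * k\<close> blocks for the exponent \<open>k\<close>: a structure that no
  single rotation fixes may be fixed by a combination of them. A perfect matching between two blocks
  that is compatible with their rotations is moved by either rotation alone, but not by both
  together; so two blocks may contribute only one factor \<open>p\<close>. Nothing worse happens:
  following partners in one direction keeps at least half of the blocks.

  The bound 2 on the arities matters for the blocks in two ways: a fact that leaves a block has at
  most one point in it, so invariance reduces it to one fixed point of the block; and a fact that
  detects a rotation sees at most one other block. Rotations and permutations of words do not
  respect the order; order invariance makes them act nonetheless.

  Merging turns \<open>p\<close> points of type \<open>t\<close> into one point whose type need not
  come from a one-point structure. Therefore words over all types are treated, although only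
  one-point types enter the sum. The inner structure of the merged block disappears into its type,
  and as \<open>p\<close> is at least 2 the words become shorter, which drives the
  reduction.\<close>

type_synonym 'a facts = "(nat \<times> 'a list) set"

type_synonym 'a ordered_structure = "'a set \<times> 'a rel \<times> 'a facts"

text \<open>\<open>Before\<close>, \<open>Unary\<close> and \<open>Binary\<close> are existential so
  that on a union of parts they become disjunctions over the parts, together with a condition on
  which parts are met; \<open>Empty\<close> records the latter. Nullary facts have no atom, as they
  belong to no single part.\<close>

datatype atom =
    Empty nat
  | Single nat
  | Sub nat nat
  | Before nat nat
  | Unary nat nat
  | Binary nat nat nat

fun sat_atom :: "'a rel \<Rightarrow> 'a facts \<Rightarrow> (nat \<Rightarrow> 'a set) \<Rightarrow> atom \<Rightarrow> bool" where
  "sat_atom L Q \<rho> (Empty j) \<longleftrightarrow> \<rho> j = {}"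
| "sat_atom L Q \<rho> (Single j) \<longleftrightarrow> is_singleton (\<rho> j)"
| "sat_atom L Q \<rho> (Sub j k) \<longleftrightarrow> \<rho> j \<subseteq> \<rho> k"
| "sat_atom L Q \<rho> (Before j k) \<longleftrightarrow> (\<exists>x\<in>\<rho> j. \<exists>y\<in>\<rho> k. (x, y) \<in> L)"
| "sat_atom L Q \<rho> (Unary r j) \<longleftrightarrow> (\<exists>x\<in>\<rho> j. (r, [x]) \<in> Q)"
| "sat_atom L Q \<rho> (Binary r j k) \<longleftrightarrow> (\<exists>x\<in>\<rho> j. \<exists>y\<in>\<rho> k. (r, [x, y]) \<in> Q)"

fun atom_bounded :: "nat \<Rightarrow> nat \<Rightarrow> atom \<Rightarrow> bool" where
  "atom_bounded s n (Empty j) \<longleftrightarrow> j < n"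
| "atom_bounded s n (Single j) \<longleftrightarrow> j < n"
| "atom_bounded s n (Sub j k) \<longleftrightarrow> j < n \<and> k < n"
| "atom_bounded s n (Before j k) \<longleftrightarrow> j < n \<and> k < n"
| "atom_bounded s n (Unary r j) \<longleftrightarrow> r < s \<and> j < n"
| "atom_bounded s n (Binary r j k) \<longleftrightarrow> r < s \<and> j < n \<and> k < n"

lemma finite_atoms: "finite {a. atom_bounded s n a}"
proof (rule finite_subset)
  let ?N = "{..<n}" and ?S = "{..<s}"
  let ?B = "Empty ` ?N \<union> Single ` ?N \<union> (\<lambda>(j, k). Sub j k) ` (?N \<times> ?N) \<union>
    (\<lambda>(j, k). Before j k) ` (?N \<times> ?N) \<union> (\<lambda>(r, j). Unary r j) ` (?S \<times> ?N) \<union>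
    (\<lambda>(r, j, k). Binary r j k) ` (?S \<times> ?N \<times> ?N)"
  have "a \<in> ?B" if "atom_bounded s n a" for a
    using that by (cases a) (auto simp: image_iff)
  then show "{a. atom_bounded s n a} \<subseteq> ?B" by blast
qed auto

text \<open>
  Only set moves occur in the game: an element is a singleton, which the atoms recognise.
\<close>

fun ef :: "nat \<Rightarrow> nat \<Rightarrow> nat \<Rightarrow> 'a ordered_structure \<Rightarrow> (nat \<Rightarrow> 'a set) \<Rightarrow>
    'b ordered_structure \<Rightarrow> (nat \<Rightarrow> 'b set) \<Rightarrow> bool" where
  "ef s 0 n (U, L, Q) \<rho> (U', L', Q') \<rho>' \<longleftrightarrow>
    (\<forall>a. atom_bounded s n a \<longrightarrow> sat_atom L Q \<rho> a = sat_atom L' Q' \<rho>' a)"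
| "ef s (Suc q) n (U, L, Q) \<rho> (U', L', Q') \<rho>' \<longleftrightarrow>
    (\<forall>A\<subseteq>U. \<exists>A'\<subseteq>U'. ef s q (Suc n) (U, L, Q) (\<rho>(n := A)) (U', L', Q') (\<rho>'(n := A'))) \<and>
    (\<forall>A'\<subseteq>U'. \<exists>A\<subseteq>U. ef s q (Suc n) (U, L, Q) (\<rho>(n := A)) (U', L', Q') (\<rho>'(n := A')))"

lemma ef_sym:
  "ef s q n (U, L, Q) \<rho> (U', L', Q') \<rho>' \<Longrightarrow> ef s q n (U', L', Q') \<rho>' (U, L, Q) \<rho>"
proof (induction q arbitrary: n \<rho> \<rho>')
  case (Suc q)
  from Suc.prems show ?case unfolding ef.simps by (meson Suc.IH)
qed auto

lemma ef_trans:
  "ef s q n (U, L, Q) \<rho> (U', L', Q') \<rho>' \<Longrightarrow> ef s q n (U', L', Q') \<rho>' (U'', L'', Q'') \<rho>'' \<Longrightarrow>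
    ef s q n (U, L, Q) \<rho> (U'', L'', Q'') \<rho>''"
proof (induction q arbitrary: n \<rho> \<rho>' \<rho>'')
  case (Suc q)
  from Suc.prems show ?case unfolding ef.simps by (meson Suc.IH)
qed auto

lemma sat_atom_cong:
  assumes "atom_bounded s n a" "\<And>j. j < n \<Longrightarrow> \<rho> j = \<rho>' j"
  shows "sat_atom L Q \<rho> a = sat_atom L Q \<rho>' a"
  using assms by (cases a) auto

lemma atom_bounded_Suc: "atom_bounded s n a \<Longrightarrow> atom_bounded s (Suc n) a"
  by (cases a) auto

text \<open>Agreement on atoms is demanded only when no round is left; the remaining rounds are
  spent on the empty set, and neither this move nor its answer changes the earlier sets.\<close>

lemma ef_atom:
  assumes "ef s q n (U, L, Q) \<rho> (U', L', Q') \<rho>'" "atom_bounded s n a"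
  shows "sat_atom L Q \<rho> a = sat_atom L' Q' \<rho>' a"
  using assms
proof (induction q arbitrary: n \<rho> \<rho>')
  case (Suc q)
  then obtain A' where "ef s q (Suc n) (U, L, Q) (\<rho>(n := {})) (U', L', Q') (\<rho>'(n := A'))"
    by (metis ef.simps(2) empty_subsetI)
  from Suc.IH[OF this atom_bounded_Suc[OF Suc.prems(2)]]
  have "sat_atom L Q (\<rho>(n := {})) a = sat_atom L' Q' (\<rho>'(n := A')) a" .
  moreover have "sat_atom L Q (\<rho>(n := {})) a = sat_atom L Q \<rho> a"
    by (rule sat_atom_cong[OF Suc.prems(2)]) simp
  moreover have "sat_atom L' Q' (\<rho>'(n := A')) a = sat_atom L' Q' \<rho>' a"
    by (rule sat_atom_cong[OF Suc.prems(2)]) simp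
  ultimately show ?case by simp
qed simp

lemma inj_on_image_subset:
  assumes "inj_on h U" "A \<subseteq> U" "B \<subseteq> U"
  shows "h ` A \<subseteq> h ` B \<longleftrightarrow> A \<subseteq> B"
proof
  assume *: "h ` A \<subseteq> h ` B"
  show "A \<subseteq> B"
  proof
    fix x assume "x \<in> A"
    then have "h x \<in> h ` B" "x \<in> U" using * assms by auto
    then show "x \<in> B" using inj_on_image_mem_iff[OF assms(1)] assms(3) by simp
  qed
qed (rule image_mono)

text \<open>The answers are images and preimages under \<open>h\<close>. Only the order inside
  \<open>U\<close> and the unary and binary facts are compared, so with the identity as
  \<open>h\<close> this also covers cutting an order down to \<open>U\<close>.\<close>

lemma ef_iso:
  assumes inj: "inj_on h U"
    and ord: "\<And>x y. x \<in> U \<Longrightarrow> y \<in> U \<Longrightarrow> (h x, h y) \<in> L' \<longleftrightarrow> (x, y) \<in> L"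
    and un: "\<And>r x. r < s \<Longrightarrow> x \<in> U \<Longrightarrow> (r, [h x]) \<in> Q' \<longleftrightarrow> (r, [x]) \<in> Q"
    and bin: "\<And>r x y. r < s \<Longrightarrow> x \<in> U \<Longrightarrow> y \<in> U \<Longrightarrow> (r, [h x, h y]) \<in> Q' \<longleftrightarrow> (r, [x, y]) \<in> Q"
    and sub: "\<And>j. j < n \<Longrightarrow> \<rho> j \<subseteq> U" "\<And>j. j < n \<Longrightarrow> \<rho>' j = h ` \<rho> j"
  shows "ef s q n (U, L, Q) \<rho> (h ` U, L', Q') \<rho>'"
  using sub
proof (induction q arbitrary: n \<rho> \<rho>')
  case 0
  have sing: "is_singleton (h ` A) \<longleftrightarrow> is_singleton A" if "A \<subseteq> U" for A
    using inj_on_subset[OF inj that] by (simp add: is_singleton_altdef card_image)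
  have "sat_atom L Q \<rho> a = sat_atom L' Q' \<rho>' a" if "atom_bounded s n a" for a
  proof (cases a)
    case (Single j)
    then show ?thesis using that 0 by (simp add: sing)
  next
    case (Sub j k)
    then have "\<rho> j \<subseteq> U" "\<rho> k \<subseteq> U" "\<rho>' j = h ` \<rho> j" "\<rho>' k = h ` \<rho> k" using that 0 by auto
    then show ?thesis using Sub inj
      by (simp add: inj_on_image_subset)
  next
    case (Before j k)
    then have "\<rho> j \<subseteq> U" "\<rho> k \<subseteq> U" "\<rho>' j = h ` \<rho> j" "\<rho>' k = h ` \<rho> k" using that 0 by auto
    then show ?thesis using Before ord by (auto simp: subset_iff)
  next
    case (Unary r j)
    then have "\<rho> j \<subseteq> U" "\<rho>' j = h ` \<rho> j" "r < s" using that 0 by auto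
    then show ?thesis using Unary un by (auto simp: subset_iff)
  next
    case (Binary r j k)
    then have "\<rho> j \<subseteq> U" "\<rho> k \<subseteq> U" "\<rho>' j = h ` \<rho> j" "\<rho>' k = h ` \<rho> k" "r < s"
      using that 0 by auto
    then show ?thesis using Binary bin by (auto simp: subset_iff)
  qed (use that 0 in auto)
  then show ?case by simp
next
  case (Suc q)
  have *: "ef s q (Suc n) (U, L, Q) (\<rho>(n := A)) (h ` U, L', Q') (\<rho>'(n := h ` A))"
    if "A \<subseteq> U" for A
    using Suc.prems that by (intro Suc.IH) (auto simp: less_Suc_eq)
  show ?case unfolding ef.simps
    by (metis * image_mono subset_imageE)
qed

text \<open>Naming the values by numbers keeps the codes of all ranks in one type, whereas the
  induction on the rank passes to sets of codes at each step.\<close>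

lemma finite_range_code:
  assumes "finite (range h)"
  shows "\<exists>g :: 'a \<Rightarrow> nat. finite (range g) \<and> (\<forall>x y. g x = g y \<longleftrightarrow> h x = h y)"
proof -
  obtain c :: "'b \<Rightarrow> nat" where c: "inj_on c (range h)"
    using finite_imp_inj_to_nat_seg[OF assms] by blast
  have "finite (range (\<lambda>x. c (h x)))" using finite_imageI[OF assms, of c] by (simp add: image_image)
  moreover have "c (h x) = c (h y) \<longleftrightarrow> h x = h y" for x y
    using c by (auto simp: inj_on_def)
  ultimately show ?thesis by (intro exI[of _ "\<lambda>x. c (h x)"]) simp
qed

text \<open>For rank \<open>Suc q\<close> the code is the set of rank \<open>q\<close> codes that
  can be reached by one set move, and a finite set of codes has finitely many subsets.\<close>

lemma ef_finite_index:
  "\<exists>g :: 'a ordered_structure \<times> (nat \<Rightarrow> 'a set) \<Rightarrow> nat. finite (range g) \<and>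
    (\<forall>\<AA> \<rho> \<BB> \<rho>'. g (\<AA>, \<rho>) = g (\<BB>, \<rho>') \<longrightarrow> ef s q n \<AA> \<rho> \<BB> \<rho>')"
proof (induction q arbitrary: n)
  case 0
  define h :: "'a ordered_structure \<times> (nat \<Rightarrow> 'a set) \<Rightarrow> atom set" where
    "h = (\<lambda>((U, L, Q), \<rho>). {a. atom_bounded s n a \<and> sat_atom L Q \<rho> a})"
  have "range h \<subseteq> Pow {a. atom_bounded s n a}" by (auto simp: h_def)
  then have fin: "finite (range h)" by (rule finite_subset) (simp add: finite_atoms)
  obtain g :: "'a ordered_structure \<times> (nat \<Rightarrow> 'a set) \<Rightarrow> nat"
    where g: "finite (range g)" "\<And>x y. g x = g y \<longleftrightarrow> h x = h y"
    using finite_range_code[OF fin] by blast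
  have "ef s 0 n \<AA> \<rho> \<BB> \<rho>'" if "g (\<AA>, \<rho>) = g (\<BB>, \<rho>')" for \<AA> \<rho> \<BB> \<rho>'
  proof -
    from that have "h (\<AA>, \<rho>) = h (\<BB>, \<rho>')" using g(2) by simp
    then show ?thesis by (cases \<AA>; cases \<BB>) (auto simp: h_def)
  qed
  then show ?case using g(1) by (intro exI[of _ g]) blast
next
  case (Suc q)
  obtain g :: "'a ordered_structure \<times> (nat \<Rightarrow> 'a set) \<Rightarrow> nat" where g: "finite (range g)"
    "\<And>\<AA> \<rho> \<BB> \<rho>'. g (\<AA>, \<rho>) = g (\<BB>, \<rho>') \<Longrightarrow> ef s q (Suc n) \<AA> \<rho> \<BB> \<rho>'"
    using Suc.IH[of "Suc n"] by blast
  define h :: "'a ordered_structure \<times> (nat \<Rightarrow> 'a set) \<Rightarrow> nat set" where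
    "h = (\<lambda>(\<AA>, \<rho>). (\<lambda>A. g (\<AA>, \<rho>(n := A))) ` Pow (fst \<AA>))"
  have "range h \<subseteq> Pow (range g)" by (auto simp: h_def)
  then have fin: "finite (range h)" by (rule finite_subset) (simp add: g)
  obtain g' :: "'a ordered_structure \<times> (nat \<Rightarrow> 'a set) \<Rightarrow> nat"
    where g': "finite (range g')" "\<And>x y. g' x = g' y \<longleftrightarrow> h x = h y"
    using finite_range_code[OF fin] by blast
  have "ef s (Suc q) n \<AA> \<rho> \<BB> \<rho>'" if "g' (\<AA>, \<rho>) = g' (\<BB>, \<rho>')" for \<AA> \<rho> \<BB> \<rho>'
  proof -
    obtain U L Q U' L' Q' where AB: "\<AA> = (U, L, Q)" "\<BB> = (U', L', Q')"
      by (metis prod.exhaust)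
    from that have eq: "h (\<AA>, \<rho>) = h (\<BB>, \<rho>')" using g'(2) by simp
    have 1: "\<exists>A'\<subseteq>U'. g (\<AA>, \<rho>(n := A)) = g (\<BB>, \<rho>'(n := A'))" if "A \<subseteq> U" for A
    proof -
      have "g (\<AA>, \<rho>(n := A)) \<in> h (\<BB>, \<rho>')" unfolding eq[symmetric] using that AB
        by (auto simp: h_def)
      then show ?thesis using AB by (auto simp: h_def)
    qed
    have 2: "\<exists>A\<subseteq>U. g (\<AA>, \<rho>(n := A)) = g (\<BB>, \<rho>'(n := A'))" if "A' \<subseteq> U'" for A'
    proof -
      have "g (\<BB>, \<rho>'(n := A')) \<in> h (\<AA>, \<rho>)" unfolding eq using that AB
        by (auto simp: h_def)
      then obtain A where "A \<subseteq> U" "g (\<BB>, \<rho>'(n := A')) = g (\<AA>, \<rho>(n := A))"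
        using AB by (auto simp: h_def)
      then show ?thesis by metis
    qed
    show ?thesis unfolding AB ef.simps
    proof (intro conjI allI impI)
      fix A assume "A \<subseteq> U"
      from 1[OF this] obtain A' where "A' \<subseteq> U'" "g (\<AA>, \<rho>(n := A)) = g (\<BB>, \<rho>'(n := A'))" by blast
      then show "\<exists>A'\<subseteq>U'. ef s q (Suc n) (U, L, Q) (\<rho>(n := A)) (U', L', Q') (\<rho>'(n := A'))"
        using g(2) unfolding AB by blast
    next
      fix A' assume "A' \<subseteq> U'"
      from 2[OF this] obtain A where "A \<subseteq> U" "g (\<AA>, \<rho>(n := A)) = g (\<BB>, \<rho>'(n := A'))" by blast
      then show "\<exists>A\<subseteq>U. ef s q (Suc n) (U, L, Q) (\<rho>(n := A)) (U', L', Q') (\<rho>'(n := A'))"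
        using g(2) unfolding AB by blast
    qed
  qed
  then show ?case using g'(1) by (intro exI[of _ g']) blast
qed

section \<open>From games to the truth of formulas\<close>

fun quantifier_depth :: "msol \<Rightarrow> nat" where
  "quantifier_depth (Neg \<phi>) = quantifier_depth \<phi>"
| "quantifier_depth (Conj \<phi> \<psi>) = max (quantifier_depth \<phi>) (quantifier_depth \<psi>)"
| "quantifier_depth (ExElem x \<phi>) = Suc (quantifier_depth \<phi>)"
| "quantifier_depth (ExSet X \<phi>) = Suc (quantifier_depth \<phi>)"
| "quantifier_depth _ = 0"

definition relations :: "'a facts \<Rightarrow> nat \<Rightarrow> 'a list set" where
  "relations Q r = {xs. (r, xs) \<in> Q}"

text \<open>The maps \<open>v\<close> and \<open>V\<close> tell which chosen set interprets a
  variable, an element being represented by its singleton; a quantifier redirects its variable to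
  the newest set. Nullary facts escape the atoms and therefore enter as a hypothesis.\<close>

lemma ef_sat:
  assumes "ef (length ar) q n (U, L, Q) \<rho> (U', L', Q') \<rho>'"
    and "quantifier_depth \<phi> \<le> q" and "wf_msol ar \<phi>" and ar: "\<forall>k\<in>set ar. k \<le> 2"
    and nullary: "\<And>r. r < length ar \<Longrightarrow> (r, []) \<in> Q \<longleftrightarrow> (r, []) \<in> Q'"
    and "\<And>x. x \<in> fo_free \<phi> \<Longrightarrow> v x < n \<and> \<rho> (v x) = {e x} \<and> \<rho>' (v x) = {e' x}"
    and "\<And>X. X \<in> so_free \<phi> \<Longrightarrow> V X < n \<and> \<rho> (V X) = E X \<and> \<rho>' (V X) = E' X"
  shows "sat U L (relations Q) e E \<phi> \<longleftrightarrow> sat U' L' (relations Q') e' E' \<phi>"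
  using assms(1-3,6,7)
proof (induction \<phi> arbitrary: q n \<rho> \<rho>' v V e e' E E')
  case (Eq x y)
  then show ?case using ef_atom[OF Eq.prems(1), of "Sub (v x) (v y)"] by auto
next
  case (Less x y)
  then show ?case using ef_atom[OF Less.prems(1), of "Before (v x) (v y)"] by auto
next
  case (Mem x X)
  then show ?case using ef_atom[OF Mem.prems(1), of "Sub (v x) (V X)"] by auto
next
  case (Rel i xs)
  then have i: "i < length ar" "length xs \<le> 2" using ar by auto
  then consider "xs = []" | x where "xs = [x]" | x y where "xs = [x, y]"
    by (cases xs; cases "tl xs"; cases "tl (tl xs)") auto
  then show ?case
  proof cases
    case 1
    then show ?thesis using nullary i by (simp add: relations_def)
  next
    case (2 x)
    then show ?thesis using ef_atom[OF Rel.prems(1), of "Unary i (v x)"] i Rel.prems(4)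
      by (auto simp: relations_def)
  next
    case (3 x y)
    then show ?thesis using ef_atom[OF Rel.prems(1), of "Binary i (v x) (v y)"] i Rel.prems(4)
      by (auto simp: relations_def)
  qed
next
  case (Neg \<phi>)
  have "sat U L (relations Q) e E \<phi> \<longleftrightarrow> sat U' L' (relations Q') e' E' \<phi>"
    using Neg.prems by (intro Neg.IH[of q n \<rho> \<rho>' v e e' V E E']) auto
  then show ?case by simp
next
  case (Conj \<phi> \<psi>)
  have "sat U L (relations Q) e E \<phi> \<longleftrightarrow> sat U' L' (relations Q') e' E' \<phi>"
    using Conj.prems by (intro Conj.IH(1)[of q n \<rho> \<rho>' v e e' V E E']) auto
  moreover have "sat U L (relations Q) e E \<psi> \<longleftrightarrow> sat U' L' (relations Q') e' E' \<psi>"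
    using Conj.prems by (intro Conj.IH(2)[of q n \<rho> \<rho>' v e e' V E E']) auto
  ultimately show ?case by simp
next
  case (ExElem x \<phi>)
  obtain q' where q: "q = Suc q'" using ExElem.prems by (cases q) auto
  have step: "sat U L (relations Q) (e(x := a)) E \<phi> \<longleftrightarrow> sat U' L' (relations Q') (e'(x := a')) E' \<phi>"
    if "ef (length ar) q' (Suc n) (U, L, Q) (\<rho>(n := {a})) (U', L', Q') (\<rho>'(n := {a'}))" for a a'
  proof (rule ExElem.IH[OF that])
    show "quantifier_depth \<phi> \<le> q'" "wf_msol ar \<phi>" using ExElem.prems q by auto
    fix y assume "y \<in> fo_free \<phi>"
    then show "(v(x := n)) y < Suc n \<and> (\<rho>(n := {a})) ((v(x := n)) y) = {(e(x := a)) y} \<and>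
      (\<rho>'(n := {a'})) ((v(x := n)) y) = {(e'(x := a')) y}"
      using ExElem.prems(4)[of y] by (cases "y = x") auto
  next
    fix X assume "X \<in> so_free \<phi>"
    then show "V X < Suc n \<and> (\<rho>(n := {a})) (V X) = E X \<and> (\<rho>'(n := {a'})) (V X) = E' X"
      using ExElem.prems(5)[of X] by auto
  qed
  show ?case
  proof
    assume "sat U L (relations Q) e E (ExElem x \<phi>)"
    then obtain a where a: "a \<in> U" "sat U L (relations Q) (e(x := a)) E \<phi>" by auto
    then obtain A' where A': "A' \<subseteq> U'"
      "ef (length ar) q' (Suc n) (U, L, Q) (\<rho>(n := {a})) (U', L', Q') (\<rho>'(n := A'))"
      using ExElem.prems(1) unfolding q ef.simps by (meson empty_subsetI insert_subset)
    from ef_atom[OF this(2), of "Single n"] obtain a' where "A' = {a'}"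
      by (auto simp: is_singleton_def)
    then show "sat U' L' (relations Q') e' E' (ExElem x \<phi>)" using A' a step by auto
  next
    assume "sat U' L' (relations Q') e' E' (ExElem x \<phi>)"
    then obtain a' where a': "a' \<in> U'" "sat U' L' (relations Q') (e'(x := a')) E' \<phi>" by auto
    then obtain A where A: "A \<subseteq> U"
      "ef (length ar) q' (Suc n) (U, L, Q) (\<rho>(n := A)) (U', L', Q') (\<rho>'(n := {a'}))"
      using ExElem.prems(1) unfolding q ef.simps by (meson empty_subsetI insert_subset)
    from ef_atom[OF this(2), of "Single n"] obtain a where "A = {a}"
      by (auto simp: is_singleton_def)
    then show "sat U L (relations Q) e E (ExElem x \<phi>)" using A a' step by auto
  qed
next
  case (ExSet X \<phi>)
  obtain q' where q: "q = Suc q'" using ExSet.prems by (cases q) auto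
  have step: "sat U L (relations Q) e (E(X := A)) \<phi> \<longleftrightarrow> sat U' L' (relations Q') e' (E'(X := A')) \<phi>"
    if "ef (length ar) q' (Suc n) (U, L, Q) (\<rho>(n := A)) (U', L', Q') (\<rho>'(n := A'))" for A A'
  proof (rule ExSet.IH[OF that])
    show "quantifier_depth \<phi> \<le> q'" "wf_msol ar \<phi>" using ExSet.prems q by auto
    fix y assume "y \<in> fo_free \<phi>"
    then show "v y < Suc n \<and> (\<rho>(n := A)) (v y) = {e y} \<and> (\<rho>'(n := A')) (v y) = {e' y}"
      using ExSet.prems(4)[of y] by auto
  next
    fix Y assume "Y \<in> so_free \<phi>"
    then show "(V(X := n)) Y < Suc n \<and> (\<rho>(n := A)) ((V(X := n)) Y) = (E(X := A)) Y \<and>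
      (\<rho>'(n := A')) ((V(X := n)) Y) = (E'(X := A')) Y"
      using ExSet.prems(5)[of Y] by (cases "Y = X") auto
  qed
  show ?case using ExSet.prems(1) step unfolding q ef.simps sat.simps by meson
qed

section \<open>Inflation of index structures\<close>

definition facts :: "nat list \<Rightarrow> 'a set \<Rightarrow> 'a facts" where
  "facts ar U = {(r, xs). r < length ar \<and> length xs = ar ! r \<and> set xs \<subseteq> U}"

text \<open>
  The points of an index structure \<open>G\<close> are inflated to the fibres of \<open>\<pi>\<close>, inside which \<open>S\<close> decides.
  Nullary facts are read off from \<open>G\<close>, since the empty set is not a singleton.
\<close>

definition inflate :: "nat list \<Rightarrow> 'a set \<Rightarrow> ('a \<Rightarrow> 'b) \<Rightarrow> 'a facts \<Rightarrow> 'b facts \<Rightarrow> 'a facts" where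
  "inflate ar U \<pi> S G =
    {(r, xs) \<in> facts ar U. if is_singleton (\<pi> ` set xs) then (r, xs) \<in> S else (r, map \<pi> xs) \<in> G}"

definition lex_order :: "('a::linorder \<Rightarrow> 'b::linorder) \<Rightarrow> 'a rel" where
  "lex_order \<pi> = {(x, y). \<pi> x < \<pi> y \<or> \<pi> x = \<pi> y \<and> x < y}"

definition less_rel :: "'a::linorder rel" where
  "less_rel = {(x, y). x < y}"

definition fibre :: "('a \<Rightarrow> 'b) \<Rightarrow> 'a set \<Rightarrow> 'b \<Rightarrow> 'a set" where
  "fibre \<pi> A i = {x \<in> A. \<pi> x = i}"

lemma mem_fibre [simp]: "x \<in> fibre \<pi> A i \<longleftrightarrow> x \<in> A \<and> \<pi> x = i"
  by (simp add: fibre_def)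

section \<open>Atoms of an inflation in terms of the fibres\<close>

context
  fixes U :: "'a::linorder set" and \<pi> :: "'a \<Rightarrow> 'b::linorder" and I :: "'b set"
    and S :: "'a facts" and G :: "'b facts" and ar :: "nat list"
  assumes img: "\<pi> ` U = I"
begin

lemma inflate_empty: "A \<subseteq> U \<Longrightarrow> A = {} \<longleftrightarrow> (\<forall>i\<in>I. fibre \<pi> A i = {})"
  using img by (metis all_not_in_conv imageI mem_fibre subsetD)

lemma inflate_single:
  assumes "A \<subseteq> U"
  shows "is_singleton (A) \<longleftrightarrow>
    (\<exists>i\<in>I. is_singleton (fibre \<pi> A i) \<and> (\<forall>i'\<in>I. i' \<noteq> i \<longrightarrow> fibre \<pi> A i' = {}))"
proof
  assume "is_singleton (A)"
  then obtain x where x: "A = {x}" by (auto simp: is_singleton_def)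
  then have "\<pi> x \<in> I" using img assms by auto
  moreover have "fibre \<pi> A (\<pi> x) = {x}" using x by (auto simp: fibre_def)
  ultimately show "\<exists>i\<in>I. is_singleton (fibre \<pi> A i) \<and>
      (\<forall>i'\<in>I. i' \<noteq> i \<longrightarrow> fibre \<pi> A i' = {})"
    using x by (intro bexI[of _ "\<pi> x"]) (auto simp: fibre_def)
next
  assume "\<exists>i\<in>I. is_singleton (fibre \<pi> A i) \<and> (\<forall>i'\<in>I. i' \<noteq> i \<longrightarrow> fibre \<pi> A i' = {})"
  then obtain i x where i: "i \<in> I" "fibre \<pi> A i = {x}"
    "\<And>i'. i' \<in> I \<Longrightarrow> i' \<noteq> i \<Longrightarrow> fibre \<pi> A i' = {}"
    by (auto simp: is_singleton_def)
  have "y = x" if "y \<in> A" for y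
  proof -
    have "\<pi> y \<in> I" "y \<in> fibre \<pi> A (\<pi> y)" using that img assms by auto
    then have "\<pi> y = i" using i(3)[of "\<pi> y"] by blast
    then have "y \<in> fibre \<pi> A i" using that by simp
    then show ?thesis using i(2) by simp
  qed
  moreover have "x \<in> A" using i(2) by (metis insertI1 mem_fibre)
  ultimately have "A = {x}" by blast
  then show "is_singleton (A)" by simp
qed

lemma inflate_sub:
  assumes "A \<subseteq> U"
  shows "A \<subseteq> B \<longleftrightarrow> (\<forall>i\<in>I. fibre \<pi> A i \<subseteq> fibre \<pi> B i)"
proof
  assume *: "\<forall>i\<in>I. fibre \<pi> A i \<subseteq> fibre \<pi> B i"
  show "A \<subseteq> B"
  proof
    fix x assume "x \<in> A"
    moreover then have "\<pi> x \<in> I" using assms img by auto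
    ultimately show "x \<in> B" using * by (metis mem_fibre subsetD)
  qed
qed (auto simp: subset_iff)

lemma inflate_before:
  assumes "A \<subseteq> U" "B \<subseteq> U"
  shows "(\<exists>x\<in>A. \<exists>y\<in>B. (x, y) \<in> lex_order \<pi>) \<longleftrightarrow>
    (\<exists>i\<in>I. \<exists>x\<in>fibre \<pi> A i. \<exists>y\<in>fibre \<pi> B i. (x, y) \<in> less_rel) \<or>
    (\<exists>i\<in>I. \<exists>i'\<in>I. i < i' \<and> fibre \<pi> A i \<noteq> {} \<and> fibre \<pi> B i' \<noteq> {})" (is "?l \<longleftrightarrow> ?r")
proof
  assume ?l
  then obtain x y where "x \<in> A" "y \<in> B" "\<pi> x < \<pi> y \<or> \<pi> x = \<pi> y \<and> x < y"
    by (auto simp: lex_order_def)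
  moreover then have "x \<in> fibre \<pi> A (\<pi> x)" "y \<in> fibre \<pi> B (\<pi> y)" "\<pi> x \<in> I" "\<pi> y \<in> I"
    using assms img by auto
  ultimately show ?r unfolding less_rel_def by (metis case_prodI empty_iff mem_Collect_eq)
next
  assume ?r
  then consider i x y where "x \<in> fibre \<pi> A i" "y \<in> fibre \<pi> B i" "x < y" |
    i i' x y where "x \<in> fibre \<pi> A i" "y \<in> fibre \<pi> B i'" "i < i'"
    unfolding less_rel_def by blast
  then show ?l
  proof cases
    case 1
    then have "x \<in> A" "y \<in> B" "(x, y) \<in> lex_order \<pi>" by (auto simp: lex_order_def)
    then show ?thesis by blast
  next
    case 2
    then have "x \<in> A" "y \<in> B" "(x, y) \<in> lex_order \<pi>" by (auto simp: lex_order_def)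
    then show ?thesis by blast
  qed
qed

lemma inflate_unary:
  assumes "A \<subseteq> U" "r < length ar"
  shows "(\<exists>x\<in>A. (r, [x]) \<in> inflate ar U \<pi> S G) \<longleftrightarrow>
    ar ! r = 1 \<and> (\<exists>i\<in>I. \<exists>x\<in>fibre \<pi> A i. (r, [x]) \<in> S)"
  using assms img by (fastforce simp: inflate_def facts_def)

lemma inflate_binary:
  assumes "A \<subseteq> U" "B \<subseteq> U" "r < length ar"
  shows "(\<exists>x\<in>A. \<exists>y\<in>B. (r, [x, y]) \<in> inflate ar U \<pi> S G) \<longleftrightarrow> ar ! r = 2 \<and>
    ((\<exists>i\<in>I. \<exists>x\<in>fibre \<pi> A i. \<exists>y\<in>fibre \<pi> B i. (r, [x, y]) \<in> S) \<or>
     (\<exists>i\<in>I. \<exists>i'\<in>I. i \<noteq> i' \<and> fibre \<pi> A i \<noteq> {} \<and> fibre \<pi> B i' \<noteq> {} \<and> (r, [i, i']) \<in> G))"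
    (is "?l \<longleftrightarrow> ?r")
proof -
  have mem: "(r, [x, y]) \<in> inflate ar U \<pi> S G \<longleftrightarrow> ar ! r = 2 \<and>
      (if \<pi> x = \<pi> y then (r, [x, y]) \<in> S else (r, [\<pi> x, \<pi> y]) \<in> G)" if "x \<in> A" "y \<in> B" for x y
    using that assms by (auto simp: inflate_def facts_def is_singleton_def)
  show ?thesis
  proof
    assume ?l
    then obtain x y where xy: "x \<in> A" "y \<in> B" "(r, [x, y]) \<in> inflate ar U \<pi> S G" by auto
    moreover then have "x \<in> fibre \<pi> A (\<pi> x)" "y \<in> fibre \<pi> B (\<pi> y)" "\<pi> x \<in> I" "\<pi> y \<in> I"
      using assms img by auto
    ultimately show ?r using mem[of x y] by (metis empty_iff)
  next
    assume r: ?r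
    then consider i x y where "x \<in> fibre \<pi> A i" "y \<in> fibre \<pi> B i" "(r, [x, y]) \<in> S" |
      i i' x y where "x \<in> fibre \<pi> A i" "y \<in> fibre \<pi> B i'" "i \<noteq> i'" "(r, [i, i']) \<in> G"
      by blast
    then show ?l
    proof cases
      case 1
      then show ?thesis using mem[of x y] r by auto
    next
      case 2
      then show ?thesis using mem[of x y] r by auto
    qed
  qed
qed

end

text \<open>The decompositions above involve the fibres only through atoms on one fibre at a time;
  everything else in them is the index order and \<open>G\<close>, common to both sides.\<close>

lemma sat_atom_inflate:
  assumes imgs: "\<pi> ` U = I" "\<pi>' ` U' = I"
    and sub: "\<And>j. j < n \<Longrightarrow> \<rho> j \<subseteq> U" "\<And>j. j < n \<Longrightarrow> \<rho>' j \<subseteq> U'"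
    and parts: "\<And>i a. i \<in> I \<Longrightarrow> atom_bounded (length ar) n a \<Longrightarrow>
      sat_atom less_rel S (\<lambda>j. fibre \<pi> (\<rho> j) i) a =
      sat_atom less_rel S' (\<lambda>j. fibre \<pi>' (\<rho>' j) i) a"
    and a: "atom_bounded (length ar) n a"
  shows "sat_atom (lex_order \<pi>) (inflate ar U \<pi> S G) \<rho> a =
    sat_atom (lex_order \<pi>') (inflate ar U' \<pi>' S' G) \<rho>' a"
proof -
  have empty: "fibre \<pi> (\<rho> j) i = {} \<longleftrightarrow> fibre \<pi>' (\<rho>' j) i = {}" if "i \<in> I" "j < n" for i j
    using parts[of i "Empty j"] that by simp
  show ?thesis
  proof (cases a)
    case (Empty j)
    then have "j < n" using a by simp
    then show ?thesis using Empty empty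
      by (simp add: inflate_empty[OF imgs(1)] inflate_empty[OF imgs(2)] sub)
  next
    case (Single j)
    then have j: "j < n" using a by simp
    have "is_singleton (fibre \<pi> (\<rho> j) i) \<longleftrightarrow> is_singleton (fibre \<pi>' (\<rho>' j) i)" if "i \<in> I" for i
      using parts[of i "Single j"] that j by simp
    then show ?thesis using Single empty j
      by (simp add: inflate_single[OF imgs(1)] inflate_single[OF imgs(2)] sub)
  next
    case (Sub j k)
    then have j: "j < n" "k < n" using a by auto
    have "fibre \<pi> (\<rho> j) i \<subseteq> fibre \<pi> (\<rho> k) i \<longleftrightarrow> fibre \<pi>' (\<rho>' j) i \<subseteq> fibre \<pi>' (\<rho>' k) i"
      if "i \<in> I" for i using parts[of i "Sub j k"] that j by simp
    then show ?thesis using Sub j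
      by (simp add: inflate_sub[OF imgs(1)] inflate_sub[OF imgs(2)] sub)
  next
    case (Before j k)
    then have j: "j < n" "k < n" using a by auto
    have "(\<exists>x\<in>fibre \<pi> (\<rho> j) i. \<exists>y\<in>fibre \<pi> (\<rho> k) i. (x, y) \<in> less_rel) \<longleftrightarrow>
      (\<exists>x\<in>fibre \<pi>' (\<rho>' j) i. \<exists>y\<in>fibre \<pi>' (\<rho>' k) i. (x, y) \<in> less_rel)" if "i \<in> I" for i
      using parts[of i "Before j k"] that j by (simp del: mem_fibre)
    then show ?thesis using Before j empty unfolding Before sat_atom.simps
      inflate_before[OF imgs(1) sub(1)[OF j(1)] sub(1)[OF j(2)]]
      inflate_before[OF imgs(2) sub(2)[OF j(1)] sub(2)[OF j(2)]]
      by (simp del: mem_fibre cong: bex_cong conj_cong)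
  next
    case (Unary r j)
    then have j: "j < n" "r < length ar" using a by auto
    have "(\<exists>x\<in>fibre \<pi> (\<rho> j) i. (r, [x]) \<in> S) \<longleftrightarrow> (\<exists>x\<in>fibre \<pi>' (\<rho>' j) i. (r, [x]) \<in> S')"
      if "i \<in> I" for i using parts[of i "Unary r j"] that j by (simp del: mem_fibre)
    then show ?thesis unfolding Unary sat_atom.simps
      inflate_unary[OF imgs(1) sub(1)[OF j(1)] j(2)] inflate_unary[OF imgs(2) sub(2)[OF j(1)] j(2)]
      by (simp del: mem_fibre cong: bex_cong)
  next
    case (Binary r j k)
    then have j: "j < n" "k < n" "r < length ar" using a by auto
    have "(\<exists>x\<in>fibre \<pi> (\<rho> j) i. \<exists>y\<in>fibre \<pi> (\<rho> k) i. (r, [x, y]) \<in> S) \<longleftrightarrow>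
      (\<exists>x\<in>fibre \<pi>' (\<rho>' j) i. \<exists>y\<in>fibre \<pi>' (\<rho>' k) i. (r, [x, y]) \<in> S')"
      if "i \<in> I" for i using parts[of i "Binary r j k"] that j by (simp del: mem_fibre)
    then show ?thesis using empty j unfolding Binary sat_atom.simps
      inflate_binary[OF imgs(1) sub(1)[OF j(1)] sub(1)[OF j(2)] j(3)]
      inflate_binary[OF imgs(2) sub(2)[OF j(1)] sub(2)[OF j(2)] j(3)]
      by (simp del: mem_fibre cong: bex_cong conj_cong)
  qed
qed

text \<open>The composition theorem: one game is played per fibre, and the answer to a set is the
  union of the answers to its fibres.\<close>

lemma ef_inflate:
  assumes imgs: "\<pi> ` U = I" "\<pi>' ` U' = I"
    and "\<And>j. j < n \<Longrightarrow> \<rho> j \<subseteq> U" "\<And>j. j < n \<Longrightarrow> \<rho>' j \<subseteq> U'"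
    and "\<And>i. i \<in> I \<Longrightarrow>
      ef (length ar) q n (fibre \<pi> U i, less_rel, S) (\<lambda>j. fibre \<pi> (\<rho> j) i)
        (fibre \<pi>' U' i, less_rel, S') (\<lambda>j. fibre \<pi>' (\<rho>' j) i)"
  shows "ef (length ar) q n (U, lex_order \<pi>, inflate ar U \<pi> S G) \<rho>
    (U', lex_order \<pi>', inflate ar U' \<pi>' S' G) \<rho>'"
  using assms(3-5)
proof (induction q arbitrary: n \<rho> \<rho>')
  case 0
  then show ?case unfolding ef.simps by (intro allI impI sat_atom_inflate[OF imgs]) simp_all
next
  case (Suc q)
  let ?st = "\<lambda>i A A'. ef (length ar) q (Suc n) (fibre \<pi> U i, less_rel, S)
    ((\<lambda>j. fibre \<pi> (\<rho> j) i)(n := A)) (fibre \<pi>' U' i, less_rel, S') ((\<lambda>j. fibre \<pi>' (\<rho>' j) i)(n := A'))"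
  have upd: "(\<lambda>j. fibre \<pi> ((\<rho>(n := A)) j) i) = (\<lambda>j. fibre \<pi> (\<rho> j) i)(n := fibre \<pi> A i)" for A i
    by (rule ext) simp
  have upd': "(\<lambda>j. fibre \<pi>' ((\<rho>'(n := A)) j) i) = (\<lambda>j. fibre \<pi>' (\<rho>' j) i)(n := fibre \<pi>' A i)" for A i
    by (rule ext) simp
  have step: "ef (length ar) q (Suc n) (U, lex_order \<pi>, inflate ar U \<pi> S G) (\<rho>(n := A))
      (U', lex_order \<pi>', inflate ar U' \<pi>' S' G) (\<rho>'(n := A'))"
    if "A \<subseteq> U" "A' \<subseteq> U'" "\<And>i. i \<in> I \<Longrightarrow> ?st i (fibre \<pi> A i) (fibre \<pi>' A' i)" for A A'
  proof (rule Suc.IH)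
    show "(\<rho>(n := A)) j \<subseteq> U" if "j < Suc n" for j
      using that Suc.prems(1) \<open>A \<subseteq> U\<close> by (auto simp: less_Suc_eq)
    show "(\<rho>'(n := A')) j \<subseteq> U'" if "j < Suc n" for j
      using that Suc.prems(2) \<open>A' \<subseteq> U'\<close> by (auto simp: less_Suc_eq)
  qed (unfold upd upd', rule that(3))
  show ?case unfolding ef.simps
  proof (intro conjI allI impI)
    fix A assume A: "A \<subseteq> U"
    have "\<forall>i\<in>I. \<exists>B\<subseteq>fibre \<pi>' U' i. ?st i (fibre \<pi> A i) B"
    proof
      fix i assume "i \<in> I"
      moreover have "fibre \<pi> A i \<subseteq> fibre \<pi> U i" using A by auto
      ultimately show "\<exists>B\<subseteq>fibre \<pi>' U' i. ?st i (fibre \<pi> A i) B"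
        using Suc.prems(3)[of i] unfolding ef.simps by blast
    qed
    then obtain B where B: "\<And>i. i \<in> I \<Longrightarrow> B i \<subseteq> fibre \<pi>' U' i"
      "\<And>i. i \<in> I \<Longrightarrow> ?st i (fibre \<pi> A i) (B i)" by metis
    \<comment> \<open>Answers that stay inside their fibres are disjoint, so the union cuts back to
      each of them.\<close>
    have "fibre \<pi>' (\<Union>i\<in>I. B i) i = B i" if "i \<in> I" for i
      using B(1) that by (force simp: fibre_def)
    moreover have "(\<Union>i\<in>I. B i) \<subseteq> U'" using B(1) by force
    ultimately show "\<exists>A'\<subseteq>U'. ef (length ar) q (Suc n) (U, lex_order \<pi>, inflate ar U \<pi> S G) (\<rho>(n := A))
        (U', lex_order \<pi>', inflate ar U' \<pi>' S' G) (\<rho>'(n := A'))"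
      using B(2) A by (intro exI[of _ "\<Union>i\<in>I. B i"] conjI step) simp_all
  next
    fix A assume A: "A \<subseteq> U'"
    have "\<forall>i\<in>I. \<exists>B\<subseteq>fibre \<pi> U i. ?st i B (fibre \<pi>' A i)"
    proof
      fix i assume "i \<in> I"
      moreover have "fibre \<pi>' A i \<subseteq> fibre \<pi>' U' i" using A by auto
      ultimately show "\<exists>B\<subseteq>fibre \<pi> U i. ?st i B (fibre \<pi>' A i)"
        using Suc.prems(3)[of i] unfolding ef.simps by blast
    qed
    then obtain B where B: "\<And>i. i \<in> I \<Longrightarrow> B i \<subseteq> fibre \<pi> U i"
      "\<And>i. i \<in> I \<Longrightarrow> ?st i (B i) (fibre \<pi>' A i)" by metis
    have "fibre \<pi> (\<Union>i\<in>I. B i) i = B i" if "i \<in> I" for i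
      using B(1) that by (force simp: fibre_def)
    moreover have "(\<Union>i\<in>I. B i) \<subseteq> U" using B(1) by force
    ultimately show "\<exists>A'\<subseteq>U. ef (length ar) q (Suc n) (U, lex_order \<pi>, inflate ar U \<pi> S G) (\<rho>(n := A'))
        (U', lex_order \<pi>', inflate ar U' \<pi>' S' G) (\<rho>'(n := A))"
      using B(2) A by (intro exI[of _ "\<Union>i\<in>I. B i"] conjI step) simp_all
  qed
qed

text \<open>A list that is constant under \<open>\<pi>\<close> is also constant under the
  composition. Hence both sides decide in the same way: \<open>S\<close> inside a fibre of
  \<open>\<pi>\<close>, else \<open>C\<close> inside a fibre of the composition, else
  \<open>G\<close>.\<close>

lemma inflate_inflate:
  assumes "\<pi> ` U \<subseteq> I"
  shows "inflate ar U \<pi> S (inflate ar I \<mu> C G) =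
    inflate ar U (\<mu> \<circ> \<pi>) (inflate ar U \<pi> S C) G"
proof -
  have "is_singleton ((\<mu> \<circ> \<pi>) ` A)" if "is_singleton (\<pi> ` A)" for A
    using that by (metis image_comp image_empty image_insert is_singleton_def)
  moreover have "set (map \<pi> xs) \<subseteq> I" if "set xs \<subseteq> U" for xs using that assms by auto
  ultimately show ?thesis
    by (fastforce simp: inflate_def facts_def image_comp)
qed

section \<open>Types and order invariance\<close>

lemma sat_restrict:
  assumes "wf_msol ar \<phi>"
  shows "sat U L (restrict R {..<length ar}) e E \<phi> = sat U L R e E \<phi>"
  using assms by (induction \<phi> arbitrary: e E) auto

lemma finite_facts: "finite U \<Longrightarrow> finite (facts ar U)"
  unfolding facts_def
  by (rule finite_subset[of _ "\<Union>r<length ar. Pair r ` {xs. set xs \<subseteq> U \<and> length xs = ar ! r}"])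
    (auto intro: finite_lists_length_eq)

lemma inflate_subset_facts: "inflate ar U \<pi> S G \<subseteq> facts ar U"
  by (auto simp: inflate_def)

lemma linear_orders_image:
  assumes "bij_betw h U V" "L \<in> linear_orders U"
  shows "map_prod h h ` L \<in> linear_orders V"
proof -
  have inj: "inj_on h U" and V: "V = h ` U" using assms(1) by (auto simp: bij_betw_def)
  have L: "L \<subseteq> U \<times> U" "trans L" "irrefl L" "total_on U L"
    using assms(2) by (auto simp: linear_orders_def strict_linear_order_on_def)
  define K where "K = map_prod h h ` L"
  have K: "(h a, h b) \<in> K \<longleftrightarrow> (a, b) \<in> L" if "a \<in> U" "b \<in> U" for a b
  proof
    assume "(h a, h b) \<in> K"
    then obtain p where "p \<in> L" "map_prod h h p = (h a, h b)" unfolding K_def by force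
    moreover then have "fst p \<in> U" "snd p \<in> U" using L(1) by auto
    ultimately show "(a, b) \<in> L" using that inj by (cases p) (auto dest: inj_onD)
  qed (force simp: K_def)
  have KV: "K \<subseteq> V \<times> V" unfolding K_def using L(1) V by auto
  have "trans K"
  proof (rule transI)
    fix x y z assume *: "(x, y) \<in> K" "(y, z) \<in> K"
    then have "x \<in> V" "y \<in> V" "z \<in> V" using KV by auto
    then obtain a b c where abc: "x = h a" "y = h b" "z = h c" "a \<in> U" "b \<in> U" "c \<in> U"
      using V by blast
    then have "(a, b) \<in> L" "(b, c) \<in> L" using * K by auto
    then have "(a, c) \<in> L" by (rule transD[OF L(2)])
    then show "(x, z) \<in> K" using abc K by simp
  qed
  moreover have "irrefl K"
  proof (rule irreflI)
    fix x show "(x, x) \<notin> K"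
    proof
      assume *: "(x, x) \<in> K"
      then obtain a where "x = h a" "a \<in> U" using KV V by blast
      then show False using * K L(3) by (auto simp: irrefl_def)
    qed
  qed
  moreover have "total_on V K"
  proof (rule total_onI)
    fix x y assume "x \<in> V" "y \<in> V" "x \<noteq> y"
    then obtain a b where "x = h a" "y = h b" "a \<in> U" "b \<in> U" "a \<noteq> b" using V by blast
    then show "(x, y) \<in> K \<or> (y, x) \<in> K" using L(4) K unfolding total_on_def by simp
  qed
  ultimately show ?thesis using KV
    unfolding K_def linear_orders_def strict_linear_order_on_def by simp
qed

lemma lex_order_linear:
  fixes \<pi> :: "nat \<Rightarrow> nat"
  shows "lex_order \<pi> \<inter> U \<times> U \<in> linear_orders U"
  unfolding linear_orders_def strict_linear_order_on_def
  by (auto simp: lex_order_def trans_def irrefl_def total_on_def)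

text \<open>Loops at a point belong to its type, so an index structure consists of the other facts.
  Nullary facts are among these, the empty set being no singleton.\<close>

definition outer :: "nat list \<Rightarrow> 'a set \<Rightarrow> 'a facts" where
  "outer ar I = {(r, xs) \<in> facts ar I. \<not> is_singleton (set xs)}"

lemma finite_outer: "finite I \<Longrightarrow> finite (outer ar I)"
  unfolding outer_def by (rule finite_subset[OF _ finite_facts[of I ar]]) auto

text \<open>Disjoint unions are formed from coded pairs, so that all structures have numbers as
  elements and one finite set of types serves for all; this is the projection to the index.\<close>

definition index :: "nat \<Rightarrow> nat" where
  "index x = fst (prod_decode x)"

lemma index_encode [simp]: "index (prod_encode p) = fst p"
  by (simp add: index_def)

locale tv_specker =
  fixes ar :: "nat list" and \<phi> :: msol
  assumes binary: "\<forall>k\<in>set ar. k \<le> 2" and tv: "\<phi> \<in> TVMSOL ar"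
begin

abbreviation "qd \<equiv> quantifier_depth \<phi>"

lemma wf: "wf_msol ar \<phi>"
  using tv by (auto simp: TVMSOL_def msol_sentence_def)

lemma ef_models:
  assumes "ef (length ar) qd 0 (U, L, Q) \<rho> (U', L', Q') \<rho>'"
    and "\<And>r. r < length ar \<Longrightarrow> (r, []) \<in> Q \<longleftrightarrow> (r, []) \<in> Q'"
  shows "models U L (relations Q) \<phi> \<longleftrightarrow> models U' L' (relations Q') \<phi>"
proof -
  have "fo_free \<phi> = {}" "so_free \<phi> = {}"
    using tv by (auto simp: TVMSOL_def msol_sentence_def)
  then show ?thesis unfolding models_def
    by (intro ef_sat[OF assms(1) order_refl wf binary assms(2),
          where v = "\<lambda>_. 0" and V = "\<lambda>_. 0"]) simp_all
qed

text \<open>\<open>less_rel\<close> and \<open>lex_order\<close> are relations on a whole type,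
  whereas \<open>linear_orders U\<close> asks for relations inside \<open>U\<close>.\<close>

lemma models_restrict_order:
  "models U (L \<inter> U \<times> U) (relations Q) \<phi> = models U L (relations Q) \<phi>"
proof -
  have "ef (length ar) qd 0 (U, L, Q) (\<lambda>_. {}) ((\<lambda>x. x) ` U, L \<inter> U \<times> U, Q) (\<lambda>_. {})"
    by (rule ef_iso) auto
  from ef_models[OF this] show ?thesis by simp
qed

text \<open>Invariance is given for the universes \<open>{1..n}\<close>; it is carried to any finite
  non-empty set of numbers along a bijection, which moves the orders as well as the facts.\<close>

lemma order_invariant:
  fixes U :: "nat set"
  assumes U: "finite U" "U \<noteq> {}" and Q: "Q \<subseteq> facts ar U"
    and L: "L \<in> linear_orders U" "L' \<in> linear_orders U"
  shows "models U L (relations Q) \<phi> = models U L' (relations Q) \<phi>"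
proof -
  define n where "n = card U"
  have n: "n \<ge> 1" using U by (simp add: n_def Suc_le_eq card_gt_0_iff)
  have "\<exists>h. bij_betw h U {1..n}"
    by (rule finite_same_card_bij) (simp_all add: U(1) n_def)
  then obtain h where h: "bij_betw h U {1..n}" by blast
  then have inj: "inj_on h U" and img: "h ` U = {1..n}" by (auto simp: bij_betw_def)
  define Q' where "Q' = (\<lambda>(r, xs). (r, map h xs)) ` Q"
  have Q': "(r, map h xs) \<in> Q' \<longleftrightarrow> (r, xs) \<in> Q" if "set xs \<subseteq> U" for r xs
  proof
    assume "(r, map h xs) \<in> Q'"
    then obtain ys where ys: "(r, ys) \<in> Q" "map h xs = map h ys" by (auto simp: Q'_def)
    then have "set ys \<subseteq> U" using Q by (auto simp: facts_def)
    then have "xs = ys" using ys(2) that inj by (metis Un_least inj_on_subset map_inj_on)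
    then show "(r, xs) \<in> Q" using ys by simp
  qed (force simp: Q'_def)
  have transfer: "models U K (relations Q) \<phi> =
    models {1..n} (map_prod h h ` K) (relations Q') \<phi>" if K: "K \<in> linear_orders U" for K
  proof -
    have KU: "K \<subseteq> U \<times> U" using K by (simp add: linear_orders_def)
    have "ef (length ar) qd 0 (U, K, Q) (\<lambda>_. {}) (h ` U, map_prod h h ` K, Q') (\<lambda>_. {})"
    proof (rule ef_iso[OF inj])
      fix x y assume xy: "x \<in> U" "y \<in> U"
      show "(h x, h y) \<in> map_prod h h ` K \<longleftrightarrow> (x, y) \<in> K"
      proof
        assume "(h x, h y) \<in> map_prod h h ` K"
        then obtain a b where "h x = h a" "h y = h b" "(a, b) \<in> K" by auto
        then show "(x, y) \<in> K" using xy KU inj by (metis SigmaD1 SigmaD2 inj_onD subsetD)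
      qed force
      show "(r, [h x, h y]) \<in> Q' \<longleftrightarrow> (r, [x, y]) \<in> Q" for r
        using Q'[of "[x, y]" r] xy by simp
    next
      fix x assume "x \<in> U"
      then show "(r, [h x]) \<in> Q' \<longleftrightarrow> (r, [x]) \<in> Q" for r using Q'[of "[x]" r] by simp
    qed auto
    from ef_models[OF this] show ?thesis using Q'[of "[]"] img by simp
  qed
  \<comment> \<open>\<open>interps\<close> consists of functions that are undefined beyond the
    vocabulary; a well-formed formula does not see the difference.\<close>
  define R where "R = restrict (relations Q') {..<length ar}"
  have R: "R \<in> interps ar {1..n}"
    unfolding R_def interps_def
  proof (rule restrict_PiE_iff[THEN iffD2], intro ballI PowI subsetI)
    fix r xs assume "r \<in> {..<length ar}" "xs \<in> relations Q' r"
    then obtain ys where "(r, ys) \<in> Q" "xs = map h ys"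
      by (auto simp: relations_def Q'_def)
    then show "xs \<in> {xs. set xs \<subseteq> {1..n} \<and> length xs = ar ! r}"
      using Q img by (auto simp: facts_def)
  qed
  have m: "models {1..n} K R \<phi> = models {1..n} K (relations Q') \<phi>" for K
    unfolding models_def R_def by (rule sat_restrict[OF wf])
  have "models {1..n} (map_prod h h ` L) R \<phi> = models {1..n} (map_prod h h ` L') R \<phi>"
    using tv n R L linear_orders_image[OF h]
    unfolding TVMSOL_def tv_order_invariant_def by blast
  then show ?thesis using m transfer L by simp
qed

definition holds :: "nat set \<Rightarrow> nat facts \<Rightarrow> bool" where
  "holds U Q \<longleftrightarrow> models U less_rel (relations Q) \<phi>"

text \<open>Order invariance enters here: the natural order may be exchanged for an ordered sum of
  the fibres of any \<open>\<pi>\<close>, monotone or not.\<close>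

lemma holds_lex:
  assumes "finite U" "U \<noteq> {}" "Q \<subseteq> facts ar U"
  shows "holds U Q \<longleftrightarrow> models U (lex_order (\<pi> :: nat \<Rightarrow> nat)) (relations Q) \<phi>"
proof -
  have "less_rel = lex_order (\<lambda>x::nat. x)" by (auto simp: less_rel_def lex_order_def)
  then have "holds U Q \<longleftrightarrow> models U (lex_order (\<lambda>x::nat. x) \<inter> U \<times> U) (relations Q) \<phi>"
    unfolding holds_def models_restrict_order by simp
  also have "\<dots> \<longleftrightarrow> models U (lex_order \<pi> \<inter> U \<times> U) (relations Q) \<phi>"
    by (rule order_invariant[OF assms lex_order_linear lex_order_linear])
  finally show ?thesis by (simp add: models_restrict_order)
qed

definition equivalent :: "nat set \<times> nat facts \<Rightarrow> nat set \<times> nat facts \<Rightarrow> bool" where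
  "equivalent X Y \<longleftrightarrow> ef (length ar) qd 0 (fst X, less_rel, snd X) (\<lambda>_. {})
    (fst Y, less_rel, snd Y) (\<lambda>_. {})"

lemma equivalent_sym: "equivalent X Y \<Longrightarrow> equivalent Y X"
  unfolding equivalent_def by (rule ef_sym)

lemma equivalent_trans: "equivalent X Y \<Longrightarrow> equivalent Y Z \<Longrightarrow> equivalent X Z"
  unfolding equivalent_def by (rule ef_trans)

text \<open>Monotonicity of \<open>h\<close> on \<open>P\<close> takes care of the order. Empty
  lists are exempt, since no atom sees nullary facts.\<close>

lemma equivalent_iso:
  assumes mono: "strict_mono_on P h" and eq: "P' = h ` P"
    and S: "\<And>r xs. set xs \<subseteq> P \<Longrightarrow> xs \<noteq> [] \<Longrightarrow> (r, map h xs) \<in> S' \<longleftrightarrow> (r, xs) \<in> S"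
  shows "equivalent (P, S) (P', S')"
proof -
  have "ef (length ar) qd 0 (P, less_rel, S) (\<lambda>_. {}) (h ` P, less_rel, S') (\<lambda>_. {})"
  proof (rule ef_iso)
    show "inj_on h P" by (rule strict_mono_on_imp_inj_on[OF mono])
    fix x assume x: "x \<in> P"
    then show "(r, [h x]) \<in> S' \<longleftrightarrow> (r, [x]) \<in> S" for r using S[of "[x]" r] by simp
    fix y assume y: "y \<in> P"
    show "(h x, h y) \<in> less_rel \<longleftrightarrow> (x, y) \<in> less_rel"
      using strict_mono_on_less[OF mono x y] by (simp add: less_rel_def)
    show "(r, [h x, h y]) \<in> S' \<longleftrightarrow> (r, [x, y]) \<in> S" for r using S[of "[x, y]" r] x y by simp
  qed auto
  then show ?thesis by (simp add: equivalent_def eq)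
qed

text \<open>The composition theorem compares the two ordered sums; order invariance leads from each
  of them to the natural order.\<close>

lemma holds_inflate:
  fixes \<pi> \<pi>' :: "nat \<Rightarrow> nat"
  assumes "finite U" "finite U'" "\<pi> ` U = I" "\<pi>' ` U' = I" "I \<noteq> {}"
    and "\<And>i. i \<in> I \<Longrightarrow> equivalent (fibre \<pi> U i, S) (fibre \<pi>' U' i, S')"
  shows "holds U (inflate ar U \<pi> S G) \<longleftrightarrow> holds U' (inflate ar U' \<pi>' S' G)"
proof -
  have e: "fibre \<pi> {} = (\<lambda>_. {})" for \<pi> :: "nat \<Rightarrow> nat" by (auto simp: fibre_def)
  have "ef (length ar) qd 0 (U, lex_order \<pi>, inflate ar U \<pi> S G) (\<lambda>_. {})
    (U', lex_order \<pi>', inflate ar U' \<pi>' S' G) (\<lambda>_. {})"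
    by (rule ef_inflate[OF assms(3,4)]) (use assms(6) in \<open>auto simp: equivalent_def e\<close>)
  then have "models U (lex_order \<pi>) (relations (inflate ar U \<pi> S G)) \<phi> =
    models U' (lex_order \<pi>') (relations (inflate ar U' \<pi>' S' G)) \<phi>"
    by (rule ef_models) (auto simp: inflate_def facts_def is_singleton_def)
  moreover have "U \<noteq> {}" "U' \<noteq> {}" using assms(3-5) by auto
  ultimately show ?thesis
    using holds_lex[OF assms(1) _ inflate_subset_facts, where \<pi> = \<pi>]
      holds_lex[OF assms(2) _ inflate_subset_facts, where \<pi> = \<pi>'] by blast
qed

text \<open>The code of a finite classification that refines \<open>equivalent\<close>; equivalent
  structures may carry different types.\<close>

definition type_of :: "nat set \<times> nat facts \<Rightarrow> nat" where
  "type_of = (SOME g. finite (range g) \<and> (\<forall>X Y. g X = g Y \<longrightarrow> equivalent X Y))"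

lemma type_of: "finite (range type_of)" "type_of X = type_of Y \<Longrightarrow> equivalent X Y"
proof -
  obtain g :: "nat ordered_structure \<times> (nat \<Rightarrow> nat set) \<Rightarrow> nat" where g: "finite (range g)"
    "\<And>\<AA> \<rho> \<BB> \<rho>'. g (\<AA>, \<rho>) = g (\<BB>, \<rho>') \<Longrightarrow> ef (length ar) qd 0 \<AA> \<rho> \<BB> \<rho>'"
    using ef_finite_index[of "length ar" qd 0] by blast
  define g' where "g' X = g ((fst X, less_rel, snd X), (\<lambda>_. {}))" for X :: "nat set \<times> nat facts"
  have "range g' \<subseteq> range g" by (auto simp: g'_def)
  then have "finite (range g')" using g(1) by (rule finite_subset)
  moreover have "g' X = g' Y \<Longrightarrow> equivalent X Y" for X Y
    unfolding g'_def equivalent_def by (rule g(2))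
  ultimately have "\<exists>g::nat set \<times> nat facts \<Rightarrow> nat.
      finite (range g) \<and> (\<forall>X Y. g X = g Y \<longrightarrow> equivalent X Y)"
    by (intro exI[of _ g']) blast
  from someI_ex[OF this, folded type_of_def]
  show "finite (range type_of)" "type_of X = type_of Y \<Longrightarrow> equivalent X Y" by blast+
qed

definition proper :: "nat set \<times> nat facts \<Rightarrow> bool" where
  "proper X \<longleftrightarrow> finite (fst X) \<and> fst X \<noteq> {} \<and> snd X \<subseteq> facts ar (fst X)"

definition types :: "nat set" where
  "types = type_of ` Collect proper"

definition rep :: "nat \<Rightarrow> nat set \<times> nat facts" where
  "rep t = (SOME X. proper X \<and> type_of X = t)"

lemma finite_types: "finite types"
  unfolding types_def by (rule finite_subset[OF _ type_of(1)]) auto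

lemma rep:
  assumes "t \<in> types"
  shows "proper (rep t)" "type_of (rep t) = t"
proof -
  have "\<exists>X. proper X \<and> type_of X = t" using assms by (auto simp: types_def)
  from someI_ex[OF this, folded rep_def]
  show "proper (rep t)" "type_of (rep t) = t" by auto
qed

lemma type_of_in_types: "proper X \<Longrightarrow> type_of X \<in> types"
  unfolding types_def by simp

lemma equivalent_rep: "proper X \<Longrightarrow> equivalent X (rep (type_of X))"
  by (rule type_of(2)) (simp add: rep type_of_in_types)

section \<open>Acceptance of an index structure whose points carry types\<close>

definition glue_univ :: "nat set \<Rightarrow> (nat \<Rightarrow> nat) \<Rightarrow> nat set" where
  "glue_univ I \<tau> = prod_encode ` (SIGMA i:I. fst (rep (\<tau> i)))"

definition glue_facts :: "(nat \<Rightarrow> nat) \<Rightarrow> nat facts" where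
  "glue_facts \<tau> = {(r, map (\<lambda>x. prod_encode (i, x)) xs) | r i xs. (r, xs) \<in> snd (rep (\<tau> i))}"

text \<open>Truth is tested on one canonical inflation, built from disjoint copies of the
  representatives; \<open>accepts_realizes\<close> shows that every other inflation with equivalent
  fibres gives the same answer.\<close>

definition accepts :: "nat set \<Rightarrow> (nat \<Rightarrow> nat) \<Rightarrow> nat facts \<Rightarrow> bool" where
  "accepts I \<tau> G \<longleftrightarrow>
    holds (glue_univ I \<tau>) (inflate ar (glue_univ I \<tau>) index (glue_facts \<tau>) G)"

definition realizes :: "nat set \<Rightarrow> (nat \<Rightarrow> nat) \<Rightarrow> nat facts \<Rightarrow> nat set \<Rightarrow> (nat \<Rightarrow> nat) \<Rightarrow> bool" where
  "realizes U \<pi> S I \<tau> \<longleftrightarrow>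
    finite U \<and> \<pi> ` U = I \<and> (\<forall>i\<in>I. equivalent (fibre \<pi> U i, S) (rep (\<tau> i)))"

text \<open>\<open>prod_encode (i, x)\<close> is \<open>triangle (i + x) + i\<close>, which
  increases with \<open>x\<close>. So copying a representative into its fibre respects its
  order.\<close>

lemma strict_mono_on_prod_encode: "strict_mono_on A (\<lambda>x. prod_encode (i, x))"
proof (rule strict_mono_onI)
  fix x y :: nat assume "x < y"
  then have "triangle (i + x) < triangle (i + y)"
  proof (induction y)
    case (Suc y)
    then show ?case by (cases "x = y") auto
  qed simp
  then show "prod_encode (i, x) < prod_encode (i, y)" by (simp add: prod_encode_def)
qed

lemma fibre_glue_univ:
  "fibre index (glue_univ I \<tau>) i = (if i \<in> I then (\<lambda>x. prod_encode (i, x)) ` fst (rep (\<tau> i)) else {})"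
  by (auto simp: fibre_def glue_univ_def)

lemma glue_facts_iff:
  assumes "xs \<noteq> []"
  shows "(r, map (\<lambda>x. prod_encode (i, x)) xs) \<in> glue_facts \<tau> \<longleftrightarrow> (r, xs) \<in> snd (rep (\<tau> i))"
proof
  assume "(r, map (\<lambda>x. prod_encode (i, x)) xs) \<in> glue_facts \<tau>"
  then obtain j ys where ys: "(r, ys) \<in> snd (rep (\<tau> j))"
    "map (\<lambda>x. prod_encode (i, x)) xs = map (\<lambda>x. prod_encode (j, x)) ys"
    by (auto simp: glue_facts_def)
  have "i = j" using ys(2) assms by (cases xs; cases ys) auto
  moreover have "inj (\<lambda>x. prod_encode (j, x))" by (auto simp: inj_on_def)
  ultimately have "xs = ys" using ys(2) by (simp add: inj_map_eq_map)
  then show "(r, xs) \<in> snd (rep (\<tau> i))" using ys \<open>i = j\<close> by simp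
qed (auto simp: glue_facts_def)

lemma glue_realizes:
  assumes "finite I" "\<tau> ` I \<subseteq> types"
  shows "realizes (glue_univ I \<tau>) index (glue_facts \<tau>) I \<tau>"
  unfolding realizes_def
proof (intro conjI ballI)
  have "finite (fst (rep (\<tau> i)))" "fst (rep (\<tau> i)) \<noteq> {}" if "i \<in> I" for i
    using rep(1)[of "\<tau> i"] that assms(2) by (auto simp: proper_def)
  then show "finite (glue_univ I \<tau>)" "index ` glue_univ I \<tau> = I"
    using assms(1) unfolding glue_univ_def by (force simp: image_image)+
  fix i assume "i \<in> I"
  have "equivalent (fst (rep (\<tau> i)), snd (rep (\<tau> i))) (fibre index (glue_univ I \<tau>) i, glue_facts \<tau>)"
    by (rule equivalent_iso[OF strict_mono_on_prod_encode[of _ i]])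
      (simp_all add: fibre_glue_univ \<open>i \<in> I\<close> glue_facts_iff)
  then show "equivalent (fibre index (glue_univ I \<tau>) i, glue_facts \<tau>) (rep (\<tau> i))"
    using equivalent_sym by simp
qed

lemma accepts_realizes:
  assumes "realizes U \<pi> S I \<tau>" "\<tau> ` I \<subseteq> types" "I \<noteq> {}"
  shows "holds U (inflate ar U \<pi> S G) \<longleftrightarrow> accepts I \<tau> G"
proof -
  have "finite I" using assms(1) by (auto simp: realizes_def)
  note g = glue_realizes[OF this assms(2)]
  show ?thesis unfolding accepts_def
    by (rule holds_inflate)
      (use assms g equivalent_trans equivalent_sym in \<open>unfold realizes_def, blast+\<close>)
qed

text \<open>Composing the projection with \<open>\<beta>\<close> turns the canonical inflation over
  \<open>I\<close> into an inflation over \<open>I'\<close>, whatever \<open>\<beta>\<close> does to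
  the order of the indices. This makes rearrangements of words and rotations of blocks symmetries of
  acceptance.\<close>

lemma accepts_bij:
  assumes "finite I" "bij_betw \<beta> I I'" "\<And>i. i \<in> I \<Longrightarrow> \<tau> i = \<tau>' (\<beta> i)" "\<tau>' ` I' \<subseteq> types" "I \<noteq> {}"
  shows "accepts I \<tau> {(r, xs). (r, map \<beta> xs) \<in> G} \<longleftrightarrow> accepts I' \<tau>' G"
proof -
  have \<beta>: "inj_on \<beta> I" "\<beta> ` I = I'" using assms(2) by (auto simp: bij_betw_def)
  have "\<tau> ` I \<subseteq> types" using assms(3,4) \<beta> by auto
  note g = glue_realizes[OF assms(1) this]
  let ?U = "glue_univ I \<tau>"
  have img: "index ` ?U = I" using g by (simp add: realizes_def)
  have sing: "is_singleton (index ` set xs) \<longleftrightarrow> is_singleton ((\<lambda>x. \<beta> (index x)) ` set xs)"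
    if "set xs \<subseteq> ?U" for xs
  proof -
    have "index ` set xs \<subseteq> I" using that img by blast
    then have "inj_on \<beta> (index ` set xs)" using \<beta>(1) by (rule inj_on_subset[rotated])
    then have "card (\<beta> ` index ` set xs) = card (index ` set xs)" by (rule card_image)
    then show ?thesis by (simp add: is_singleton_altdef image_image)
  qed
  then have eq: "inflate ar ?U index S {(r, xs). (r, map \<beta> xs) \<in> G} = inflate ar ?U (\<beta> \<circ> index) S G" for S
    unfolding inflate_def facts_def by (auto simp: sing comp_def)
  have "fibre (\<beta> \<circ> index) ?U (\<beta> i) = fibre index ?U i" if "i \<in> I" for i
    using that \<beta>(1) img unfolding fibre_def by (auto dest: inj_onD)
  then have "realizes ?U (\<beta> \<circ> index) (glue_facts \<tau>) I' \<tau>'"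
    using g assms(3) \<beta>(2) img unfolding realizes_def by (auto simp: image_comp[symmetric] simp del: comp_apply)
  from accepts_realizes[OF this assms(4)] show ?thesis
    unfolding accepts_def eq using \<beta>(2) assms(5) by auto
qed

section \<open>Merging points of equal type into one point\<close>

definition merged_type :: "nat set \<Rightarrow> nat \<Rightarrow> nat facts \<Rightarrow> nat" where
  "merged_type J t C = type_of (glue_univ J (\<lambda>_. t),
    inflate ar (glue_univ J (\<lambda>_. t)) index (glue_facts (\<lambda>_. t)) C)"

lemma proper_glue:
  assumes "finite I" "I \<noteq> {}" "\<tau> ` I \<subseteq> types"
  shows "proper (glue_univ I \<tau>, inflate ar (glue_univ I \<tau>) index S C)"
  using glue_realizes[OF assms(1,3)] assms(2)
  unfolding realizes_def proper_def by (auto simp: inflate_def)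

lemma merged_type_in_types:
  "finite J \<Longrightarrow> J \<noteq> {} \<Longrightarrow> t \<in> types \<Longrightarrow> merged_type J t C \<in> types"
  unfolding merged_type_def by (intro type_of_in_types proper_glue) auto

lemma map_prod_encode_decode:
  assumes "index ` set xs = {i}"
  shows "xs = map (\<lambda>x. prod_encode (i, x)) (map (snd \<circ> prod_decode) xs)"
  unfolding map_map
proof (rule map_idI[symmetric])
  fix x assume "x \<in> set xs"
  then have "index x = i" using assms by blast
  then show "((\<lambda>x. prod_encode (i, x)) \<circ> (snd \<circ> prod_decode)) x = x"
    by (metis comp_apply index_def prod.collapse prod_decode_inverse)
qed

text \<open>The canonical inflation over \<open>I\<close> is inflated in two stages. Seen over
  \<open>I'\<close>, the copies over \<open>J\<close> form one fibre with \<open>C\<close> between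
  them, and its type is the merged one; all other fibres stay as they were.
  \<open>inflate_inflate\<close> identifies the two views.\<close>

lemma accepts_merge:
  assumes I: "finite I" "I \<noteq> {}" "\<tau> ` I \<subseteq> types" "\<mu> ` I = I'"
    and J: "j \<in> I'" "fibre \<mu> I j = J" "\<And>i. i \<in> J \<Longrightarrow> \<tau> i = t" "\<tau>' j = merged_type J t C"
    and inj: "inj_on \<mu> (I - J)" "\<And>i. i \<in> I - J \<Longrightarrow> \<tau>' (\<mu> i) = \<tau> i"
  shows "accepts I \<tau> (inflate ar I \<mu> C G) \<longleftrightarrow> accepts I' \<tau>' G"
proof -
  let ?U = "glue_univ I \<tau>" and ?V = "glue_univ J (\<lambda>_. t)"
  let ?S = "inflate ar ?U index (glue_facts \<tau>) C"
  note g = glue_realizes[OF I(1,3)]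
  have img: "index ` ?U = I" using g by (simp add: realizes_def)
  have "J \<subseteq> I" using J(2) by auto
  have JI: "J \<noteq> {}" "finite J" using I(1,4) J(1,2) \<open>J \<subseteq> I\<close> finite_subset by auto
  have t: "t \<in> types" using JI J(3) I(3) \<open>J \<subseteq> I\<close> by blast
  have V: "fibre (\<mu> \<circ> index) ?U j = ?V"
    using J(2,3) \<open>J \<subseteq> I\<close> unfolding glue_univ_def by (force simp: fibre_def)
  have "realizes ?U (\<mu> \<circ> index) ?S I' \<tau>'"
    unfolding realizes_def
  proof (intro conjI ballI)
    show "finite ?U" using g by (simp add: realizes_def)
    show "(\<mu> \<circ> index) ` ?U = I'" using img I(4) by (metis image_comp)
    fix i' assume i': "i' \<in> I'"
    show "equivalent (fibre (\<mu> \<circ> index) ?U i', ?S) (rep (\<tau>' i'))"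
    proof (cases "i' = j")
      case True
      have "(r, xs) \<in> ?S \<longleftrightarrow> (r, xs) \<in> inflate ar ?V index (glue_facts (\<lambda>_. t)) C"
        if xs: "set xs \<subseteq> ?V" "xs \<noteq> []" for r xs
      proof -
        have "?V \<subseteq> ?U" using V by auto
        have "(r, xs) \<in> glue_facts \<tau> \<longleftrightarrow> (r, xs) \<in> glue_facts (\<lambda>_. t)"
          if sing: "is_singleton (index ` set xs)"
        proof -
          obtain i where i: "index ` set xs = {i}" using sing unfolding is_singleton_def ..
          define ys where "ys = map (snd \<circ> prod_decode) xs"
          have "xs = map (\<lambda>x. prod_encode (i, x)) ys"
            unfolding ys_def by (rule map_prod_encode_decode[OF i])
          moreover have "i \<in> J"
          proof -
            have "i \<in> index ` set xs" using i by simp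
            then show ?thesis using xs(1) by (auto simp: glue_univ_def)
          qed
          ultimately show ?thesis using glue_facts_iff[of ys] xs(2) J(3) by auto
        qed
        then show ?thesis using xs(1) \<open>?V \<subseteq> ?U\<close> by (auto simp: inflate_def facts_def)
      qed
      then have "equivalent (?V, ?S) (?V, inflate ar ?V index (glue_facts (\<lambda>_. t)) C)"
        by (intro equivalent_iso[where h = "\<lambda>x. x"]) (auto simp: strict_mono_on_def)
      moreover have "equivalent (?V, inflate ar ?V index (glue_facts (\<lambda>_. t)) C) (rep (\<tau>' j))"
        unfolding J(4) merged_type_def
        by (rule equivalent_rep, rule proper_glue[OF JI(2,1)]) (use t in auto)
      ultimately show ?thesis unfolding True V by (rule equivalent_trans)
    next
      case False
      obtain i where i: "i \<in> I" "\<mu> i = i'" using i' I(4) by auto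
      then have "i \<notin> J" using False J(2) by auto
      have uniq: "i'' = i" if "i'' \<in> I" "\<mu> i'' = i'" for i''
      proof -
        have "i'' \<notin> J" using False J(2) that by auto
        then show ?thesis using inj(1) i that \<open>i \<notin> J\<close> by (auto dest: inj_onD)
      qed
      have F: "fibre (\<mu> \<circ> index) ?U i' = fibre index ?U i"
      proof (rule set_eqI)
        fix x
        have "index x \<in> I" if "x \<in> ?U" using that img by blast
        then show "x \<in> fibre (\<mu> \<circ> index) ?U i' \<longleftrightarrow> x \<in> fibre index ?U i"
          using uniq[of "index x"] i(2) by (metis comp_apply mem_fibre)
      qed
      \<comment> \<open>Over the single index \<open>i\<close> the inflation follows
        \<open>glue_facts \<tau>\<close> and never consults \<open>C\<close>.\<close>
      have "equivalent (fibre index ?U i, ?S) (fibre index ?U i, glue_facts \<tau>)"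
      proof (rule equivalent_iso[where h = "\<lambda>x. x"])
        fix r xs assume xs: "set xs \<subseteq> fibre index ?U i" "xs \<noteq> []"
        then have "index ` set xs = {i}" by (cases xs) auto
        note ind = this
        then have S: "(r, xs) \<in> ?S \<longleftrightarrow> (r, xs) \<in> facts ar ?U \<and> (r, xs) \<in> glue_facts \<tau>"
          by (simp add: inflate_def)
        have "(r, xs) \<in> facts ar ?U" if "(r, xs) \<in> glue_facts \<tau>"
        proof -
          define ys where "ys = map (snd \<circ> prod_decode) xs"
          have ys: "xs = map (\<lambda>x. prod_encode (i, x)) ys"
            unfolding ys_def by (rule map_prod_encode_decode[OF ind])
          then have "(r, ys) \<in> snd (rep (\<tau> i))" using glue_facts_iff[of ys r i \<tau>] that xs(2) by auto
          then have "(r, ys) \<in> facts ar (fst (rep (\<tau> i)))"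
            using rep(1)[of "\<tau> i"] I(3) i(1) unfolding proper_def by blast
          moreover have "set xs \<subseteq> ?U" using xs(1) by auto
          ultimately show ?thesis using ys by (simp add: facts_def)
        qed
        then show "(r, map (\<lambda>x. x) xs) \<in> glue_facts \<tau> \<longleftrightarrow> (r, xs) \<in> ?S"
          using S by auto
      qed (auto simp: strict_mono_on_def)
      then show ?thesis unfolding F using inj(2)[of i] i \<open>i \<notin> J\<close> g equivalent_trans
        unfolding realizes_def by auto
    qed
  qed
  moreover have "\<tau>' ` I' \<subseteq> types"
  proof
    fix t' assume "t' \<in> \<tau>' ` I'"
    then obtain i where i: "i \<in> I" "t' = \<tau>' (\<mu> i)" using I(4) by auto
    show "t' \<in> types"
    proof (cases "i \<in> J")
      case True
      then have "\<mu> i = j" using J(2) by auto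
      then show ?thesis using i J(4) merged_type_in_types[OF JI(2,1) t] by simp
    next
      case False
      then show ?thesis using i inj(2)[of i] I(3) by auto
    qed
  qed
  moreover have "I' \<noteq> {}" using J(1) by blast
  ultimately have "holds ?U (inflate ar ?U (\<mu> \<circ> index) ?S G) \<longleftrightarrow> accepts I' \<tau>' G"
    by (rule accepts_realizes)
  then show ?thesis
    unfolding accepts_def inflate_inflate[of index ?U I, OF equalityD1[OF img]] .
qed

end

section \<open>Rotation of blocks\<close>

text \<open>
  Position \<open>x\<close> belongs to block \<open>x div p\<close>, and \<open>s i\<close> says how far block \<open>i\<close> is rotated.
\<close>

definition rotate_blocks :: "nat \<Rightarrow> (nat \<Rightarrow> nat) \<Rightarrow> nat \<Rightarrow> nat" where
  "rotate_blocks p s x = p * (x div p) + (x mod p + s (x div p)) mod p"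

text \<open>Facts are pulled back, so that membership is a mere substitution; as rotations commute,
  this is an action all the same.\<close>

definition act :: "nat \<Rightarrow> (nat \<Rightarrow> nat) \<Rightarrow> nat facts \<Rightarrow> nat facts" where
  "act p s G = {(r, xs). (r, map (rotate_blocks p s) xs) \<in> G}"

abbreviation unit_rotation :: "nat \<Rightarrow> nat \<Rightarrow> nat" where
  "unit_rotation i \<equiv> (\<lambda>_. 0)(i := 1)"

lemma mem_act [simp]: "(r, xs) \<in> act p s G \<longleftrightarrow> (r, map (rotate_blocks p s) xs) \<in> G"
  by (simp add: act_def)

lemma rotate_blocks_div: "p > 0 \<Longrightarrow> rotate_blocks p s x div p = x div p"
  by (simp add: rotate_blocks_def)

lemma rotate_blocks_mod: "p > 0 \<Longrightarrow> rotate_blocks p s x mod p = (x mod p + s (x div p)) mod p"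
  by (simp add: rotate_blocks_def)

lemma rotate_blocks_comp:
  assumes "p > 0"
  shows "rotate_blocks p s (rotate_blocks p s' x) = rotate_blocks p (\<lambda>i. s i + s' i) x"
proof -
  have "rotate_blocks p s (rotate_blocks p s' x) =
      p * (x div p) + ((x mod p + s' (x div p)) mod p + s (x div p)) mod p"
    unfolding rotate_blocks_def[of p s] rotate_blocks_div[OF assms] rotate_blocks_mod[OF assms] ..
  then show ?thesis by (simp add: rotate_blocks_def mod_simps add_ac)
qed

lemma rotate_blocks_cong:
  assumes "s (x div p) mod p = s' (x div p) mod p"
  shows "rotate_blocks p s x = rotate_blocks p s' x"
proof -
  have "(x mod p + s (x div p)) mod p = (x mod p + s' (x div p)) mod p"
    using assms by (metis mod_add_right_eq)
  then show ?thesis by (simp add: rotate_blocks_def)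
qed

lemma rotate_blocks_id:
  assumes "s (x div p) mod p = 0"
  shows "rotate_blocks p s x = x"
proof -
  have "rotate_blocks p s x = rotate_blocks p (\<lambda>_. 0) x"
    using assms by (intro rotate_blocks_cong) simp
  then show ?thesis by (simp add: rotate_blocks_def)
qed

text \<open>Multiplication by \<open>p - 1\<close> replaces the sign, so that all amounts of
  rotation remain natural numbers: the two amounts add up to a multiple of \<open>p\<close>.\<close>

lemma rotate_blocks_inverse:
  assumes "p > 0"
  shows "rotate_blocks p (\<lambda>i. (p - 1) * s i) (rotate_blocks p s x) = x"
  unfolding rotate_blocks_comp[OF assms]
proof (rule rotate_blocks_id)
  have "(p - 1) * c + c = p * c" for c using assms by (cases p) auto
  then show "((p - 1) * s (x div p) + s (x div p)) mod p = 0" by simp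
qed

lemma inj_rotate_blocks: "p > 0 \<Longrightarrow> inj (rotate_blocks p s)"
  by (metis injI rotate_blocks_inverse)

lemma rotate_blocks_less_iff:
  assumes "p > 0" "\<forall>i\<ge>j. s i = 0" "p * j \<le> n"
  shows "rotate_blocks p s x < n \<longleftrightarrow> x < n"
proof (cases "x div p < j")
  case True
  then have "x < p * j" "rotate_blocks p s x < p * j"
    using rotate_blocks_div[OF assms(1), of s x] assms(1)
    by (simp_all add: div_less_iff_less_mult[symmetric] mult.commute[of p])
  then show ?thesis using assms(3) by simp
next
  case False
  then show ?thesis using assms(2) by (simp add: rotate_blocks_id)
qed

lemma act_act: "p > 0 \<Longrightarrow> act p s (act p s' G) = act p (\<lambda>i. s i + s' i) G"
  by (simp add: act_def rotate_blocks_comp comp_def add.commute)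

lemma act_zero: "act p (\<lambda>_. 0) G = G"
proof -
  have "rotate_blocks p (\<lambda>_. 0) = (\<lambda>x. x)" by (rule ext, rule rotate_blocks_id) simp
  then show ?thesis by (simp add: act_def)
qed

lemma act_mult:
  assumes "p > 0" "act p s G = G"
  shows "act p (\<lambda>i. b * s i) G = G"
proof (induction b)
  case 0
  show ?case by (simp add: act_zero)
next
  case (Suc b)
  have "act p (\<lambda>i. Suc b * s i) G = act p s (act p (\<lambda>i. b * s i) G)"
    by (simp add: act_act[OF assms(1)])
  then show ?case using Suc assms(2) by simp
qed

lemma is_singleton_image_inj:
  assumes "inj_on f A"
  shows "is_singleton (f ` A) \<longleftrightarrow> is_singleton A"
  using card_image[OF assms] by (simp add: is_singleton_altdef)

lemma rotate_blocks_outer: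
  assumes "p > 0" "\<forall>i\<ge>j. s i = 0" "p * j \<le> n"
  shows "(r, map (rotate_blocks p s) xs) \<in> outer ar {..<n} \<longleftrightarrow> (r, xs) \<in> outer ar {..<n}"
proof -
  have "inj_on (rotate_blocks p s) (set xs)"
    by (rule inj_on_subset[OF inj_rotate_blocks[OF assms(1)]]) simp
  then show ?thesis using rotate_blocks_less_iff[OF assms]
    by (auto simp: outer_def facts_def is_singleton_image_inj)
qed

lemma act_outer:
  assumes "p > 0" "\<forall>i\<ge>j. s i = 0" "p * j \<le> n" "G \<subseteq> outer ar {..<n}"
  shows "act p s G \<subseteq> outer ar {..<n}"
  using assms(4) rotate_blocks_outer[OF assms(1-3)] by (auto simp: act_def)

section \<open>Contracting a rotation-invariant block to a point\<close>

definition collapse :: "nat \<Rightarrow> nat \<Rightarrow> nat \<Rightarrow> nat" where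
  "collapse p j x = (if x < p * j then x else if x < p * j + p then p * j else x - p + 1)"

definition expand :: "nat \<Rightarrow> nat \<Rightarrow> nat \<Rightarrow> nat" where
  "expand p j y = (if y \<le> p * j then y else y + p - 1)"

abbreviation block :: "nat \<Rightarrow> nat \<Rightarrow> nat set" where
  "block p j \<equiv> {p * j..<p * j + p}"

lemma mem_block: "p > 0 \<Longrightarrow> x \<in> block p j \<longleftrightarrow> x div p = j"
  by (metis add.commute atLeastLessThan_iff div_nat_eqI dividend_less_div_times mult.commute
      mult_Suc_right times_div_less_eq_dividend)

context
  fixes p j l :: nat and ar :: "nat list"
  assumes p: "p > 0" and binary: "\<forall>k\<in>set ar. k \<le> 2"
begin

private abbreviation (input) "I \<equiv> {..<p * j + p + l}"

private abbreviation (input) "I' \<equiv> {..<p * j + 1 + l}"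

lemma collapse_image: "collapse p j ` I = I'"
proof
  show "collapse p j ` I \<subseteq> I'" using p by (auto simp: collapse_def)
  show "I' \<subseteq> collapse p j ` I"
  proof
    fix y assume "y \<in> I'"
    then have "collapse p j (expand p j y) = y" "expand p j y \<in> I"
      using p by (auto simp: collapse_def expand_def)
    then show "y \<in> collapse p j ` I" by (metis imageI)
  qed
qed

lemma collapse_expand: "collapse p j (expand p j y) = y"
  using p by (auto simp: collapse_def expand_def)

lemma expand_mem: "y \<in> I' \<Longrightarrow> expand p j y \<in> I"
  using p by (auto simp: expand_def)

lemma collapse_eq: "x \<notin> block p j \<Longrightarrow> collapse p j x = collapse p j y \<Longrightarrow> x = y"
  using p by (auto simp: collapse_def split: if_splits)

lemma expand_collapse: "expand p j (collapse p j x) = (if x \<in> block p j then p * j else x)"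
  using p by (auto simp: collapse_def expand_def)

lemma collapse_rotate_blocks:
  assumes "i < j"
  shows "collapse p j (rotate_blocks p (unit_rotation i) x) =
    rotate_blocks p (unit_rotation i) (collapse p j x)"
proof (cases "x < p * j")
  case True
  then have "rotate_blocks p (unit_rotation i) x < p * j"
    using rotate_blocks_less_iff[of p j "unit_rotation i" "p * j" x] p assms by simp
  then show ?thesis using True by (simp add: collapse_def)
next
  case False
  have fixed: "rotate_blocks p (unit_rotation i) y = y" if "\<not> y < p * j" for y
  proof (rule rotate_blocks_id)
    have "y div p \<ge> j" using that p by (simp add: less_eq_div_iff_mult_less_eq mult.commute)
    then show "unit_rotation i (y div p) mod p = 0" using assms by simp
  qed
  have "\<not> collapse p j x < p * j" using False by (auto simp: collapse_def)
  then show ?thesis using fixed False by simp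
qed

lemma rotate_blocks_notin_block:
  "x \<notin> block p j \<Longrightarrow> rotate_blocks p ((\<lambda>_. 0)(j := b)) x = x"
  by (rule rotate_blocks_id) (use mem_block[OF p] in auto)

lemma rotate_blocks_mem_block: "rotate_blocks p s x \<in> block p j \<longleftrightarrow> x \<in> block p j"
  using mem_block[OF p] rotate_blocks_div[OF p] by metis

lemma collapse_rotate_block:
  "collapse p j (rotate_blocks p (unit_rotation j) x) = collapse p j x"
proof (cases "x \<in> block p j")
  case True
  then have "rotate_blocks p (unit_rotation j) x \<in> block p j" using rotate_blocks_mem_block by blast
  then show ?thesis using True by (auto simp: collapse_def)
next
  case False
  then show ?thesis using rotate_blocks_notin_block[of x 1] by simp
qed

text \<open>Empty lists are left out because nullary facts stay with the contracted
  structure.\<close>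

definition block_facts :: "nat facts" where
  "block_facts = {(r, xs) \<in> outer ar (block p j). xs \<noteq> []}"

definition invariant_blocks :: "nat facts set" where
  "invariant_blocks = {C. C \<subseteq> block_facts \<and> act p (unit_rotation j) C = C}"

lemma finite_invariant_blocks: "finite invariant_blocks"
proof -
  have "finite block_facts" unfolding block_facts_def
    by (rule finite_subset[OF _ finite_outer[of "block p j" ar]]) auto
  then show ?thesis unfolding invariant_blocks_def by simp
qed

lemma inflate_collapse_outer:
  assumes "C \<subseteq> block_facts"
  shows "inflate ar I (collapse p j) C G \<subseteq> outer ar I"
proof -
  have "is_singleton (collapse p j ` A)" if "is_singleton A" for A
    using that by (auto simp: is_singleton_def)
  then show ?thesis using assms
    by (auto simp: inflate_def outer_def block_facts_def split: if_splits)
qed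

lemma block_facts_collapse:
  assumes "(r, xs) \<in> block_facts"
  shows "(r, xs) \<in> facts ar I" "is_singleton (collapse p j ` set xs)"
proof -
  from assms have xs: "set xs \<subseteq> block p j" "xs \<noteq> []" "r < length ar" "length xs = ar ! r"
    by (auto simp: block_facts_def outer_def facts_def)
  then have "collapse p j ` set xs = {p * j}" by (cases xs) (auto simp: collapse_def subset_iff)
  moreover have "set xs \<subseteq> I" using xs by auto
  ultimately show "(r, xs) \<in> facts ar I" "is_singleton (collapse p j ` set xs)"
    using xs by (simp_all add: facts_def)
qed

lemma inflate_collapse_block:
  assumes "C \<subseteq> block_facts"
  shows "inflate ar I (collapse p j) C G \<inter> block_facts = C"
  using assms block_facts_collapse by (auto simp: inflate_def)

lemma inflate_collapse_outside:
  assumes "G \<subseteq> outer ar I'"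
  shows "{(r, ys) \<in> outer ar I'. (r, map (expand p j) ys) \<in> inflate ar I (collapse p j) C G} = G"
proof (rule set_eqI, clarify)
  fix r ys
  have "map (collapse p j) (map (expand p j) ys) = ys" by (simp add: comp_def collapse_expand)
  moreover have "collapse p j ` set (map (expand p j) ys) = set ys"
    by (simp add: image_image collapse_expand)
  ultimately have "(r, map (expand p j) ys) \<in> inflate ar I (collapse p j) C G \<longleftrightarrow> (r, ys) \<in> G"
    if "(r, ys) \<in> outer ar I'"
    using that expand_mem by (auto simp: inflate_def outer_def facts_def simp del: map_map)
  then show "(r, ys) \<in> {(r, ys) \<in> outer ar I'. (r, map (expand p j) ys) \<in>
      inflate ar I (collapse p j) C G} \<longleftrightarrow> (r, ys) \<in> G"
    using assms by blast
qed

lemma collapse_singleton: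
  assumes "is_singleton (collapse p j ` A)"
  shows "A \<subseteq> block p j \<or> is_singleton A"
proof (rule disjCI)
  assume "\<not> is_singleton A"
  obtain y where y: "collapse p j ` A = {y}" using assms by (auto simp: is_singleton_def)
  show "A \<subseteq> block p j"
  proof (rule ccontr)
    assume "\<not> A \<subseteq> block p j"
    then obtain x where x: "x \<in> A" "x \<notin> block p j" by blast
    have "z = x" if "z \<in> A" for z
    proof -
      have "collapse p j x = collapse p j z" using x(1) that by (metis imageI singletonD y)
      then show ?thesis using collapse_eq[OF x(2)] by simp
    qed
    then have "A = {x}" using x(1) by blast
    then show False using \<open>\<not> is_singleton A\<close> by simp
  qed
qed

lemma length_le_2: "(r, xs) \<in> facts ar A \<Longrightarrow> length xs \<le> 2"
  using binary by (auto simp: facts_def)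

text \<open>Two entries that do not collapse to one point cannot both lie in the block, and a single
  point of the block can be rotated to the first place \<open>p * j\<close>. With three entries, two
  distinct points of the block could occur beside a point outside, and no rotation would bring both
  to the first place.\<close>

lemma rotate_to_expand:
  assumes "length xs \<le> 2" "\<not> is_singleton (collapse p j ` set xs)"
  shows "\<exists>b. map (rotate_blocks p ((\<lambda>_. 0)(j := b))) xs = map (expand p j \<circ> collapse p j) xs"
proof (cases "\<exists>z\<in>set xs. z \<in> block p j")
  case False
  then have "map (rotate_blocks p ((\<lambda>_. 0)(j := 0))) xs = map (expand p j \<circ> collapse p j) xs"
    using rotate_blocks_notin_block by (auto simp: expand_collapse simp del: atLeastLessThan_iff)
  then show ?thesis ..
next
  case True
  then obtain z where z: "z \<in> set xs" "z \<in> block p j" by blast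
  have uniq: "x = z" if x: "x \<in> set xs" "x \<in> block p j" for x
  proof (rule ccontr)
    assume "x \<noteq> z"
    then have "set xs = {x, z}"
      using assms(1) x z by (cases xs; cases "tl xs"; cases "tl (tl xs)") auto
    then have "collapse p j ` set xs = {p * j}"
      using x(2) z(2) by (auto simp: collapse_def)
    then show False using assms(2) by simp
  qed
  define b where "b = p - z mod p"
  have "z div p = j" using z mem_block[OF p] by simp
  then have "rotate_blocks p ((\<lambda>_. 0)(j := b)) z = p * j"
    using p by (simp add: rotate_blocks_def b_def)
  then have "rotate_blocks p ((\<lambda>_. 0)(j := b)) x = expand p j (collapse p j x)" if "x \<in> set xs" for x
    using uniq[OF that] rotate_blocks_notin_block[of x b] unfolding expand_collapse
    by (cases "x \<in> block p j") auto
  then have "map (rotate_blocks p ((\<lambda>_. 0)(j := b))) xs = map (expand p j \<circ> collapse p j) xs" by simp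
  then show ?thesis ..
qed

lemma mem_act_unit:
  assumes "act p (unit_rotation j) G = G"
  shows "(r, map (rotate_blocks p ((\<lambda>_. 0)(j := b))) xs) \<in> G \<longleftrightarrow> (r, xs) \<in> G"
proof -
  have "(\<lambda>i. b * unit_rotation j i) = (\<lambda>_. 0)(j := b)" by auto
  then have "act p ((\<lambda>_. 0)(j := b)) G = G" using act_mult[OF p assms, of b] by simp
  then show ?thesis by (metis mem_act)
qed

text \<open>By invariance, a fact across the boundary of the block holds iff its rotation to the
  first place of the block does, and those facts are what the contracted structure records. The
  facts inside the block are kept separately.\<close>

lemma inflate_collapse_decompose:
  assumes G: "G \<subseteq> outer ar I" "act p (unit_rotation j) G = G"
  shows "inflate ar I (collapse p j) (G \<inter> block_facts)
    {(r, ys) \<in> outer ar I'. (r, map (expand p j) ys) \<in> G} = G"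
    (is "inflate _ _ _ _ ?G' = _")
proof (rule set_eqI, clarify)
  fix r xs
  show "(r, xs) \<in> inflate ar I (collapse p j) (G \<inter> block_facts) ?G' \<longleftrightarrow> (r, xs) \<in> G"
  proof (cases "(r, xs) \<in> facts ar I")
    case False
    then show ?thesis using G(1) by (auto simp: inflate_def outer_def)
  next
    case facts: True
    show ?thesis
    proof (cases "is_singleton (collapse p j ` set xs)")
      case True
      have "(r, xs) \<in> block_facts" if "(r, xs) \<in> G"
        using collapse_singleton[OF True] G(1) that True
        by (auto simp: block_facts_def outer_def facts_def is_singleton_def)
      then show ?thesis using True facts by (auto simp: inflate_def)
    next
      case False
      obtain b where b: "map (rotate_blocks p ((\<lambda>_. 0)(j := b))) xs = map (expand p j \<circ> collapse p j) xs"
        using rotate_to_expand[OF length_le_2[OF facts] False] by blast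
      have "set (map (collapse p j) xs) \<subseteq> I'" using facts collapse_image by (auto simp: facts_def)
      then have "(r, map (collapse p j) xs) \<in> outer ar I'"
        using False facts by (simp add: outer_def facts_def)
      then have "(r, xs) \<in> inflate ar I (collapse p j) (G \<inter> block_facts) ?G' \<longleftrightarrow>
        (r, map (expand p j \<circ> collapse p j) xs) \<in> G"
        using False facts by (simp add: inflate_def)
      then show ?thesis unfolding b[symmetric] mem_act_unit[OF G(2)] .
    qed
  qed
qed

lemma rotate_block_facts:
  "(r, map (rotate_blocks p s) xs) \<in> block_facts \<longleftrightarrow> (r, xs) \<in> block_facts"
proof -
  have "inj_on (rotate_blocks p s) (set xs)"
    by (rule inj_on_subset[OF inj_rotate_blocks[OF p]]) simp
  then show ?thesis using rotate_blocks_mem_block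
    by (auto simp: block_facts_def outer_def facts_def is_singleton_image_inj image_subset_iff
        simp del: atLeastLessThan_iff)
qed

lemma rotate_facts:
  assumes "i \<le> j"
  shows "(r, map (rotate_blocks p (unit_rotation i)) xs) \<in> facts ar I \<longleftrightarrow> (r, xs) \<in> facts ar I"
  using rotate_blocks_less_iff[of p "Suc j" "unit_rotation i" "p * j + p + l"] p assms
  by (auto simp: facts_def image_subset_iff)

text \<open>Rotating an earlier block commutes with the contraction and fixes block \<open>j\<close>
  pointwise, so it acts on \<open>G\<close> and leaves \<open>C\<close> alone. Thus being moved by
  the rotations of the earlier blocks passes to the contracted structure.\<close>

lemma act_inflate_collapse:
  assumes "i < j" "C \<subseteq> block_facts"
  shows "act p (unit_rotation i) (inflate ar I (collapse p j) C G) =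
    inflate ar I (collapse p j) C (act p (unit_rotation i) G)"
proof (rule set_eqI, clarify)
  fix r xs
  let ?\<sigma> = "rotate_blocks p (unit_rotation i)"
  have *: "collapse p j ` ?\<sigma> ` set xs = ?\<sigma> ` collapse p j ` set xs"
    using collapse_rotate_blocks[OF assms(1)] by (simp add: image_image)
  have sing: "is_singleton (collapse p j ` ?\<sigma> ` set xs) \<longleftrightarrow> is_singleton (collapse p j ` set xs)"
    unfolding * by (rule is_singleton_image_inj) (rule inj_on_subset[OF inj_rotate_blocks[OF p]], simp)
  have C: "(r, map ?\<sigma> xs) \<in> C \<longleftrightarrow> (r, xs) \<in> C"
  proof (cases "(r, xs) \<in> block_facts")
    case True
    then have xs: "set xs \<subseteq> block p j" by (auto simp: block_facts_def outer_def facts_def)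
    have "?\<sigma> x = x" if "x \<in> set xs" for x
    proof (rule rotate_blocks_id)
      have "x div p = j" using xs that mem_block[OF p] by blast
      then show "unit_rotation i (x div p) mod p = 0" using assms(1) by simp
    qed
    then have "map ?\<sigma> xs = xs" by (simp add: map_idI)
    then show ?thesis by simp
  next
    case False
    then show ?thesis using rotate_block_facts assms(2) by blast
  qed
  have "map (collapse p j) (map ?\<sigma> xs) = map ?\<sigma> (map (collapse p j) xs)"
    using collapse_rotate_blocks[OF assms(1)] by simp
  then show "(r, xs) \<in> act p (unit_rotation i) (inflate ar I (collapse p j) C G) \<longleftrightarrow>
    (r, xs) \<in> inflate ar I (collapse p j) C (act p (unit_rotation i) G)"
    using sing C rotate_facts[of i r xs] assms(1) by (simp add: inflate_def del: map_map)
qed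

lemma act_inflate_collapse_eq:
  assumes "i < j" "C \<subseteq> block_facts" "G \<subseteq> outer ar I'"
  shows "act p (unit_rotation i) (inflate ar I (collapse p j) C G) = inflate ar I (collapse p j) C G
    \<longleftrightarrow> act p (unit_rotation i) G = G"
proof
  assume "act p (unit_rotation i) (inflate ar I (collapse p j) C G) = inflate ar I (collapse p j) C G"
  then have eq: "inflate ar I (collapse p j) C (act p (unit_rotation i) G) = inflate ar I (collapse p j) C G"
    using act_inflate_collapse[OF assms(1,2)] by simp
  have "act p (unit_rotation i) G \<subseteq> outer ar I'"
    by (rule act_outer[of p j]) (use p assms in auto)
  from inflate_collapse_outside[OF this, of C] inflate_collapse_outside[OF assms(3), of C]
  show "act p (unit_rotation i) G = G" unfolding eq by simp
qed (simp only: act_inflate_collapse[OF assms(1,2)])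

lemma act_inflate_collapse_block:
  assumes "C \<in> invariant_blocks"
  shows "act p (unit_rotation j) (inflate ar I (collapse p j) C G) = inflate ar I (collapse p j) C G"
proof (rule set_eqI, clarify)
  fix r xs
  have C: "(r, map (rotate_blocks p (unit_rotation j)) xs) \<in> C \<longleftrightarrow> (r, xs) \<in> C"
  proof -
    have "act p (unit_rotation j) C = C" using assms by (simp add: invariant_blocks_def)
    then show ?thesis using mem_act[of r xs p "unit_rotation j" C] by simp
  qed
  have m: "map (collapse p j) (map (rotate_blocks p (unit_rotation j)) xs) = map (collapse p j) xs"
    using collapse_rotate_block by simp
  have i: "collapse p j ` rotate_blocks p (unit_rotation j) ` set xs = collapse p j ` set xs"
    using collapse_rotate_block by (simp add: image_image)
  show "(r, xs) \<in> act p (unit_rotation j) (inflate ar I (collapse p j) C G) \<longleftrightarrow>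
    (r, xs) \<in> inflate ar I (collapse p j) C G"
    unfolding mem_act using C rotate_facts[of j r xs]
    unfolding inflate_def by (simp only: mem_Collect_eq case_prod_conv m i set_map order_refl)
qed

text \<open>The two components are the facts inside the block and the contracted structure. The set
  of possible \<open>C\<close> does not depend on \<open>l\<close>, which later gives a recursion
  with the same terms for every rest of the word.\<close>

lemma inflate_collapse_bij:
  "bij_betw (\<lambda>(C, G). inflate ar I (collapse p j) C G) (invariant_blocks \<times> Pow (outer ar I'))
    {G \<in> Pow (outer ar I). act p (unit_rotation j) G = G}"
proof (rule bij_betw_byWitness[where f' =
      "\<lambda>G. (G \<inter> block_facts, {(r, ys) \<in> outer ar I'. (r, map (expand p j) ys) \<in> G})"])
  show "\<forall>a\<in>invariant_blocks \<times> Pow (outer ar I').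
    (\<lambda>G. (G \<inter> block_facts, {(r, ys) \<in> outer ar I'. (r, map (expand p j) ys) \<in> G}))
      ((\<lambda>(C, G). inflate ar I (collapse p j) C G) a) = a"
  proof
    fix a assume a: "a \<in> invariant_blocks \<times> Pow (outer ar I')"
    obtain C G where "a = (C, G)" by (cases a)
    moreover then have "C \<subseteq> block_facts" "G \<subseteq> outer ar I'" using a by (auto simp: invariant_blocks_def)
    ultimately show "(\<lambda>G. (G \<inter> block_facts, {(r, ys) \<in> outer ar I'. (r, map (expand p j) ys) \<in> G}))
      ((\<lambda>(C, G). inflate ar I (collapse p j) C G) a) = a"
      by (simp only: case_prod_conv inflate_collapse_block inflate_collapse_outside)
  qed
  show "\<forall>G\<in>{G \<in> Pow (outer ar I). act p (unit_rotation j) G = G}.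
    (\<lambda>(C, G). inflate ar I (collapse p j) C G)
      (G \<inter> block_facts, {(r, ys) \<in> outer ar I'. (r, map (expand p j) ys) \<in> G}) = G"
    using inflate_collapse_decompose by (simp only: case_prod_conv) blast
  show "(\<lambda>(C, G). inflate ar I (collapse p j) C G) ` (invariant_blocks \<times> Pow (outer ar I'))
    \<subseteq> {G \<in> Pow (outer ar I). act p (unit_rotation j) G = G}"
  proof
    fix H assume "H \<in> (\<lambda>(C, G). inflate ar I (collapse p j) C G) ` (invariant_blocks \<times> Pow (outer ar I'))"
    then obtain C G where C: "C \<in> invariant_blocks" and H: "H = inflate ar I (collapse p j) C G" by auto
    then have "C \<subseteq> block_facts" by (simp add: invariant_blocks_def)
    from inflate_collapse_outer[OF this] act_inflate_collapse_block[OF C]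
    show "H \<in> {G \<in> Pow (outer ar I). act p (unit_rotation j) G = G}" using H by simp
  qed
  have "G \<inter> block_facts \<in> invariant_blocks" if "act p (unit_rotation j) G = G" for G
  proof -
    have "act p (unit_rotation j) (G \<inter> block_facts) = act p (unit_rotation j) G \<inter> block_facts"
      by (auto simp: act_def rotate_block_facts)
    then show ?thesis using that by (simp add: invariant_blocks_def)
  qed
  then show "(\<lambda>G. (G \<inter> block_facts, {(r, ys) \<in> outer ar I'. (r, map (expand p j) ys) \<in> G})) `
    {G \<in> Pow (outer ar I). act p (unit_rotation j) G = G} \<subseteq> invariant_blocks \<times> Pow (outer ar I')"
    by blast
qed

end

section \<open>Orbits of irregular index structures\<close>

lemma act_cancel:
  assumes "p > 0"
  shows "act p (\<lambda>i. (p - 1) * s i) (act p s G) = G"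
proof -
  have "rotate_blocks p s (rotate_blocks p (\<lambda>i. (p - 1) * s i) x) = x" for x
    using rotate_blocks_inverse[OF assms, of s x] by (simp add: rotate_blocks_comp[OF assms] add.commute)
  then show ?thesis by (simp add: act_def comp_def)
qed

lemma act_commute: "p > 0 \<Longrightarrow> act p s (act p u G) = act p u (act p s G)"
  by (simp add: act_act add.commute)

lemma act_cong:
  assumes "\<And>i. s i mod p = s' i mod p"
  shows "act p s G = act p s' G"
proof -
  have "rotate_blocks p s = rotate_blocks p s'" by (rule ext, rule rotate_blocks_cong, rule assms)
  then show ?thesis by (simp add: act_def)
qed

lemma act_fixed_iff:
  assumes "p > 0"
  shows "act p u (act p s G) = act p s G \<longleftrightarrow> act p u G = G"
  by (metis act_cancel act_commute assms)

text \<open>Amounts of rotation are not reduced modulo \<open>p\<close>, so a trivial rotation is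
  one by a multiple of \<open>p\<close>; hence the divisibility conditions in
  \<open>dominates\<close> and \<open>frozen\<close>.\<close>

definition stabilizer :: "nat \<Rightarrow> nat \<Rightarrow> nat facts \<Rightarrow> (nat \<Rightarrow> nat) set" where
  "stabilizer p J G = {s. (\<forall>i\<ge>J. s i = 0) \<and> act p s G = G}"

lemma stabilizer_act: "p > 0 \<Longrightarrow> stabilizer p J (act p s G) = stabilizer p J G"
  by (simp add: stabilizer_def act_fixed_iff)

definition dominates :: "nat \<Rightarrow> (nat \<Rightarrow> nat) set \<Rightarrow> nat \<Rightarrow> nat \<Rightarrow> bool" where
  "dominates p St i' i \<longleftrightarrow> (\<forall>s\<in>St. p dvd s i' \<longrightarrow> p dvd s i)"

definition frozen :: "nat \<Rightarrow> (nat \<Rightarrow> nat) set \<Rightarrow> nat \<Rightarrow> bool" where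
  "frozen p St i \<longleftrightarrow> (\<forall>s\<in>St. p dvd s i)"

text \<open>
  Since relations are at most binary, a fact witnessing that the rotation of block \<open>i\<close> moves \<open>G\<close>
  involves at most one further block.
\<close>

lemma frozen_or_dominated:
  assumes p: "prime p" and binary: "\<forall>k\<in>set ar. k \<le> 2" and n: "p * J \<le> n"
    and G: "G \<subseteq> outer ar {..<n}" "act p (unit_rotation i) G \<noteq> G" and "i < J"
  shows "frozen p (stabilizer p J G) i \<or>
    (\<exists>i'<J. i' \<noteq> i \<and> dominates p (stabilizer p J G) i' i)"
proof -
  have p0: "p > 0" using p by (simp add: prime_gt_0_nat)
  let ?\<sigma> = "rotate_blocks p (unit_rotation i)"
  obtain r xs where rxs: "(r, map ?\<sigma> xs) \<in> G \<longleftrightarrow> (r, xs) \<notin> G"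
    using G(2) by (auto simp: act_def)
  have "(r, map ?\<sigma> xs) \<in> outer ar {..<n} \<longleftrightarrow> (r, xs) \<in> outer ar {..<n}"
    by (rule rotate_blocks_outer[OF p0 _ n]) (use \<open>i < J\<close> in auto)
  then have "(r, xs) \<in> outer ar {..<n}" using rxs G(1) by blast
  then have "length xs \<le> 2" using binary by (auto simp: outer_def facts_def)
  have contra: False if s: "s \<in> stabilizer p J G" "\<not> p dvd s i"
    "\<And>x. x \<in> set xs \<Longrightarrow> x div p \<noteq> i \<Longrightarrow> p dvd s (x div p)" for s
  proof -
    \<comment> \<open>As \<open>p\<close> is prime, some multiple of \<open>s\<close> rotates block
      \<open>i\<close> by exactly one step. It is trivial on the other points of \<open>xs\<close>,
      so it moves \<open>xs\<close> just as the unit rotation does, although it stabilizes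
      \<open>G\<close>.\<close>
    have "coprime (s i) p" using s(2) p by (metis coprime_commute prime_imp_coprime)
    then obtain b where b: "[s i * b = 1] (mod p)" using cong_solve_coprime_nat by auto
    have "act p (\<lambda>i. b * s i) G = G" using s(1) by (intro act_mult[OF p0]) (simp add: stabilizer_def)
    moreover have "map (rotate_blocks p (\<lambda>i. b * s i)) xs = map ?\<sigma> xs"
    proof (rule map_cong[OF refl], rule rotate_blocks_cong)
      fix x assume x: "x \<in> set xs"
      show "b * s (x div p) mod p = unit_rotation i (x div p) mod p"
      proof (cases "x div p = i")
        case True
        then show ?thesis using b by (simp add: cong_def mult.commute)
      next
        case False
        then show ?thesis using s(3)[OF x] by simp
      qed
    qed
    ultimately show False using rxs mem_act[of r xs p "\<lambda>i. b * s i" G] by metis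
  qed
  have "\<exists>x\<in>set xs. x div p = i"
  proof (rule ccontr)
    assume "\<not> ?thesis"
    then have "map ?\<sigma> xs = xs" by (intro map_idI rotate_blocks_id) auto
    then show False using rxs by simp
  qed
  then obtain i' where i': "\<And>x. x \<in> set xs \<Longrightarrow> x div p \<noteq> i \<Longrightarrow> x div p = i'"
    using \<open>length xs \<le> 2\<close> by (cases xs; cases "tl xs"; cases "tl (tl xs)") auto
  show ?thesis
  proof (cases "i' < J \<and> i' \<noteq> i")
    case True
    have "dominates p (stabilizer p J G) i' i"
      unfolding dominates_def using contra i' by blast
    then show ?thesis using True by blast
  next
    case False
    \<comment> \<open>No block of \<open>xs\<close> other than \<open>i\<close> is among the first
      \<open>J\<close>, and beyond them the members of the stabilizer vanish.\<close>
    have "p dvd s (x div p)" if "s \<in> stabilizer p J G" "x \<in> set xs" "x div p \<noteq> i" for s x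
      using i'[OF that(2,3)] False that by (auto simp: stabilizer_def)
    then have "frozen p (stabilizer p J G) i"
      unfolding frozen_def using contra by blast
    then show ?thesis ..
  qed
qed

text \<open>
  Of the partners of the \<open>J\<close> blocks, at least half lie in the same direction, and following them
  in that direction terminates.
\<close>

definition dominated_below :: "nat \<Rightarrow> nat \<Rightarrow> (nat \<Rightarrow> nat) set \<Rightarrow> nat set" where
  "dominated_below p J St = {i. i < J \<and> (frozen p St i \<or> (\<exists>i'<i. dominates p St i' i))}"

definition dominated_above :: "nat \<Rightarrow> nat \<Rightarrow> (nat \<Rightarrow> nat) set \<Rightarrow> nat set" where
  "dominated_above p J St = {i. i < J \<and> (frozen p St i \<or> (\<exists>i'<J. i < i' \<and> dominates p St i' i))}"

definition free_blocks :: "nat \<Rightarrow> nat \<Rightarrow> (nat \<Rightarrow> nat) set \<Rightarrow> nat set" where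
  "free_blocks p J St = (if J \<le> 2 * card (dominated_below p J St) then dominated_below p J St
    else dominated_above p J St)"

lemma free_blocks_less: "free_blocks p J St \<subseteq> {..<J}"
  by (auto simp: free_blocks_def dominated_below_def dominated_above_def)

text \<open>Induction along the chosen direction: when block \<open>i\<close> is reached, its
  partner is known to be trivial, either by the induction or because \<open>s\<close> vanishes
  there. Mixing both directions would admit two blocks that are partners of each other, and the
  induction would be circular.\<close>

lemma free_blocks_dvd:
  assumes s: "s \<in> St" "\<And>i. i \<notin> free_blocks p J St \<Longrightarrow> s i = 0"
  shows "p dvd s i"
proof (cases "J \<le> 2 * card (dominated_below p J St)")
  case True
  then have A: "free_blocks p J St = dominated_below p J St" by (simp add: free_blocks_def)
  show ?thesis
  proof (induction i rule: less_induct)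
    case (less i)
    show ?case
    proof (cases "i \<in> dominated_below p J St")
      case True
      then show ?thesis using less s(1) by (auto simp: dominated_below_def frozen_def dominates_def)
    next
      case False
      then show ?thesis using s(2) A by simp
    qed
  qed
next
  case False
  then have A: "free_blocks p J St = dominated_above p J St" by (simp add: free_blocks_def)
  show ?thesis
  proof (induction "J - i" arbitrary: i rule: less_induct)
    case less
    show ?case
    proof (cases "i \<in> dominated_above p J St")
      case True
      then have "i < J" "frozen p St i \<or> (\<exists>i'<J. i < i' \<and> dominates p St i' i)"
        by (auto simp: dominated_above_def)
      then show ?thesis
        using less s(1) by (auto simp: frozen_def dominates_def intro: diff_less_mono2)
    next
      case False
      then show ?thesis using s(2) A by simp
    qed
  qed
qed

lemma card_free_blocks:
  assumes "\<And>i. i < 2 * k \<Longrightarrow> frozen p St i \<or> (\<exists>i'<2 * k. i' \<noteq> i \<and> dominates p St i' i)"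
  shows "k \<le> card (free_blocks p (2 * k) St)"
proof -
  let ?A = "dominated_below p (2 * k) St" and ?B = "dominated_above p (2 * k) St"
  have "i \<in> ?A \<union> ?B" if "i < 2 * k" for i
    using assms[OF that] that unfolding dominated_below_def dominated_above_def
    by (auto simp: nat_neq_iff)
  then have "?A \<union> ?B = {..<2 * k}" by (auto simp: dominated_below_def dominated_above_def)
  then have "2 * k = card (?A \<union> ?B)" by simp
  also have "\<dots> \<le> card ?A + card ?B" by (rule card_Un_le)
  finally show ?thesis by (simp add: free_blocks_def)
qed

text \<open>Only the free blocks \<open>A G\<close> are rotated. Their rotations meet the stabilizer
  trivially, so a class has exactly \<open>p ^ card (A G)\<close> members. Since rotations commute,
  the stabilizer and with it \<open>A G\<close> is constant along a class; this is what makes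
  \<open>R\<close> symmetric and transitive.\<close>

lemma card_irregular_dvd:
  assumes p: "prime p" and binary: "\<forall>k\<in>set ar. k \<le> 2" and n: "p * (2 * k) \<le> n"
    and X: "finite X" "\<And>G. G \<in> X \<Longrightarrow> G \<subseteq> outer ar {..<n}"
    and closed: "\<And>G s. G \<in> X \<Longrightarrow> \<forall>i\<ge>2 * k. s i = 0 \<Longrightarrow> act p s G \<in> X"
    and moved: "\<And>G i. G \<in> X \<Longrightarrow> i < 2 * k \<Longrightarrow> act p (unit_rotation i) G \<noteq> G"
  shows "p ^ k dvd card X"
proof -
  have p0: "p > 0" using p by (simp add: prime_gt_0_nat)
  define A where "A G = free_blocks p (2 * k) (stabilizer p (2 * k) G)" for G
  have A_act: "A (act p s G) = A G" for s G by (simp add: A_def stabilizer_act[OF p0])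
  have A_less: "i \<ge> 2 * k \<Longrightarrow> i \<notin> A G" for i G using free_blocks_less[of p "2 * k" "stabilizer p (2 * k) G"] by (auto simp: A_def)
  have A_card: "k \<le> card (A G)" if "G \<in> X" for G
    unfolding A_def
    by (rule card_free_blocks, rule frozen_or_dominated[OF p binary n X(2)[OF that] moved[OF that]])
  have A_free: "p dvd s i" if "\<And>i. i \<notin> A G \<Longrightarrow> s i = 0" "act p s G = G" for s i G
    by (rule free_blocks_dvd[of s "stabilizer p (2 * k) G" p "2 * k"])
      (use that A_less in \<open>auto simp: stabilizer_def A_def\<close>)
  define R where "R = {(G, H). G \<in> X \<and> H \<in> X \<and> (\<exists>s. (\<forall>i. i \<notin> A G \<longrightarrow> s i = 0) \<and> H = act p s G)}"
  have RI: "(G, H) \<in> R" if "H = act p s G" "G \<in> X" "H \<in> X" "\<And>i. i \<notin> A G \<Longrightarrow> s i = 0" for G H s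
    using that unfolding R_def by (auto intro!: exI[of _ s])
  have "equiv X R"
  proof (rule equivI)
    show "R \<subseteq> X \<times> X" by (auto simp: R_def)
    show "refl_on X R" by (intro refl_onI) (auto simp: R_def act_zero intro!: exI[of _ "\<lambda>_. 0"])
    show "sym R"
    proof (rule symI)
      fix G H assume "(G, H) \<in> R"
      then obtain s where s: "G \<in> X" "H \<in> X" "\<And>i. i \<notin> A G \<Longrightarrow> s i = 0" "H = act p s G"
        by (auto simp: R_def)
      have "G = act p (\<lambda>i. (p - 1) * s i) H" unfolding s(4) act_cancel[OF p0] ..
      moreover have "(p - 1) * s i = 0" if "i \<notin> A H" for i
        using that s(3)[of i] unfolding s(4) A_act by simp
      ultimately show "(H, G) \<in> R" using s(1,2) by (intro RI)
    qed
    show "trans R"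
    proof (rule transI)
      fix G H K assume "(G, H) \<in> R" "(H, K) \<in> R"
      then obtain s u where s: "G \<in> X" "K \<in> X" "\<And>i. i \<notin> A G \<Longrightarrow> s i = 0" "H = act p s G"
        "\<And>i. i \<notin> A H \<Longrightarrow> u i = 0" "K = act p u H"
        by (auto simp: R_def)
      have "K = act p (\<lambda>i. u i + s i) G" unfolding s(4,6) act_act[OF p0] ..
      moreover have "u i + s i = 0" if "i \<notin> A G" for i
        using that s(3)[of i] s(5)[of i] unfolding s(4) A_act by simp
      ultimately show "(G, K) \<in> R" using s(1,2) by (intro RI)
    qed
  qed
  then show ?thesis
  proof (rule equiv_imp_dvd_card[OF X(1)])
    fix E assume "E \<in> X // R"
    then obtain G where G: "G \<in> X" "E = R `` {G}" by (auto elim: quotientE)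
    define e where "e s = act p (\<lambda>i. if i \<in> A G then s i else 0) G" for s
    have "E = e ` (A G \<rightarrow>\<^sub>E {..<p})"
    proof
      show "E \<subseteq> e ` (A G \<rightarrow>\<^sub>E {..<p})"
      proof
        fix H assume "H \<in> E"
        then obtain s where s: "\<And>i. i \<notin> A G \<Longrightarrow> s i = 0" "H = act p s G" using G by (auto simp: R_def)
        have "H = e (\<lambda>i\<in>A G. s i mod p)"
          unfolding e_def s(2) by (rule act_cong) (use s(1) in auto)
        then show "H \<in> e ` (A G \<rightarrow>\<^sub>E {..<p})" using p0 by auto
      qed
      show "e ` (A G \<rightarrow>\<^sub>E {..<p}) \<subseteq> E"
      proof
        fix H assume "H \<in> e ` (A G \<rightarrow>\<^sub>E {..<p})"
        then obtain s where H: "H = act p (\<lambda>i. if i \<in> A G then s i else 0) G" by (auto simp: e_def)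
        then have "H \<in> X" using closed[OF G(1)] A_less by simp
        then have "(G, H) \<in> R" using G(1) by (intro RI[OF H]) simp_all
        then show "H \<in> E" using G(2) by simp
      qed
    qed
    moreover have "inj_on e (A G \<rightarrow>\<^sub>E {..<p})"
    proof (rule inj_onI)
      fix s u assume su: "s \<in> A G \<rightarrow>\<^sub>E {..<p}" "u \<in> A G \<rightarrow>\<^sub>E {..<p}" "e s = e u"
      let ?s = "\<lambda>i. if i \<in> A G then s i else 0" and ?u = "\<lambda>i. if i \<in> A G then u i else 0"
      \<comment> \<open>The difference of two vectors with the same image lies in the stabilizer and
        is supported on the free blocks, so it is trivial modulo \<open>p\<close>.\<close>
      have "act p (\<lambda>i. (p - 1) * ?u i) (act p ?s G) = G"
        using su(3) act_cancel[OF p0, of ?u G] by (simp add: e_def)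
      then have *: "act p (\<lambda>i. (p - 1) * ?u i + ?s i) G = G" by (simp only: act_act[OF p0])
      show "s = u"
      proof (rule PiE_ext[OF su(1,2)])
        fix i assume i: "i \<in> A G"
        have "p dvd (p - 1) * ?u i + ?s i" by (rule A_free[OF _ *]) simp
        then have "p dvd (p - 1) * u i + s i" using i by simp
        then have "((p - 1) * u i + s i + u i) mod p = u i mod p" by (metis dvd_imp_mod_0 mod_add_left_eq add_0)
        moreover have "(p - 1) * u i + s i + u i = p * u i + s i" using p0 by (cases p) auto
        ultimately have "(p * u i + s i) mod p = u i mod p" by (simp only:)
        then have "s i mod p = u i mod p" by simp
        moreover have "s i < p" "u i < p" using su(1,2) i by auto
        ultimately show "s i = u i" by simp
      qed
    qed
    moreover have "finite (A G)" using A_less by (metis finite_nat_set_iff_bounded not_le)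
    ultimately have "card E = p ^ card (A G)" by (simp add: card_image card_PiE)
    then show "p ^ k dvd card E" using A_card[OF G(1)] by (simp add: le_imp_power_dvd)
  qed
qed

section \<open>Accepted and irregular index structures over a word of types\<close>

context tv_specker
begin

definition count :: "nat list \<Rightarrow> nat" where
  "count ws = card {G \<in> Pow (outer ar {..<length ws}). accepts {..<length ws} ((!) ws) G}"

text \<open>Interpolates between all accepted structures, the case \<open>j = 0\<close>, and those
  to which the orbit argument applies; every block adds one condition.\<close>

definition irregular :: "nat \<Rightarrow> nat \<Rightarrow> nat \<Rightarrow> nat list \<Rightarrow> nat facts set" where
  "irregular p t j w = {G \<in> Pow (outer ar {..<p * j + length w}).
    accepts {..<p * j + length w} ((!) (replicate (p * j) t @ w)) G \<and>
    (\<forall>i<j. act p (unit_rotation i) G \<noteq> G)}"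

lemma finite_irregular: "finite (irregular p t j w)"
  unfolding irregular_def by (simp add: finite_outer)

text \<open>All points of the rotated blocks have type \<open>t\<close>, so rotations preserve types
  and hence acceptance; and since they commute, they preserve irregularity.\<close>

lemma irregular_dvd:
  assumes p: "prime p" and w: "t \<in> types" "set w \<subseteq> types"
  shows "p ^ k dvd card (irregular p t (2 * k) w)"
proof (rule card_irregular_dvd[OF p binary _ finite_irregular])
  have p0: "p > 0" using p by (simp add: prime_gt_0_nat)
  let ?n = "p * (2 * k) + length w"
  show "p * (2 * k) \<le> ?n" by simp
  show "G \<in> irregular p t (2 * k) w \<Longrightarrow> G \<subseteq> outer ar {..<?n}" for G by (simp add: irregular_def)
  show "G \<in> irregular p t (2 * k) w \<Longrightarrow> i < 2 * k \<Longrightarrow> act p (unit_rotation i) G \<noteq> G" for G i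
    by (simp add: irregular_def)
  fix G and s :: "nat \<Rightarrow> nat" assume G: "G \<in> irregular p t (2 * k) w" and s: "\<forall>i\<ge>2 * k. s i = 0"
  let ?ws = "replicate (p * (2 * k)) t @ w" and ?\<sigma> = "rotate_blocks p s"
  have "act p s G \<subseteq> outer ar {..<?n}"
    by (rule act_outer[OF p0 s]) (use G in \<open>auto simp: irregular_def\<close>)
  moreover have "accepts {..<?n} ((!) ?ws) (act p s G)"
  proof (cases "?n = 0")
    \<comment> \<open>The empty index set is treated apart, as \<open>accepts_bij\<close> speaks of
      non-empty ones.\<close>
    case True
    then have "{..<?n} = {}" by (simp only: lessThan_0)
    then have "accepts {..<?n} ((!) ?ws) (act p s G) = accepts {..<?n} ((!) ?ws) G"
      by (simp add: accepts_def glue_univ_def inflate_def facts_def act_def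
        cong: conj_cong)
    then show ?thesis using G by (simp add: irregular_def)
  next
    case False
    have "accepts {..<?n} ((!) ?ws) {(r, xs). (r, map ?\<sigma> xs) \<in> G} \<longleftrightarrow> accepts {..<?n} ((!) ?ws) G"
    proof (rule accepts_bij)
      have lt: "?\<sigma> x < ?n \<longleftrightarrow> x < ?n" for x by (rule rotate_blocks_less_iff[OF p0 s]) simp
      have "inj_on ?\<sigma> {..<?n}" by (rule inj_on_subset[OF inj_rotate_blocks[OF p0]]) simp
      moreover have "?\<sigma> ` {..<?n} = {..<?n}"
        by (rule endo_inj_surj) (use calculation lt in auto)
      ultimately show "bij_betw ?\<sigma> {..<?n} {..<?n}" by (simp add: bij_betw_def)
      show "?ws ! x = ?ws ! ?\<sigma> x" if "x \<in> {..<?n}" for x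
      proof (cases "x < p * (2 * k)")
        case True
        then have "?\<sigma> x < p * (2 * k)" using rotate_blocks_less_iff[OF p0 s order_refl] by simp
        then show ?thesis using True by (simp add: nth_append)
      next
        case False
        then have "x div p \<ge> 2 * k" using p0 by (simp add: less_eq_div_iff_mult_less_eq mult.commute)
        then have "?\<sigma> x = x" using s by (intro rotate_blocks_id) simp
        then show ?thesis by simp
      qed
      show "(!) ?ws ` {..<?n} \<subseteq> types"
      proof
        fix y assume "y \<in> (!) ?ws ` {..<?n}"
        then obtain i where "i < length ?ws" "y = ?ws ! i" by auto
        then have "y \<in> set ?ws" by (metis nth_mem)
        then show "y \<in> types" using w by auto
      qed
      show "{..<?n} \<noteq> {}" using False by (simp only: lessThan_empty_iff) simp
    qed simp
    then show ?thesis using G by (simp add: irregular_def act_def)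
  qed
  moreover have "act p (unit_rotation i) (act p s G) \<noteq> act p s G" if "i < 2 * k" for i
    using G that unfolding act_fixed_iff[OF p0] by (simp add: irregular_def)
  ultimately show "act p s G \<in> irregular p t (2 * k) w" by (simp add: irregular_def)
qed

text \<open>The rotation of block \<open>j\<close> either moves the structure, which is then
  irregular for one more block, or fixes it. In the latter case the block is contracted to a letter
  of merged type, with \<open>C\<close> ranging over its possible inner structures.\<close>

lemma irregular_Suc:
  assumes p: "p > 0" and w: "t \<in> types" "set w \<subseteq> types"
  shows "card (irregular p t j (replicate p t @ w)) = card (irregular p t (Suc j) w) +
    (\<Sum>C\<in>invariant_blocks p j ar. card (irregular p t j (merged_type (block p j) t C # w)))"
proof -
  define l where "l = length w"
  let ?I = "{..<p * j + p + l}" and ?I' = "{..<p * j + 1 + l}"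
  let ?A = "irregular p t j (replicate p t @ w)" and ?e = "unit_rotation j"
  let ?B = "\<lambda>C. irregular p t j (merged_type (block p j) t C # w)"
  let ?f = "\<lambda>(C, G). inflate ar ?I (collapse p j) C G"
  let ?ws = "replicate (p * j) t @ replicate p t @ w"
  let ?ws' = "\<lambda>C. replicate (p * j) t @ merged_type (block p j) t C # w"
  have len: "p * j + length (replicate p t @ w) = p * j + p + l"
    "p * Suc j + length w = p * j + p + l" "p * j + length (m # w) = p * j + 1 + l" for m
    by (simp_all add: l_def)
  have ws: "replicate (p * Suc j) t @ w = ?ws" by (simp add: replicate_add[symmetric] add.commute)
  have "irregular p t (Suc j) w = {G \<in> ?A. act p ?e G \<noteq> G}"
    unfolding irregular_def len ws by (auto simp: less_Suc_eq)
  moreover have "?A = {G \<in> ?A. act p ?e G \<noteq> G} \<union> {G \<in> ?A. act p ?e G = G}" by blast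
  moreover have "card ({G \<in> ?A. act p ?e G \<noteq> G} \<union> {G \<in> ?A. act p ?e G = G}) =
      card {G \<in> ?A. act p ?e G \<noteq> G} + card {G \<in> ?A. act p ?e G = G}"
    using finite_irregular[of p t j "replicate p t @ w"] by (intro card_Un_disjoint) auto
  moreover have "card {G \<in> ?A. act p ?e G = G} = (\<Sum>C\<in>invariant_blocks p j ar. card (?B C))"
  proof -
    note bij = inflate_collapse_bij[OF p binary, of j l]
    have acc: "accepts ?I ((!) ?ws) (inflate ar ?I (collapse p j) C G) \<longleftrightarrow> accepts ?I' ((!) (?ws' C)) G" for C G
    proof (rule accepts_merge)
      show "(!) ?ws ` ?I \<subseteq> types"
      proof
        fix y assume "y \<in> (!) ?ws ` ?I"
        then obtain i where "i < length ?ws" "y = ?ws ! i"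
          by (auto simp: l_def add.assoc)
        then have "y \<in> set ?ws" by (metis nth_mem)
        then show "y \<in> types" using w by auto
      qed
      show "collapse p j ` ?I = ?I'" by (rule collapse_image[OF p binary])
      show "fibre (collapse p j) ?I (p * j) = block p j"
        using p by (auto simp: collapse_def split: if_splits)
      show "inj_on (collapse p j) (?I - block p j)"
        by (rule inj_onI) (use collapse_eq[OF p binary] in blast)
      show "?ws' C ! collapse p j i = ?ws ! i" if "i \<in> ?I - block p j" for i
        using that by (auto simp: collapse_def nth_append nth_Cons' add.commute[of p "p * j"])
    qed (use p in \<open>auto simp: nth_append\<close>)
    have "{G \<in> ?A. act p ?e G = G} = ?f ` (SIGMA C:invariant_blocks p j ar. ?B C)"
    proof
      show "?f ` (SIGMA C:invariant_blocks p j ar. ?B C) \<subseteq> {G \<in> ?A. act p ?e G = G}"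
      proof
        fix H assume "H \<in> ?f ` (SIGMA C:invariant_blocks p j ar. ?B C)"
        then obtain C G where C: "C \<in> invariant_blocks p j ar" "G \<in> ?B C"
          "H = inflate ar ?I (collapse p j) C G" by auto
        then have CG: "C \<subseteq> block_facts p j ar" "G \<subseteq> outer ar ?I'"
          by (auto simp: invariant_blocks_def[OF p binary] irregular_def l_def)
        have "H \<in> ?f ` (invariant_blocks p j ar \<times> Pow (outer ar ?I'))" using C CG by force
        then have "H \<in> {G \<in> Pow (outer ar ?I). act p ?e G = G}" using bij by (simp add: bij_betw_def)
        then show "H \<in> {G \<in> ?A. act p ?e G = G}"
          using C(2) acc[of C G] act_inflate_collapse_eq[OF p binary _ CG]
          unfolding irregular_def len C(3) by simp
      qed
      show "{G \<in> ?A. act p ?e G = G} \<subseteq> ?f ` (SIGMA C:invariant_blocks p j ar. ?B C)"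
      proof
        fix H assume H: "H \<in> {G \<in> ?A. act p ?e G = G}"
        then have "H \<in> {G \<in> Pow (outer ar ?I). act p ?e G = G}" unfolding irregular_def len by simp
        then have "H \<in> ?f ` (invariant_blocks p j ar \<times> Pow (outer ar ?I'))"
          using bij by (simp add: bij_betw_def)
        then obtain C G where C: "C \<in> invariant_blocks p j ar" "G \<subseteq> outer ar ?I'"
          "H = inflate ar ?I (collapse p j) C G" by auto
        then have CG: "C \<subseteq> block_facts p j ar" by (auto simp: invariant_blocks_def[OF p binary])
        have "G \<in> ?B C" using H C(2) acc[of C G] act_inflate_collapse_eq[OF p binary _ CG C(2)]
          unfolding irregular_def len C(3) by simp
        then show "H \<in> ?f ` (SIGMA C:invariant_blocks p j ar. ?B C)" using C by force
      qed
    qed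
    moreover have "inj_on ?f (SIGMA C:invariant_blocks p j ar. ?B C)"
    proof (rule inj_on_subset)
      show "inj_on ?f (invariant_blocks p j ar \<times> Pow (outer ar ?I'))" using bij by (simp add: bij_betw_def)
      show "(SIGMA C:invariant_blocks p j ar. ?B C) \<subseteq> invariant_blocks p j ar \<times> Pow (outer ar ?I')"
        unfolding irregular_def len by auto
    qed
    ultimately show ?thesis
      using finite_invariant_blocks[OF p binary] finite_irregular by (simp add: card_image)
  qed
  ultimately show ?thesis by simp
qed

end

section \<open>Functions spanned by finitely many shifts\<close>

definition words :: "'a set \<Rightarrow> nat \<Rightarrow> 'a list set" where
  "words D n = {ds. set ds \<subseteq> D \<and> length ds = n}"

lemma finite_words: "finite D \<Longrightarrow> finite (words D n)"
  unfolding words_def by (rule finite_lists_length_eq)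

lemma words_0 [simp]: "words D 0 = {[]}"
  by (auto simp: words_def)

lemma sum_words_Suc:
  assumes "finite D"
  shows "(\<Sum>ds\<in>words D (Suc n). g ds) = (\<Sum>d\<in>D. \<Sum>ds\<in>words D n. g (d # ds))"
proof -
  have "words D (Suc n) = (\<lambda>(d, ds). d # ds) ` (D \<times> words D n)"
    by (force simp: words_def length_Suc_conv image_iff)
  moreover have "inj_on (\<lambda>(d, ds). d # ds) (D \<times> words D n)" by (auto simp: inj_on_def)
  ultimately have "(\<Sum>ds\<in>words D (Suc n). g ds) = (\<Sum>(d, ds)\<in>D \<times> words D n. g (d # ds))"
    by (simp add: sum.reindex case_prod_unfold)
  then show ?thesis by (simp add: sum.cartesian_product)
qed

text \<open>Modulo \<open>m\<close>, the power \<open>e\<close> of a letter can be traded for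
  shorter words, uniformly in the rest \<open>w\<close>. In the application \<open>\<Phi>\<close> is
  \<open>count\<close>, and \<open>e\<close> is the number of points in \<open>2 * k\<close>
  blocks.\<close>

locale reducible =
  fixes \<Phi> :: "'a list \<Rightarrow> int" and T :: "'a set" and e :: nat and m :: int
  assumes T: "finite T" and m: "m > 0"
    and perm: "\<And>u v. mset u = mset v \<Longrightarrow> set u \<subseteq> T \<Longrightarrow> \<Phi> u = \<Phi> v"
    and reduce: "\<And>t. t \<in> T \<Longrightarrow> \<exists>cs. (\<forall>(c, v)\<in>set cs. set v \<subseteq> T \<and> length v < e) \<and>
      (\<forall>w. set w \<subseteq> T \<longrightarrow> [\<Phi> (replicate e t @ w) = (\<Sum>(c, v)\<leftarrow>cs. c * \<Phi> (v @ w))] (mod m))"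
begin

text \<open>By the pigeonhole principle a longer word contains some letter at least \<open>e\<close>
  times.\<close>

definition basis :: "'a list set" where
  "basis = {u. set u \<subseteq> T \<and> length u \<le> card T * e}"

lemma finite_basis: "finite basis"
  unfolding basis_def by (rule finite_lists_length_le[OF T])

definition spanned :: "('a list \<Rightarrow> int) \<Rightarrow> bool" where
  "spanned g \<longleftrightarrow> (\<exists>a. \<forall>w. set w \<subseteq> T \<longrightarrow> [g w = (\<Sum>b\<in>basis. a b * \<Phi> (b @ w))] (mod m))"

lemma spanned_zero: "spanned (\<lambda>_. 0)"
  unfolding spanned_def by (intro exI[of _ "\<lambda>_. 0"]) simp

lemma spanned_add:
  assumes "spanned g" "spanned h"
  shows "spanned (\<lambda>w. c * g w + h w)"
proof -
  obtain a b where ab: "\<And>w. set w \<subseteq> T \<Longrightarrow> [g w = (\<Sum>b\<in>basis. a b * \<Phi> (b @ w))] (mod m)"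
    "\<And>w. set w \<subseteq> T \<Longrightarrow> [h w = (\<Sum>x\<in>basis. b x * \<Phi> (x @ w))] (mod m)"
    using assms unfolding spanned_def by blast
  then have "[c * g w + h w = (\<Sum>x\<in>basis. (c * a x + b x) * \<Phi> (x @ w))] (mod m)" if "set w \<subseteq> T" for w
    using cong_add[OF cong_scalar_left[OF ab(1)[OF that], of c] ab(2)[OF that]]
    by (simp add: distrib_right sum.distrib sum_distrib_left mult.assoc)
  then show ?thesis unfolding spanned_def by (intro exI[of _ "\<lambda>x. c * a x + b x"]) blast
qed

lemma spanned_sum: "finite A \<Longrightarrow> (\<And>x. x \<in> A \<Longrightarrow> spanned (g x)) \<Longrightarrow> spanned (\<lambda>w. \<Sum>x\<in>A. g x w)"
  by (induction A rule: finite_induct) (use spanned_zero spanned_add[of _ _ 1] in auto)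

lemma spanned_sum_list:
  "(\<And>c v. (c, v) \<in> set cs \<Longrightarrow> spanned (g v)) \<Longrightarrow> spanned (\<lambda>w. \<Sum>(c, v)\<leftarrow>cs. c * g v w)"
proof (induction cs)
  case (Cons cv cs)
  then show ?case by (cases cv) (auto intro!: spanned_add)
qed (simp add: spanned_zero)

lemma spanned_cong:
  "spanned h \<Longrightarrow> (\<And>w. set w \<subseteq> T \<Longrightarrow> [g w = h w] (mod m)) \<Longrightarrow> spanned g"
  unfolding spanned_def by (meson cong_trans)

lemma long_word_repeats:
  assumes "set u \<subseteq> T" "length u > card T * e"
  obtains t u' where "t \<in> T" "mset u = mset (replicate e t @ u')"
proof -
  have "\<exists>t\<in>T. Multiset.count (mset u) t \<ge> e"
  proof (rule ccontr)
    assume "\<not> ?thesis"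
    then have "Multiset.count (mset u) t \<le> e" if "t \<in> T" for t using that by (simp add: not_le less_imp_le)
    then have "sum (count_list u) T \<le> card T * e"
      using sum_bounded_above[of T "count_list u" e] by (simp add: count_mset)
    then show False using assms sum_count_set[OF assms(1) T] by simp
  qed
  then obtain t where t: "t \<in> T" "Multiset.count (mset u) t \<ge> e" by blast
  then have "replicate_mset e t \<subseteq># mset u" by (simp add: count_le_replicate_mset_subset_eq)
  moreover obtain u' where "mset u' = mset u - replicate_mset e t" using ex_mset by blast
  ultimately have "mset u = mset (replicate e t @ u')" by simp
  then show ?thesis using that t by blast
qed

text \<open>A long word is rearranged so that the power \<open>e\<close> of some letter comes first;
  reducing this power yields shorter words, which are spanned by induction.\<close>

lemma spanned_word: "set u \<subseteq> T \<Longrightarrow> spanned (\<lambda>w. \<Phi> (u @ w))"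
proof (induction "length u" arbitrary: u rule: less_induct)
  case less
  show ?case
  proof (cases "length u \<le> card T * e")
    case True
    then have "u \<in> basis" using less.prems by (simp add: basis_def)
    then have "(\<Sum>b\<in>basis. (if b = u then 1 else 0) * \<Phi> (b @ w)) = \<Phi> (u @ w)" for w
      using finite_basis by (simp add: if_distrib[of "\<lambda>x. x * _"] cong: if_cong)
    then show ?thesis unfolding spanned_def by (intro exI[of _ "\<lambda>b. if b = u then 1 else 0"]) simp
  next
    case False
    then obtain t u' where t: "t \<in> T" "mset u = mset (replicate e t @ u')"
      using long_word_repeats[OF less.prems] by auto
    obtain cs where cs: "\<And>c v. (c, v) \<in> set cs \<Longrightarrow> set v \<subseteq> T \<and> length v < e"
      "\<And>w. set w \<subseteq> T \<Longrightarrow> [\<Phi> (replicate e t @ w) = (\<Sum>(c, v)\<leftarrow>cs. c * \<Phi> (v @ w))] (mod m)"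
      using reduce[OF t(1)] by blast
    have u': "set u' \<subseteq> T" "length u = e + length u'"
      using less.prems mset_eq_setD[OF t(2)] mset_eq_length[OF t(2)] by auto
    have "spanned (\<lambda>w. \<Sum>(c, v)\<leftarrow>cs. c * \<Phi> ((v @ u') @ w))"
      by (rule spanned_sum_list, rule less.hyps) (use cs(1) u' in fastforce)+
    then show ?thesis
    proof (rule spanned_cong)
      fix w assume w: "set w \<subseteq> T"
      have "\<Phi> (u @ w) = \<Phi> (replicate e t @ u' @ w)"
        by (rule perm) (use t w less.prems in auto)
      then show "[\<Phi> (u @ w) = (\<Sum>(c, v)\<leftarrow>cs. c * \<Phi> ((v @ u') @ w))] (mod m)"
        using cs(2)[of "u' @ w"] w u' by simp
    qed
  qed
qed

text \<open>There are finitely many coefficient vectors modulo \<open>m\<close>, so two of the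
  functions \<open>\<psi> n\<close> agree modulo \<open>m\<close> in all arguments. The recursion
  then carries this agreement on; it acts on the functions, because the coefficients need not be
  unique.\<close>

lemma eventually_periodic:
  assumes D: "finite D" "\<gamma> ` D \<subseteq> T"
  shows "\<exists>N q. q > 0 \<and> (\<forall>n\<ge>N. [(\<Sum>ds\<in>words D (n + q). \<Phi> (map \<gamma> ds)) =
    (\<Sum>ds\<in>words D n. \<Phi> (map \<gamma> ds))] (mod m))"
proof -
  define \<psi> where "\<psi> n w = (\<Sum>ds\<in>words D n. \<Phi> (map \<gamma> ds @ w))" for n w
  \<comment> \<open>By symmetry of \<open>\<Phi>\<close> the head of the word may move into the
    argument. This is why \<open>\<psi>\<close> has an argument \<open>w\<close>, although only its
    value at \<open>[]\<close> is wanted.\<close>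
  have \<psi>_Suc: "\<psi> (Suc n) w = (\<Sum>d\<in>D. \<psi> n (\<gamma> d # w))" if "set w \<subseteq> T" for n w
    unfolding \<psi>_def sum_words_Suc[OF D(1)]
  proof (intro sum.cong refl perm)
    fix d ds assume "d \<in> D" "ds \<in> words D n"
    then show "set (map \<gamma> (d # ds) @ w) \<subseteq> T" using D(2) that by (auto simp: words_def)
  qed simp
  have "spanned (\<psi> n)" for n
    unfolding \<psi>_def
    by (rule spanned_sum[OF finite_words[OF D(1)]], rule spanned_word)
      (use D(2) in \<open>auto simp: words_def\<close>)
  then obtain a where a: "\<And>n w. set w \<subseteq> T \<Longrightarrow>
      [\<psi> n w = (\<Sum>b\<in>basis. a n b * \<Phi> (b @ w))] (mod m)"
    unfolding spanned_def by metis
  define a' where "a' n = (\<lambda>b\<in>basis. a n b mod m)" for n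
  have "range a' \<subseteq> basis \<rightarrow>\<^sub>E {0..<m}" using m by (auto simp: a'_def)
  then have "finite (range a')" by (rule finite_subset) (simp add: finite_PiE finite_basis)
  then have "\<not> inj a'" using finite_imageD infinite_UNIV_nat by blast
  then obtain k l where kl: "a' k = a' l" "k < l" by (metis injI nat_neq_iff)
  have "[\<psi> (k + i) w = \<psi> (l + i) w] (mod m)" if "set w \<subseteq> T" for i w
    using that
  proof (induction i arbitrary: w)
    case 0
    have "[a k b = a l b] (mod m)" if "b \<in> basis" for b
      using fun_cong[OF kl(1), of b] that by (simp add: a'_def cong_def)
    then have "[(\<Sum>b\<in>basis. a k b * \<Phi> (b @ w)) = (\<Sum>b\<in>basis. a l b * \<Phi> (b @ w))] (mod m)"
      by (intro cong_sum cong_scalar_right)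
    then show ?case using a[OF 0] by (metis add_0_right cong_sym cong_trans)
  next
    case (Suc i)
    then show ?case using D(2) by (auto simp: \<psi>_Suc intro!: cong_sum)
  qed
  from this[of "[]"] have "[\<psi> (k + i) [] = \<psi> (l + i) []] (mod m)" for i by simp
  then have "[\<psi> (n + (l - k)) [] = \<psi> n []] (mod m)" if "n \<ge> k" for n
    using kl(2) that by (metis add.commute cong_sym le_add_diff_inverse2 less_imp_le
        ordered_cancel_comm_monoid_diff_class.add_diff_assoc2 add.left_commute le_add_diff_inverse)
  then show ?thesis using kl(2) unfolding \<psi>_def
    by (intro exI[of _ k] exI[of _ "l - k"]) simp
qed

end

section \<open>Symmetry of the count and its reduction modulo prime powers\<close>

context tv_specker
begin

text \<open>An inflation consults \<open>G\<close> only at lists with more than one index or none,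
  and these are outer facts. The pullback in \<open>accepts_bij\<close> may contain further facts,
  which this lemma discards.\<close>

lemma accepts_cong:
  assumes "finite I" "\<tau> ` I \<subseteq> types" "G \<inter> outer ar I = G' \<inter> outer ar I"
  shows "accepts I \<tau> G \<longleftrightarrow> accepts I \<tau> G'"
proof -
  have img: "index ` glue_univ I \<tau> = I"
    using glue_realizes[OF assms(1,2)] by (simp add: realizes_def)
  have "(r, map index xs) \<in> G \<longleftrightarrow> (r, map index xs) \<in> G'"
    if "(r, xs) \<in> facts ar (glue_univ I \<tau>)" "\<not> is_singleton (index ` set xs)" for r xs
  proof -
    have "set (map index xs) \<subseteq> I" using that(1) img by (auto simp: facts_def)
    then have "(r, map index xs) \<in> outer ar I" using that by (simp add: outer_def facts_def)
    then show ?thesis using assms(3) by blast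
  qed
  then have "inflate ar (glue_univ I \<tau>) index S G = inflate ar (glue_univ I \<tau>) index S G'" for S
    by (auto simp: inflate_def)
  then show ?thesis by (simp add: accepts_def)
qed

lemma card_Collect_bij:
  assumes "bij_betw h A B" "\<And>x. x \<in> A \<Longrightarrow> P x \<longleftrightarrow> Q (h x)"
  shows "card {x \<in> A. P x} = card {y \<in> B. Q y}"
proof (rule bij_betw_same_card)
  have "h ` {x \<in> A. P x} = {y \<in> B. Q y}" using assms by (auto simp: bij_betw_def)
  then show "bij_betw h {x \<in> A. P x} {y \<in> B. Q y}"
    by (intro bij_betw_subset[OF assms(1)]) auto
qed

lemma bij_betw_outer:
  assumes "bij_betw \<beta> I I'"
  shows "bij_betw (\<lambda>(r, xs). (r, map \<beta> xs)) (outer ar I) (outer ar I')"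
  unfolding bij_betw_def
proof
  have \<beta>: "inj_on \<beta> I" "\<beta> ` I = I'" using assms by (auto simp: bij_betw_def)
  have sing: "is_singleton (\<beta> ` set xs) \<longleftrightarrow> is_singleton (set xs)" if "set xs \<subseteq> I" for xs
    by (rule is_singleton_image_inj[OF inj_on_subset[OF \<beta>(1) that]])
  show "inj_on (\<lambda>(r, xs). (r, map \<beta> xs)) (outer ar I)"
  proof (rule inj_onI)
    fix x y assume *: "x \<in> outer ar I" "y \<in> outer ar I"
      "(case x of (r, xs) \<Rightarrow> (r, map \<beta> xs)) = (case y of (r, xs) \<Rightarrow> (r, map \<beta> xs))"
    obtain r xs r' ys where xy: "x = (r, xs)" "y = (r', ys)" by (cases x; cases y)
    then have "set xs \<union> set ys \<subseteq> I" using * by (auto simp: outer_def facts_def)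
    then have "inj_on \<beta> (set xs \<union> set ys)" by (rule inj_on_subset[OF \<beta>(1)])
    then show "x = y" using * xy map_inj_on[of \<beta> xs ys] by auto
  qed
  show "(\<lambda>(r, xs). (r, map \<beta> xs)) ` outer ar I = outer ar I'"
  proof
    show "(\<lambda>(r, xs). (r, map \<beta> xs)) ` outer ar I \<subseteq> outer ar I'"
      using sing \<beta>(2) by (auto simp: outer_def facts_def intro!: imageI dest: subsetD)
    show "outer ar I' \<subseteq> (\<lambda>(r, xs). (r, map \<beta> xs)) ` outer ar I"
    proof clarify
      fix r ys assume ys: "(r, ys) \<in> outer ar I'"
      then have "set ys \<subseteq> \<beta> ` I" using \<beta>(2) by (simp add: outer_def facts_def)
      then obtain xs where xs: "ys = map \<beta> xs" "set xs \<subseteq> I"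
        by (metis lists_eq_set lists_image image_iff mem_Collect_eq)
      then have "(r, xs) \<in> outer ar I" using ys sing by (simp add: outer_def facts_def)
      then show "(r, ys) \<in> (\<lambda>(r, xs). (r, map \<beta> xs)) ` outer ar I" using xs(1) by force
    qed
  qed
qed

lemma nth_in_types: "set ws \<subseteq> types \<Longrightarrow> (!) ws ` {..<length ws} \<subseteq> types"
  using nth_mem by blast

text \<open>A rearrangement is a bijection of positions that preserves letters; it carries accepted
  index structures to accepted ones by \<open>accepts_bij\<close>.\<close>

lemma count_perm:
  assumes "mset ws = mset ws'" "set ws \<subseteq> types"
  shows "count ws = count ws'"
proof (cases "ws = []")
  case False
  obtain \<beta> where \<beta>: "bij_betw \<beta> {..<length ws} {..<length ws'}"
    "\<And>i. i < length ws \<Longrightarrow> ws ! i = ws' ! \<beta> i"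
    using permutation_Ex_bij[OF assms(1)] by blast
  let ?I = "{..<length ws}" and ?I' = "{..<length ws'}"
  have ws': "set ws' \<subseteq> types" using assms mset_eq_setD by blast
  let ?h = "\<lambda>(r, xs). (r, map \<beta> xs)"
  note bij = bij_betw_outer[OF \<beta>(1)]
  show ?thesis unfolding count_def
  proof (rule card_Collect_bij)
    show "bij_betw ((`) ?h) (Pow (outer ar ?I)) (Pow (outer ar ?I'))" by (rule bij_betw_Pow[OF bij])
    fix G assume G: "G \<in> Pow (outer ar ?I)"
    have "?h x \<in> ?h ` G \<longleftrightarrow> x \<in> G" if "x \<in> outer ar ?I" for x
      by (rule inj_on_image_mem_iff[OF bij_betw_imp_inj_on[OF bij] that]) (use G in simp)
    then have "{(r, xs). (r, map \<beta> xs) \<in> ?h ` G} \<inter> outer ar ?I = G \<inter> outer ar ?I"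
      by (intro set_eqI) (metis (no_types, lifting) IntE IntI case_prod_conv mem_Collect_eq prod.collapse)
    then have "accepts ?I ((!) ws) G \<longleftrightarrow> accepts ?I ((!) ws) {(r, xs). (r, map \<beta> xs) \<in> ?h ` G}"
      by (intro accepts_cong nth_in_types assms(2)) simp_all
    also have "\<dots> \<longleftrightarrow> accepts ?I' ((!) ws') (?h ` G)"
      by (rule accepts_bij[OF _ \<beta>(1)]) (use \<beta>(2) nth_in_types[OF ws'] False in auto)
    finally show "accepts ?I ((!) ws) G \<longleftrightarrow> accepts ?I' ((!) ws') (?h ` G)" .
  qed
qed (use assms in simp)

text \<open>An exact identity over the integers with the same \<open>cs\<close> for all
  \<open>w\<close>. Negative coefficients arise because irregular structures are obtained by
  subtraction; the modulus comes in only afterwards.\<close>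

definition shorter :: "nat \<Rightarrow> (nat list \<Rightarrow> int) \<Rightarrow> bool" where
  "shorter e g \<longleftrightarrow> (\<exists>cs. (\<forall>(c, v)\<in>set cs. set v \<subseteq> types \<and> length v < e) \<and>
    (\<forall>w. set w \<subseteq> types \<longrightarrow> g w = (\<Sum>(c, v)\<leftarrow>cs. c * int (count (v @ w)))))"

lemma shorter_zero: "shorter e (\<lambda>_. 0)"
  unfolding shorter_def by (intro exI[of _ "[]"]) simp

lemma shorter_count: "set v \<subseteq> types \<Longrightarrow> length v < e \<Longrightarrow> shorter e (\<lambda>w. int (count (v @ w)))"
  unfolding shorter_def by (intro exI[of _ "[(1, v)]"]) simp

lemma shorter_add:
  assumes "shorter e g" "shorter e h"
  shows "shorter e (\<lambda>w. g w + h w)"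
proof -
  obtain cs cs' where
    "\<forall>(c, v)\<in>set cs. set v \<subseteq> types \<and> length v < e"
    "\<forall>w. set w \<subseteq> types \<longrightarrow> g w = (\<Sum>(c, v)\<leftarrow>cs. c * int (count (v @ w)))"
    "\<forall>(c, v)\<in>set cs'. set v \<subseteq> types \<and> length v < e"
    "\<forall>w. set w \<subseteq> types \<longrightarrow> h w = (\<Sum>(c, v)\<leftarrow>cs'. c * int (count (v @ w)))"
    using assms unfolding shorter_def by blast
  then show ?thesis unfolding shorter_def by (intro exI[of _ "cs @ cs'"]) auto
qed

lemma shorter_uminus:
  assumes "shorter e g"
  shows "shorter e (\<lambda>w. - g w)"
proof -
  obtain cs where cs: "\<forall>(c, v)\<in>set cs. set v \<subseteq> types \<and> length v < e"
    "\<forall>w. set w \<subseteq> types \<longrightarrow> g w = (\<Sum>(c, v)\<leftarrow>cs. c * int (count (v @ w)))"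
    using assms unfolding shorter_def by blast
  have "(\<Sum>(c, v)\<leftarrow>map (\<lambda>(c, v). (- c, v)) cs. c * h v) = - (\<Sum>(c, v)\<leftarrow>cs. c * h v)" for h :: "nat list \<Rightarrow> int"
    by (induction cs) auto
  then show ?thesis unfolding shorter_def using cs
    by (intro exI[of _ "map (\<lambda>(c, v). (- c, v)) cs"]) auto
qed

lemma shorter_sum:
  "finite A \<Longrightarrow> (\<And>x. x \<in> A \<Longrightarrow> shorter e (g x)) \<Longrightarrow> shorter e (\<lambda>w. \<Sum>x\<in>A. g x w)"
  by (induction A rule: finite_induct) (auto intro: shorter_zero shorter_add)

lemma shorter_shift:
  assumes "shorter e g" "set u \<subseteq> types" "e + length u \<le> e'"
  shows "shorter e' (\<lambda>w. g (u @ w))"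
proof -
  obtain cs where cs: "\<And>c v. (c, v) \<in> set cs \<Longrightarrow> set v \<subseteq> types \<and> length v < e"
    "\<And>w. set w \<subseteq> types \<Longrightarrow> g w = (\<Sum>(c, v)\<leftarrow>cs. c * int (count (v @ w)))"
    using assms(1) unfolding shorter_def by blast
  have "(\<Sum>(c, v)\<leftarrow>map (\<lambda>(c, v). (c, v @ u)) cs. c * int (count (v @ w))) =
      (\<Sum>(c, v)\<leftarrow>cs. c * int (count (v @ u @ w)))" for w
    by (induction cs) auto
  then show ?thesis unfolding shorter_def using cs assms(2,3)
    by (intro exI[of _ "map (\<lambda>(c, v). (c, v @ u)) cs"]) fastforce
qed

text \<open>Solving \<open>irregular_Suc\<close> for the irregular structures with one more block
  produces one word of full length, which is the one subtracted here. In all other words some block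
  is a single letter, and \<open>p \<ge> 2\<close> makes them strictly shorter.\<close>

lemma shorter_irregular:
  assumes p: "p \<ge> 2" and t: "t \<in> types"
  shows "shorter (p * j) (\<lambda>w. int (card (irregular p t j w)) - int (count (replicate (p * j) t @ w)))"
    (is "shorter _ (?g j)")
proof (induction j)
  case 0
  have "?g 0 w = 0" for w by (simp add: irregular_def count_def)
  then show ?case using shorter_zero by simp
next
  case (Suc j)
  let ?B = "invariant_blocks p j ar" and ?m = "merged_type (block p j) t"
  have p0: "p > 0" using p by simp
  have m: "?m C \<in> types" for C using p by (intro merged_type_in_types t) auto
  have t': "set (replicate k t) \<subseteq> types" for k using t by auto
  have "shorter (p * Suc j) (\<lambda>w. ?g j (replicate p t @ w) +
      - (\<Sum>C\<in>?B. ?g j ([?m C] @ w) + int (count ((replicate (p * j) t @ [?m C]) @ w))))"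
    by (intro shorter_add shorter_uminus shorter_sum shorter_shift[OF Suc.IH] shorter_count
        finite_invariant_blocks[OF p0 binary]) (use p m t t' in auto)
  moreover have "?g (Suc j) w = ?g j (replicate p t @ w) +
      - (\<Sum>C\<in>?B. ?g j ([?m C] @ w) + int (count ((replicate (p * j) t @ [?m C]) @ w)))"
    if "set w \<subseteq> types" for w
  proof -
    have "replicate (p * Suc j) t @ w = replicate (p * j) t @ replicate p t @ w"
      by (simp add: replicate_add[symmetric] add.commute)
    then show ?thesis using irregular_Suc[OF p0 t that, of j] by simp
  qed
  ultimately show ?case unfolding shorter_def by auto
qed

text \<open>For \<open>2 * k\<close> blocks the irregular structures drop out modulo
  \<open>p ^ k\<close>, and what \<open>shorter_irregular\<close> leaves is the required
  reduction.\<close>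

lemma reducible_prime_power:
  assumes p: "prime p"
  shows "reducible (\<lambda>w. int (count w)) types (p * (2 * k)) (int (p ^ k))"
proof
  show "finite types" by (rule finite_types)
  show "int (p ^ k) > 0" using p by (simp add: prime_gt_0_nat)
  show "int (count u) = int (count v)" if "mset u = mset v" "set u \<subseteq> types" for u v
    using count_perm[OF that] by simp
  fix t assume t: "t \<in> types"
  let ?g = "\<lambda>w. int (card (irregular p t (2 * k) w)) - int (count (replicate (p * (2 * k)) t @ w))"
  have "shorter (p * (2 * k)) (\<lambda>w. - ?g w)"
    using p by (intro shorter_uminus shorter_irregular t) (simp add: prime_ge_2_nat)
  moreover have "[int (count (replicate (p * (2 * k)) t @ w)) = - ?g w] (mod int (p ^ k))"
    if "set w \<subseteq> types" for w
  proof -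
    have "int (p ^ k) dvd int (card (irregular p t (2 * k) w))"
      using irregular_dvd[OF p t that, of k] by (simp only: int_dvd_int_iff)
    then show ?thesis by (simp add: cong_iff_dvd_diff)
  qed
  moreover from calculation(1) obtain cs where
    "\<forall>(c, v)\<in>set cs. set v \<subseteq> types \<and> length v < p * (2 * k)"
    "\<And>w. set w \<subseteq> types \<Longrightarrow> - ?g w = (\<Sum>(c, v)\<leftarrow>cs. c * int (count (v @ w)))"
    unfolding shorter_def by blast
  ultimately show "\<exists>cs. (\<forall>(c, v)\<in>set cs. set v \<subseteq> types \<and> length v < p * (2 * k)) \<and>
      (\<forall>w. set w \<subseteq> types \<longrightarrow> [int (count (replicate (p * (2 * k)) t @ w)) =
        (\<Sum>(c, v)\<leftarrow>cs. c * int (count (v @ w)))] (mod int (p ^ k)))"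
    by (intro exI[of _ cs]) auto
qed

section \<open>Splitting an interpretation into one-point structures and an index structure\<close>

definition points :: "nat facts set" where
  "points = Pow {(r, xs) \<in> facts ar {0}. xs \<noteq> []}"

definition point_type :: "nat facts \<Rightarrow> nat" where
  "point_type d = type_of ({0}, d)"

text \<open>The universe \<open>{1..n}\<close> is indexed from \<open>0\<close>: the element \<open>x\<close> carries the point \<open>ds ! (x - 1)\<close>.\<close>

definition spread :: "nat facts list \<Rightarrow> nat facts" where
  "spread ds = {(r, xs). xs \<noteq> [] \<and> (r, map (\<lambda>_. 0) xs) \<in> ds ! (hd xs - 1)}"

abbreviation pred :: "nat \<Rightarrow> nat" where
  "pred x \<equiv> x - 1"

lemma finite_points: "finite points"
proof -
  have "{(r, xs) \<in> facts ar {0::nat}. xs \<noteq> []} \<subseteq> facts ar {0}" by auto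
  then show ?thesis unfolding points_def using finite_facts[of "{0::nat}" ar]
    by (simp add: finite_subset)
qed

lemma proper_point: "d \<in> points \<Longrightarrow> proper ({0}, d)"
  by (auto simp: points_def proper_def)

lemma point_type_in_types: "point_type ` points \<subseteq> types"
  unfolding point_type_def using type_of_in_types proper_point by blast

lemma map_pred_Suc: "set xs \<subseteq> {1..n} \<Longrightarrow> map Suc (map pred xs) = xs"
  by (auto intro!: map_idI simp: subset_iff)

lemma inj_on_pred: "inj_on pred {1..n}"
  by (auto simp: inj_on_def)

lemma pred_singleton:
  assumes "set xs \<subseteq> {1..n}"
  shows "is_singleton (pred ` set xs) \<longleftrightarrow> is_singleton (set xs)"
  by (rule is_singleton_image_inj[OF inj_on_subset[OF inj_on_pred assms]])

lemma pred_image: "pred ` {1..n} = {..<n}"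
proof
  show "{..<n} \<subseteq> pred ` {1..n}"
  proof
    fix y assume "y \<in> {..<n}"
    then have "y = pred (Suc y)" "Suc y \<in> {1..n}" by auto
    then show "y \<in> pred ` {1..n}" by (rule image_eqI)
  qed
qed auto

lemma map_const_id: "set xs \<subseteq> {c} \<Longrightarrow> map (\<lambda>_. c) xs = xs"
  by (induction xs) auto

lemma map_const_hd: "is_singleton (set xs) \<Longrightarrow> map (\<lambda>_. hd xs) xs = xs"
  by (rule map_const_id) (cases xs, auto simp: is_singleton_def)

text \<open>The fibres of \<open>pred\<close> are single points, each isomorphic to its entry of
  \<open>ds\<close>, so the inflation realizes the word of their types.\<close>

lemma holds_spread:
  assumes "ds \<in> words points n" "n \<ge> 1"
  shows "holds {1..n} (inflate ar {1..n} pred (spread ds) G) \<longleftrightarrow>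
    accepts {..<n} ((!) (map point_type ds)) G"
proof (rule accepts_realizes)
  have ds: "length ds = n" "set ds \<subseteq> points" using assms(1) by (auto simp: words_def)
  show "realizes {1..n} pred (spread ds) {..<n} ((!) (map point_type ds))"
    unfolding realizes_def
  proof (intro conjI ballI)
    show "pred ` {1..n} = {..<n}" by (rule pred_image)
    fix i assume "i \<in> {..<n}"
    then have i: "i < n" by simp
    then have fib: "fibre pred {1..n} i = {Suc i}" by (auto simp: fibre_def)
    have "ds ! i \<in> points" using ds i by (metis nth_mem subsetD)
    then have "equivalent ({0}, ds ! i) (rep (point_type (ds ! i)))"
      unfolding point_type_def by (intro equivalent_rep proper_point)
    moreover have "equivalent ({0}, ds ! i) ({Suc i}, spread ds)"
    proof (rule equivalent_iso[where h = "\<lambda>_. Suc i"])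
      fix r xs assume xs: "set xs \<subseteq> {0::nat}" "xs \<noteq> []"
      then have "map (\<lambda>_. 0) xs = xs" by (intro map_const_id)
      then show "(r, map (\<lambda>_. Suc i) xs) \<in> spread ds \<longleftrightarrow> (r, xs) \<in> ds ! i"
        using xs(2) by (simp add: spread_def hd_map comp_def)
    qed (auto simp: strict_mono_on_def)
    ultimately have "equivalent ({Suc i}, spread ds) (rep (point_type (ds ! i)))"
      using equivalent_sym equivalent_trans by metis
    then show "equivalent (fibre pred {1..n} i, spread ds) (rep (map point_type ds ! i))"
      unfolding fib using i ds(1) by simp
  qed simp
  show "(!) (map point_type ds) ` {..<n} \<subseteq> types"
  proof -
    have "set (map point_type ds) \<subseteq> types" using point_type_in_types ds(2) by auto
    from nth_in_types[OF this] show ?thesis by (simp only: length_map ds(1))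
  qed
  show "{..<n} \<noteq> {}" using assms(2) by (auto simp: lessThan_empty_iff)
qed

text \<open>The loops of an interpretation form the one-point structures, and the remaining facts
  form the index structure. Nullary facts go to the latter, which is why \<open>points\<close>
  excludes empty lists.\<close>

lemma spread_bij:
  "bij_betw (\<lambda>(ds, G). inflate ar {1..n} pred (spread ds) G)
    (words points n \<times> Pow (outer ar {..<n})) (Pow (facts ar {1..n}))"
proof (rule bij_betw_byWitness[where f' =
    "\<lambda>Q. (map (\<lambda>i. {(r, xs) \<in> facts ar {0}. xs \<noteq> [] \<and> (r, map (\<lambda>_. Suc i) xs) \<in> Q}) [0..<n],
      {(r, xs) \<in> outer ar {..<n}. (r, map Suc xs) \<in> Q})"])
  let ?F = "\<lambda>(ds, G). inflate ar {1..n} pred (spread ds) G"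
  let ?P = "\<lambda>Q i. {(r, xs) \<in> facts ar {0::nat}. xs \<noteq> [] \<and> (r, map (\<lambda>_. Suc i) xs) \<in> Q}"
  let ?f = "\<lambda>Q. (map (?P Q) [0..<n], {(r, xs) \<in> outer ar {..<n}. (r, map Suc xs) \<in> Q})"
  show "\<forall>a\<in>words points n \<times> Pow (outer ar {..<n}). ?f (?F a) = a"
  proof
    fix a assume a_mem: "a \<in> words points n \<times> Pow (outer ar {..<n})"
    obtain ds G where a: "a = (ds, G)" by (cases a)
    have ds: "length ds = n" "set ds \<subseteq> points" and G: "G \<subseteq> outer ar {..<n}"
      using a_mem by (simp_all add: a words_def)
    let ?Q = "inflate ar {1..n} pred (spread ds) G"
    have "?P ?Q i = ds ! i" if "i < n" for i
    proof (rule set_eqI, clarify)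
      fix r xs
      have d: "ds ! i \<subseteq> {(r, xs) \<in> facts ar {0}. xs \<noteq> []}"
      proof -
        have "ds ! i \<in> points" using ds that by (metis nth_mem subsetD)
        then show ?thesis unfolding points_def by simp
      qed
      show "(r, xs) \<in> ?P ?Q i \<longleftrightarrow> (r, xs) \<in> ds ! i"
      proof (cases "(r, xs) \<in> facts ar {0} \<and> xs \<noteq> []")
        case True
        then have xs: "set xs = {0}" "xs \<noteq> []" by (cases xs, auto simp: facts_def)
        have "map (\<lambda>_. 0) xs = xs" by (rule map_const_id, rule equalityD1, rule xs(1))
        moreover have "set (map (\<lambda>_. Suc i) xs) = {Suc i}" using xs by auto
        moreover have "(r, map (\<lambda>_. Suc i) xs) \<in> facts ar {1..n}"
          using True that by (auto simp: facts_def)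
        ultimately show ?thesis
          using True by (simp add: inflate_def spread_def hd_map comp_def)
      next
        case False
        then show ?thesis using d by blast
      qed
    qed
    then have "map (?P ?Q) [0..<n] = ds" using ds(1) by (intro nth_equalityI) simp_all
    moreover have "{(r, xs) \<in> outer ar {..<n}. (r, map Suc xs) \<in> ?Q} = G"
    proof -
      have "(r, map Suc xs) \<in> ?Q \<longleftrightarrow> (r, xs) \<in> G" if "(r, xs) \<in> outer ar {..<n}" for r xs
      proof -
        have "(r, map Suc xs) \<in> facts ar {1..n}" using that by (auto simp: outer_def facts_def)
        moreover have "\<not> is_singleton (pred ` set (map Suc xs))"
          using that by (simp add: outer_def image_image)
        ultimately show ?thesis by (simp add: inflate_def comp_def)
      qed
      then show ?thesis using G by auto
    qed
    ultimately show "?f (?F a) = a" by (simp only: a case_prod_conv)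
  qed
  show "\<forall>Q\<in>Pow (facts ar {1..n}). ?F (?f Q) = Q"
  proof
    fix Q assume "Q \<in> Pow (facts ar {1..n})"
    then have Q: "Q \<subseteq> facts ar {1..n}" by simp
    have "(r, xs) \<in> ?F (?f Q) \<longleftrightarrow> (r, xs) \<in> Q" for r xs
    proof (cases "(r, xs) \<in> facts ar {1..n}")
      case True
      then have xs: "set xs \<subseteq> {1..n}" "r < length ar" "length xs = ar ! r" by (auto simp: facts_def)
      show ?thesis
      proof (cases "is_singleton (set xs)")
        case sing: True
        then have "xs \<noteq> []" by (auto simp: is_singleton_def)
        then have hd: "hd xs \<in> {1..n}" using xs(1) hd_in_set by blast
        then have S: "Suc (pred (hd xs)) = hd xs" "pred (hd xs) < n" by auto
        have "(r, xs) \<in> ?F (?f Q) \<longleftrightarrow> (r, map (\<lambda>_. 0) xs) \<in> ?P Q (pred (hd xs))"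
          using True sing \<open>xs \<noteq> []\<close> S(2)
          by (simp add: inflate_def pred_singleton[OF xs(1)] spread_def del: One_nat_def)
        also have "\<dots> \<longleftrightarrow> (r, map (\<lambda>_. hd xs) xs) \<in> Q"
          using xs \<open>xs \<noteq> []\<close> S(1) by (auto simp: facts_def comp_def simp del: One_nat_def)
        finally show ?thesis by (simp only: map_const_hd[OF sing])
      next
        case False
        have "set (map pred xs) \<subseteq> {..<n}" using xs(1) pred_image[of n] by auto
        then have "(r, map pred xs) \<in> outer ar {..<n}"
          using False xs pred_singleton[OF xs(1)] by (simp add: outer_def facts_def)
        then show ?thesis using True False map_pred_Suc[OF xs(1)]
          by (simp add: inflate_def pred_singleton[OF xs(1)] del: map_map One_nat_def)
      qed
    next
      case False
      then show ?thesis using Q by (auto simp: inflate_def)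
    qed
    then show "?F (?f Q) = Q" by (intro set_eqI) (simp only: split_paired_all)
  qed
  show "?F ` (words points n \<times> Pow (outer ar {..<n})) \<subseteq> Pow (facts ar {1..n})"
    by (auto simp: inflate_def)
  show "?f ` Pow (facts ar {1..n}) \<subseteq> words points n \<times> Pow (outer ar {..<n})"
    by (auto simp: words_def points_def)
qed

text \<open>The sum runs over words of one-point structures and not of types, so distinct points of
  the same type are counted separately.\<close>

lemma card_holds:
  assumes "n \<ge> 1"
  shows "card {Q \<in> Pow (facts ar {1..n}). holds {1..n} Q} =
    (\<Sum>ds\<in>words points n. count (map point_type ds))"
proof -
  let ?F = "\<lambda>(ds, G). inflate ar {1..n} pred (spread ds) G"
  let ?P = "\<lambda>(ds, G). accepts {..<n} ((!) (map point_type ds)) G"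
  let ?X = "words points n \<times> Pow (outer ar {..<n})"
  have "card {Q \<in> Pow (facts ar {1..n}). holds {1..n} Q} = card {x \<in> ?X. ?P x}"
    by (rule card_Collect_bij[OF spread_bij, symmetric]) (use holds_spread[OF _ assms] in auto)
  also have "{x \<in> ?X. ?P x} = (SIGMA ds:words points n.
      {G \<in> Pow (outer ar {..<n}). accepts {..<n} ((!) (map point_type ds)) G})" by auto
  also have "card \<dots> = (\<Sum>ds\<in>words points n.
      card {G \<in> Pow (outer ar {..<n}). accepts {..<n} ((!) (map point_type ds)) G})"
    by (rule card_SigmaI) (auto simp: finite_words finite_points finite_outer)
  also have "\<dots> = (\<Sum>ds\<in>words points n. count (map point_type ds))"
    by (rule sum.cong) (auto simp: count_def words_def)
  finally show ?thesis .
qed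

lemma interps_bij:
  "bij_betw (\<lambda>Q. restrict (relations Q) {..<length ar}) (Pow (facts ar U)) (interps ar U)"
proof (rule bij_betw_byWitness[where f' = "\<lambda>R. {(r, xs). r < length ar \<and> xs \<in> R r}"])
  show "\<forall>Q\<in>Pow (facts ar U). {(r, xs). r < length ar \<and> xs \<in> restrict (relations Q) {..<length ar} r} = Q"
    by (auto simp: relations_def facts_def)
  show "\<forall>R\<in>interps ar U. restrict (relations {(r, xs). r < length ar \<and> xs \<in> R r}) {..<length ar} = R"
    by (auto simp: interps_def relations_def PiE_def extensional_def restrict_def fun_eq_iff)
  show "(\<lambda>Q. restrict (relations Q) {..<length ar}) ` Pow (facts ar U) \<subseteq> interps ar U"
    unfolding interps_def by (rule image_subsetI, rule restrict_PiE_iff[THEN iffD2])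
      (auto simp: relations_def facts_def)
  show "(\<lambda>R. {(r, xs). r < length ar \<and> xs \<in> R r}) ` interps ar U \<subseteq> Pow (facts ar U)"
    by (fastforce simp: interps_def facts_def PiE_def Pi_def)
qed

lemma card_models:
  assumes "n \<ge> 1"
  shows "card {R \<in> interps ar {1..n}. tv_models {1..n} R \<phi>} =
    (\<Sum>ds\<in>words points n. count (map point_type ds))"
proof -
  have "card {Q \<in> Pow (facts ar {1..n}). holds {1..n} Q} =
    card {R \<in> interps ar {1..n}. tv_models {1..n} R \<phi>}"
  proof (rule card_Collect_bij[OF interps_bij])
    fix Q :: "nat facts" assume Q: "Q \<in> Pow (facts ar {1..n})"
    let ?R = "restrict (relations Q) {..<length ar}" and ?L = "lex_order (\<lambda>x::nat. x)"
    have "?R \<in> interps ar {1..n}" using interps_bij[of "{1..n}"] Q by (auto simp: bij_betw_def)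
    then have "tv_models {1..n} ?R \<phi> \<longleftrightarrow> models {1..n} (?L \<inter> {1..n} \<times> {1..n}) ?R \<phi>"
      using tv assms lex_order_linear by (intro tv_models_iff)
    also have "\<dots> \<longleftrightarrow> models {1..n} (?L \<inter> {1..n} \<times> {1..n}) (relations Q) \<phi>"
      unfolding models_def by (rule sat_restrict[OF wf])
    also have "\<dots> \<longleftrightarrow> holds {1..n} Q"
      unfolding models_restrict_order using Q assms by (intro holds_lex[symmetric]) auto
    finally show "holds {1..n} Q \<longleftrightarrow> tv_models {1..n} ?R \<phi>" ..
  qed
  then show ?thesis using card_holds[OF assms] by simp
qed

end

section \<open>Periodicity modulo every number\<close>

definition eventually_periodic_mod :: "(nat \<Rightarrow> nat) \<Rightarrow> nat \<Rightarrow> bool" where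
  "eventually_periodic_mod f m \<longleftrightarrow> (\<exists>N q. q > 0 \<and> (\<forall>n\<ge>N. [f (n + q) = f n] (mod m)))"

text \<open>Multiples of a period are periods, so the product of the two periods serves for both
  moduli.\<close>

lemma eventually_periodic_mod_mult:
  assumes "eventually_periodic_mod f a" "eventually_periodic_mod f b" "coprime a b"
  shows "eventually_periodic_mod f (a * b)"
proof -
  have iter: "[f (n + c * q) = f n] (mod m)" if "\<And>n. n \<ge> N \<Longrightarrow> [f (n + q) = f n] (mod m)" "n \<ge> N"
    for m N q n c
  proof (induction c)
    case (Suc c)
    have "[f (n + c * q + q) = f (n + c * q)] (mod m)" using that by simp
    then show ?case using Suc by (metis add.assoc add.commute cong_trans mult_Suc)
  qed simp
  obtain N q N' q' where q: "q > 0" "\<And>n. n \<ge> N \<Longrightarrow> [f (n + q) = f n] (mod a)"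
    "q' > 0" "\<And>n. n \<ge> N' \<Longrightarrow> [f (n + q') = f n] (mod b)"
    using assms unfolding eventually_periodic_mod_def by blast
  have "[f (n + q * q') = f n] (mod a * b)" if "n \<ge> max N N'" for n
    using iter[of N q a n q'] iter[of N' q' b n q] q(2,4) that assms(3)
    by (intro coprime_cong_mult_nat) (simp_all add: mult.commute)
  then show ?thesis unfolding eventually_periodic_mod_def using q(1,3)
    by (intro exI[of _ "max N N'"] exI[of _ "q * q'"]) simp
qed

text \<open>Splitting off the full power of one prime divisor leaves a smaller factor that is
  coprime to it.\<close>

lemma eventually_periodic_mod_all:
  assumes "\<And>p k. prime p \<Longrightarrow> eventually_periodic_mod f (p ^ k)" "m \<ge> 1"
  shows "eventually_periodic_mod f m"
  using assms(2)
proof (induction m rule: less_induct)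
  case (less m)
  show ?case
  proof (cases "m = 1")
    case True
    \<comment> \<open>The modulus 1 is the prime power \<open>2 ^ 0\<close>.\<close>
    then show ?thesis using assms(1)[of 2 0] by simp
  next
    case False
    then obtain p where p: "prime p" "p dvd m" using prime_factor_nat by blast
    have "m \<noteq> 0" using less.prems by simp
    then obtain m' where m': "m = p ^ multiplicity p m * m'" "\<not> p dvd m'"
      using multiplicity_decompose'[of m p] p(1) by (metis not_prime_unit)
    have "multiplicity p m > 0" using p \<open>m \<noteq> 0\<close> by (simp add: prime_multiplicity_gt_zero_iff)
    then have "p ^ multiplicity p m > 1" using p(1) by (metis one_less_power prime_gt_1_nat)
    then have "m' \<ge> 1" "m' < m" using m'(1) \<open>m \<noteq> 0\<close> by (metis Suc_leI One_nat_def mult_0_right neq0_conv,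
      metis mult_less_cancel2 mult_1 m'(1) neq0_conv mult_0_right)
    moreover have "coprime (p ^ multiplicity p m) m'"
      using p(1) m'(2) by (simp add: prime_imp_coprime)
    ultimately show ?thesis
      using eventually_periodic_mod_mult[OF assms(1)[OF p(1)] less.IH[of m']] m'(1) by metis
  qed
qed

lemma specker_eventually_periodic:
  assumes "tvmsol_specker 2 f" "prime p"
  shows "eventually_periodic_mod f (p ^ k)"
proof -
  obtain ar \<phi> where ar: "\<forall>r\<in>set ar. r \<le> 2" "\<phi> \<in> TVMSOL ar"
    and f: "\<And>n. n \<ge> 1 \<Longrightarrow> f n = card {R \<in> interps ar {1..n}. tv_models {1..n} R \<phi>}"
    using assms(1) unfolding tvmsol_specker_def by blast
  interpret tv_specker ar \<phi> by unfold_locales (use ar in auto)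
  interpret reducible "\<lambda>w. int (count w)" types "p * (2 * k)" "int (p ^ k)"
    by (rule reducible_prime_power[OF assms(2)])
  obtain N q where q: "q > 0" "\<And>n. n \<ge> N \<Longrightarrow>
      [(\<Sum>ds\<in>words points (n + q). int (count (map point_type ds))) =
       (\<Sum>ds\<in>words points n. int (count (map point_type ds)))] (mod int (p ^ k))"
    using eventually_periodic[OF finite_points point_type_in_types] by blast
  \<comment> \<open>The bound 1 enters because \<open>f 0\<close> is unconstrained.\<close>
  have "[f (n + q) = f n] (mod p ^ k)" if "n \<ge> max N 1" for n
  proof -
    have "[int (f (n + q)) = int (f n)] (mod int (p ^ k))"
      using q(2)[of n] that f[of n] f[of "n + q"] card_models[of n] card_models[of "n + q"] by simp
    then show ?thesis by (simp only: cong_int_iff)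
  qed
  then show ?thesis unfolding eventually_periodic_mod_def using q(1) by blast
qed

theorem theorem13:
  fixes f :: "nat \<Rightarrow> nat" and m :: nat
  assumes "tvmsol_specker 2 f" and "m \<ge> 1"
  shows "\<exists>d\<ge>1. \<exists>a :: nat \<Rightarrow> int. \<forall>n>d.
    [int (f n) = (\<Sum>j=1..d. a j * int (f (n - j)))] (mod int m)"
proof -
  have "eventually_periodic_mod f m"
    using specker_eventually_periodic[OF assms(1)] assms(2) by (rule eventually_periodic_mod_all)
  then obtain N q where q: "q > 0" "\<And>n. n \<ge> N \<Longrightarrow> [f (n + q) = f n] (mod m)"
    unfolding eventually_periodic_mod_def by blast
  \<comment> \<open>Periodicity is the recurrence in which only the coefficient at
    \<open>j = q\<close> is 1. The depth \<open>N + q\<close> is padded with zero coefficients, so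
    that \<open>n - q\<close> exceeds \<open>N\<close> whenever the recurrence applies.\<close>
  show ?thesis
  proof (intro exI[of _ "N + q"] exI[of _ "\<lambda>j. if j = q then 1 else 0"] conjI allI impI)
    fix n assume n: "n > N + q"
    have "(\<Sum>j=1..N + q. (if j = q then 1 else 0) * int (f (n - j))) = int (f (n - q))"
      using q(1) by (simp add: if_distrib[of "\<lambda>x. x * _"] cong: if_cong)
    moreover have "[f n = f (n - q)] (mod m)" using q(2)[of "n - q"] n by simp
    ultimately show "[int (f n) = (\<Sum>j=1..N + q. (if j = q then 1 else 0) * int (f (n - j)))] (mod int m)"
      by (simp only: cong_int_iff)
  qed (use q in simp)
qed

end
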